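(* Let $\underline\lambda$ be a block column Schubert problem on $G(a,b)$ and $\underline\rho$ a Schubert problem on $G(c,d)$ (written as $\underline\rho=(\underline\alpha,\underline\beta,\underline\gamma)$ with $\underline\alpha$ of length $2$ and $\underline\beta$ of length $p+q$, so that it can be composed with $\underline\lambda$ via the composable partition with $\underline a=(a_1,a_2)$, $\underline b=(m_1,\dots,m_p,n_1,\dots,n_q)$). Then the composed Schubert problem $\underline\lambda\circ\underline\rho$ on $G(a+c,b+d)$ is fibered over $\underline\lambda$ with fiber $\underline\rho$.
   Context: Partitions are weakly decreasing finite sequences of positive integers (empty allowed); $\Box_{a,b}$ is the partition with $a$ parts equal to $b$; $\mu+\nu$ has $k$-th part $\mu_k+\nu_k$; $(\mu,\nu)$ is the decreasing rearrangement of the concatenated parts. For a vector space $V$, $\mathrm{Gr}(a,V)$ is the Grassmannian of $a$-dimensional subspaces, $G(a,b)=\mathrm{Gr}(a,\mathbb{C}^{a+b})$. For a complete flag $F_\bullet$ ($\dim F_i=i$) and $\lambda\subseteq\Box_{a,b}$, $\Omega_\lambda F_\bullet=\{H:\dim H\cap F_{b+i-\lambda_i}\ge i,\ i=1,\dots,a\}$. A Schubert problem on $G(a,b)$ is a list $\underline\lambda=(\lambda^1,\dots,\lambda^r)$ of partitions in $\Box_{a,b}$ with $\sum|\lambda^i|=ab$; an instance is given by flags $\mathcal F_\bullet=(F^1_\bullet,\dots,F^r_\bullet)$ and its solution set is $\Omega_{\underline\lambda}\mathcal F_\bullet=\bigcap_i\Omega_{\lambda^i}F^i_\bullet$. A block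 column Schubert problem on $G(a,b)$ is $\underline\lambda=(\underline\mu,\underline\nu)$ with $\underline\mu=(\Box_{a_1,b_1},\Box_{a_2,b_2})$, $a=a_1+a_2$, $b=b_1+b_2$, $\underline\nu=(\Box_{a_2,m_1},\dots,\Box_{a_2,m_p},\Box_{a_1,n_1},\dots,\Box_{a_1,n_q})$, $\sum m_i=b_1$, $\sum n_j=b_2$. For a composable partition $\underline\mu=(\mu^1,\dots,\mu^r)$, $\underline\nu=(\nu^1,\dots,\nu^s)$, $\underline a$, $\underline b$ (with $\sum a_i=a$, $\sum b_j=b$, $a_i\ge\ell(\mu^i)$, $b_j\ge\nu^j_1$) and a Schubert problem $\underline\rho=(\underline\alpha,\underline\beta,\underline\gamma)$ on $G(c,d)$ split into lists of lengths $r,s,t$, the composition $\underline\lambda\circ\underline\rho$ is the list $(\Box_{a_i,d}+\mu^i,\alpha^i)$ ($i\le r$), $(\Box_{c,b_j},\nu^j)+\beta^j$ ($j\le s$), $\gamma^k$ ($k\le t$), a Schubert problem on $G(a+c,b+d)$. Fibration: a Schubert problem $\underline\kappa$ on $G(a+c,b+d)$ is fibered over $\underline\lambda$ (on $G(a,b)$) with fiber $\underline\rho$ (on $G(c,d)$) if: (1) for every general instance $\mathcal F_\bullet$ of $\underline\kappa$ there are a subspace $V\subset\mathbb{C}^{a+b+c+d}$ of dimension $a+b$ and an instance $\mathcal E_\bullet$ of $\underline\lambda$ in $\mathrm{Gr}(a,V)$ such that $H\cap V\in\Omega_{\underline\lambda}\mathcal E_\bullet$ for every $H\in\Omega_{\underline\kappa}\mathcal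 F_\bullet$; (2) with $W:=\mathbb{C}^{a+b+c+d}/V$, for every $h\in\Omega_{\underline\lambda}\mathcal E_\bullet$ there is an instance $\mathcal F_\bullet(h)$ of $\underline\rho$ in $\mathrm{Gr}(c,W)$ such that whenever $H\in\Omega_{\underline\kappa}\mathcal F_\bullet$ with $H\cap V=h$, $H/h$ (identified with a $c$-dimensional subspace of $W$) lies in $\Omega_{\underline\rho}\mathcal F_\bullet(h)$; (3) $H\mapsto(H\cap V,H/(H\cap V))$ is a bijection between $\Omega_{\underline\kappa}\mathcal F_\bullet$ and the set of pairs $(h,K)$ with $h\in\Omega_{\underline\lambda}\mathcal E_\bullet$ and $K\in\Omega_{\underline\rho}\mathcal F_\bullet(h)$; (4) for a given $V$ all general instances $\mathcal E_\bullet$ of $\underline\lambda$ in $\mathrm{Gr}(a,V)$ arise in (1), and for general $\mathcal E_\bullet$ and $h\in\Omega_{\underline\lambda}\mathcal E_\bullet$ the instances $\mathcal F_\bullet(h)$ of $\underline\rho$ that arise are general. *)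

theory Defs
  imports Complex_Main "HOL-Library.Function_Algebras"
begin

text \<open>Vectors are functions nat to complex; C^N is the set of vectors
supported in the first N coordinates.  Subspaces of a quotient V1/V0 are
represented (correspondence theorem) by subspaces K with V0 <= K <= V1.\<close>

type_synonym cvec = "nat \<Rightarrow> complex"

definition cscale :: "complex \<Rightarrow> cvec \<Rightarrow> cvec" where
  "cscale c v = (\<lambda>i. c * v i)"

interpretation cv: vector_space cscale
  by unfold_locales (auto simp: cscale_def algebra_simps fun_eq_iff)

definition ambient :: "nat \<Rightarrow> cvec set" where
  "ambient N = {v. \<forall>i\<ge>N. v i = 0}"

definition csum :: "cvec set \<Rightarrow> cvec set \<Rightarrow> cvec set" where
  "csum H V = cv.span (H \<union> V)"

definition is_partition :: "nat list \<Rightarrow> bool" where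
  "is_partition lam \<longleftrightarrow> sorted_wrt (\<ge>) lam \<and> 0 \<notin> set lam"

definition part :: "nat list \<Rightarrow> nat \<Rightarrow> nat" where
  "part lam i = (if 1 \<le> i \<and> i \<le> length lam then lam ! (i - 1) else 0)"

definition in_box :: "nat \<Rightarrow> nat \<Rightarrow> nat list \<Rightarrow> bool" where
  "in_box k l lam \<longleftrightarrow> length lam \<le> k \<and> (\<forall>x\<in>set lam. x \<le> l)"

definition box :: "nat \<Rightarrow> nat \<Rightarrow> nat list" where
  "box k l = (if l = 0 then [] else replicate k l)"

definition padd :: "nat list \<Rightarrow> nat list \<Rightarrow> nat list" where
  "padd mu nu = map (\<lambda>i. part mu (Suc i) + part nu (Suc i)) [0..<max (length mu) (length nu)]"

definition pcat :: "nat list \<Rightarrow> nat list \<Rightarrow> nat list" where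
  "pcat mu nu = rev (sort (mu @ nu))"

definition schubert_problem :: "nat \<Rightarrow> nat \<Rightarrow> nat list list \<Rightarrow> bool" where
  "schubert_problem k l lams \<longleftrightarrow>
     (\<forall>lam\<in>set lams. is_partition lam \<and> in_box k l lam) \<and>
     sum_list (map sum_list lams) = k * l"

text \<open>Composition lam o rho, where rho = alphas @ betas @ gammas,
length alphas = length mus, length betas = length nus.\<close>
definition compose ::
  "nat list list \<Rightarrow> nat list list \<Rightarrow> nat list \<Rightarrow> nat list \<Rightarrow> nat \<Rightarrow> nat \<Rightarrow>
   nat list list \<Rightarrow> nat list list \<Rightarrow> nat list list \<Rightarrow> nat list list" where
  "compose mus nus as bs c d als bes gas =
     map (\<lambda>i. pcat (padd (box (as ! i) d) (mus ! i)) (als ! i)) [0..<length mus] @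
     map (\<lambda>j. padd (pcat (box c (bs ! j)) (nus ! j)) (bes ! j)) [0..<length nus] @
     gas"

definition block_column :: "nat \<Rightarrow> nat \<Rightarrow> nat \<Rightarrow> nat \<Rightarrow> nat list \<Rightarrow> nat list \<Rightarrow> nat list list" where
  "block_column a1 a2 b1 b2 ms ns =
     [box a1 b1, box a2 b2] @ map (box a2) ms @ map (box a1) ns"

definition qdim :: "cvec set \<Rightarrow> cvec set \<Rightarrow> nat" where
  "qdim V0 V1 = cv.dim V1 - cv.dim V0"

definition is_flag :: "cvec set \<Rightarrow> cvec set \<Rightarrow> (nat \<Rightarrow> cvec set) \<Rightarrow> bool" where
  "is_flag V0 V1 F \<longleftrightarrow>
     (\<forall>j\<le>qdim V0 V1. cv.subspace (F j) \<and> V0 \<subseteq> F j \<and> F j \<subseteq> V1 \<and>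
        cv.dim (F j) = cv.dim V0 + j) \<and>
     (\<forall>j<qdim V0 V1. F j \<subseteq> F (Suc j))"

definition is_instance :: "cvec set \<Rightarrow> cvec set \<Rightarrow> nat \<Rightarrow> (nat \<Rightarrow> nat \<Rightarrow> cvec set) \<Rightarrow> bool" where
  "is_instance V0 V1 r Fs \<longleftrightarrow> (\<forall>k<r. is_flag V0 V1 (Fs k))"

definition inst_eq :: "cvec set \<Rightarrow> cvec set \<Rightarrow> nat \<Rightarrow> (nat \<Rightarrow> nat \<Rightarrow> cvec set) \<Rightarrow> (nat \<Rightarrow> nat \<Rightarrow> cvec set) \<Rightarrow> bool" where
  "inst_eq V0 V1 r Fs Gs \<longleftrightarrow> (\<forall>k<r. \<forall>j\<le>qdim V0 V1. Fs k j = Gs k j)"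

definition grass :: "cvec set \<Rightarrow> cvec set \<Rightarrow> nat \<Rightarrow> cvec set set" where
  "grass V0 V1 k = {K. cv.subspace K \<and> V0 \<subseteq> K \<and> K \<subseteq> V1 \<and> cv.dim K = cv.dim V0 + k}"

text \<open>Omega_lam F in Gr(k, V1/V0) with b = qdim - k:
 dim (K/V0 \<inter> F_{b+i-lam_i}/V0) >= i.\<close>
definition schubert :: "cvec set \<Rightarrow> cvec set \<Rightarrow> nat \<Rightarrow> nat list \<Rightarrow> (nat \<Rightarrow> cvec set) \<Rightarrow> cvec set set" where
  "schubert V0 V1 k lam F =
     {K \<in> grass V0 V1 k. \<forall>i\<in>{1..k}.
        cv.dim (K \<inter> F (qdim V0 V1 - k + i - part lam i)) \<ge> cv.dim V0 + i}"

definition sol :: "cvec set \<Rightarrow> cvec set \<Rightarrow> nat \<Rightarrow> nat list list \<Rightarrow> (nat \<Rightarrow> nat \<Rightarrow> cvec set) \<Rightarrow> cvec set set" where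
  "sol V0 V1 k lams Fs = {K \<in> grass V0 V1 k. \<forall>i<length lams. K \<in> schubert V0 V1 k (lams ! i) (Fs i)}"

inductive_set cpoly :: "((nat \<Rightarrow> complex) \<Rightarrow> complex) set" where
  const: "(\<lambda>x. c) \<in> cpoly"
| var: "(\<lambda>x. x i) \<in> cpoly"
| add: "f \<in> cpoly \<Longrightarrow> g \<in> cpoly \<Longrightarrow> (\<lambda>x. f x + g x) \<in> cpoly"
| mult: "f \<in> cpoly \<Longrightarrow> g \<in> cpoly \<Longrightarrow> (\<lambda>x. f x * g x) \<in> cpoly"

definition frame :: "cvec set \<Rightarrow> cvec set \<Rightarrow> (nat \<Rightarrow> cvec) \<Rightarrow> bool" where
  "frame V0 V1 w \<longleftrightarrow> cv.subspace V0 \<and> cv.subspace V1 \<and> V0 \<subseteq> V1 \<and> cv.dim V1 \<ge> cv.dim V0 \<and>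
     cv.span (V0 \<union> w ` {..<qdim V0 V1}) = V1"

text \<open>Parametrisation of tuples of flags in V1/V0 by coordinates x:
 flag k is spanned (mod V0) by the vectors u k 0, u k 1, ...\<close>
definition flags_of :: "cvec set \<Rightarrow> cvec set \<Rightarrow> (nat \<Rightarrow> cvec) \<Rightarrow> (nat \<Rightarrow> complex) \<Rightarrow> nat \<Rightarrow> nat \<Rightarrow> cvec set" where
  "flags_of V0 V1 w x k j =
     (let m = qdim V0 V1 in
      cv.span (V0 \<union> {(\<Sum>i<m. cscale (x ((k * m + l) * m + i)) (w i)) | l. l < j}))"

definition general :: "cvec set \<Rightarrow> cvec set \<Rightarrow> ((nat \<Rightarrow> nat \<Rightarrow> cvec set) \<Rightarrow> bool) \<Rightarrow> bool" where
  "general V0 V1 P \<longleftrightarrow>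
     (\<exists>w f. frame V0 V1 w \<and> f \<in> cpoly \<and> (\<exists>x. f x \<noteq> 0) \<and>
        (\<forall>x. f x \<noteq> 0 \<longrightarrow> P (flags_of V0 V1 w x)))"

text \<open>kap on G(a+c,b+d) fibered over lam (on G(a,b)) with fiber rho (on G(c,d)).
The general instances of kap are those given by parameters x with fO x ~= 0;
Vf, Ef, Fhf are the constructions of V, E and F(h) in (1), (2).\<close>
definition fibered ::
  "nat \<Rightarrow> nat \<Rightarrow> nat \<Rightarrow> nat \<Rightarrow> nat list list \<Rightarrow> nat list list \<Rightarrow> nat list list \<Rightarrow> bool" where
  "fibered a b c d kap lam rho \<longleftrightarrow>
    (let U = ambient (a + b + c + d); Z = {0} in
     \<exists>w fO Vf Ef Fhf.
       frame Z U w \<and> fO \<in> cpoly \<and> (\<exists>x. fO x \<noteq> 0) \<and>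
       (\<forall>x. fO x \<noteq> 0 \<longrightarrow>
          (let F = flags_of Z U w x; V = Vf F; E = Ef F in
            is_instance Z U (length kap) F \<and>
            cv.subspace V \<and> V \<subseteq> U \<and> cv.dim V = a + b \<and>
            is_instance Z V (length lam) E \<and>
            (\<forall>H\<in>sol Z U (a + c) kap F. H \<inter> V \<in> sol Z V a lam E) \<and>
            (\<forall>h\<in>sol Z V a lam E.
               is_instance V U (length rho) (Fhf F h) \<and>
               (\<forall>H\<in>sol Z U (a + c) kap F. H \<inter> V = h \<longrightarrow>
                   csum H V \<in> sol V U c rho (Fhf F h))) \<and>
            bij_betw (\<lambda>H. (H \<inter> V, csum H V)) (sol Z U (a + c) kap F)
               (SIGMA h:sol Z V a lam E. sol V U c rho (Fhf F h)))) \<and>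
       (\<forall>x0. fO x0 \<noteq> 0 \<longrightarrow>
          (let V = Vf (flags_of Z U w x0) in
            general Z V (\<lambda>E. \<exists>x. fO x \<noteq> 0 \<and> Vf (flags_of Z U w x) = V \<and>
                 inst_eq Z V (length lam) (Ef (flags_of Z U w x)) E) \<and>
            general Z V (\<lambda>E. \<forall>h\<in>sol Z V a lam E.
               general V U (\<lambda>G. \<exists>x. fO x \<noteq> 0 \<and> Vf (flags_of Z U w x) = V \<and>
                 inst_eq Z V (length lam) (Ef (flags_of Z U w x)) E \<and>
                 inst_eq V U (length rho) (Fhf (flags_of Z U w x) h) G)))))"

end

theory Submission
  imports Defs "HOL-Computational_Algebra.Polynomial" "HOL-Library.FuncSet"
begin

text \<open>Write \<open>F\<^sup>1, F\<^sup>2, \<dots>\<close> for general flags in the ambient space \<open>U\<close>, \<open>V\<close> for the sum of the steps of dimensions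
  \<open>a1 + b2\<close> of \<open>F\<^sup>1\<close> and \<open>a2 + b1\<close> of \<open>F\<^sup>2\<close>, and \<open>G\<^sub>j\<close> for the step of the \<open>j\<close>-th remaining flag of the block
  column problem at its corner. A solution \<open>H\<close> of the composed problem meets \<open>V\<close> in a solution \<open>h\<close> of the base problem for
  the flags induced in \<open>V\<close>, and it is contained in the intersection \<open>T h\<close> of all \<open>h + G\<^sub>j\<close>. As \<open>T h \<inter> V = h\<close> and
  \<open>T h + V = U\<close>, the quotient \<open>T h / h\<close> is isomorphic to \<open>U / V\<close>; it carries the flags of the fibre problem, and \<open>H\<close> is recovered
  from \<open>h\<close> and \<open>K = H + V\<close> as \<open>K \<inter> T h\<close>.

  Everything rests on transversality statements that have to hold along all solutions for general
  flags. Pairs of a subspace and a tuple of flags satisfying the Schubert conditions are covered by finitely many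
  polynomial charts with at most as many parameters as there are coordinates of flags, so by algebraic dependence
  the flags over the zero set of a nonzero polynomial on a chart lie in a hypersurface. Hence a transversality
  condition holds along all solutions for general flags as soon as it holds at a single point of each chart,
  and coordinate subspaces provide such a point.

  For the last condition of a fibration, each flag is moved by a linear map of its own, which
  acts on \<open>V\<close> and fixes a complement, or fixes \<open>V\<close> and acts on a complement of \<open>h\<close> in \<open>T h\<close>.\<close>

section \<open>Polynomial functions\<close>

text \<open>The block column shape enters through two counts. The corner condition of flag
  \<open>2 + j\<close> makes \<open>h + G_j\<close> a subspace of codimension \<open>m j\<close>,
  and the \<open>m j\<close> add up to \<open>b\<close>; so \<open>T h\<close> has dimension at
  least \<open>a + c + d\<close>, just enough to map onto \<open>U / V\<close> with kernel
  \<open>h\<close>. Moreover \<open>h\<close> has dimension \<open>a1 + a2\<close> and meets the two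
  summands of \<open>V\<close> in at least these dimensions, so it lies in \<open>V\<close>
  automatically. Hence the base problem, whose space \<open>V\<close> moves with the flags, can be
  replaced by the problem \<open>lamt\<close> in the fixed ambient space, and one genericity
  argument serves both \<open>kap\<close> and \<open>lamt\<close>. That argument uses that the sizes
  of the partitions add up to the dimension of the Grassmannian: each box removes a parameter from a
  chart, which offsets the parameters of the subspace. Jump sets other than the expected ones lose
  further parameters, so general flags avoid those charts altogether. At a test point of the
  remaining charts the jump columns are 0; a transversality condition may therefore involve only
  columns outside the jumps, and this dictates the columns chosen in all later tests.\<close>

inductive_set polys :: "'v set \<Rightarrow> (('v \<Rightarrow> complex) \<Rightarrow> complex) set" for A where
  const: "(\<lambda>x. c) \<in> polys A"
| var: "i \<in> A \<Longrightarrow> (\<lambda>x. x i) \<in> polys A"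
| add: "f \<in> polys A \<Longrightarrow> g \<in> polys A \<Longrightarrow> (\<lambda>x. f x + g x) \<in> polys A"
| mult: "f \<in> polys A \<Longrightarrow> g \<in> polys A \<Longrightarrow> (\<lambda>x. f x * g x) \<in> polys A"

text \<open>\<open>polys\<close> refines \<open>cpoly\<close> by an arbitrary index type and a set
  of admissible variables: chart parameters are quadruples, and the dependence argument compares
  numbers of variables.\<close>

lemma cpoly_eq_polys: "cpoly = polys UNIV"
proof (intro set_eqI iffI)
  fix f :: "(nat \<Rightarrow> complex) \<Rightarrow> complex"
  show "f \<in> polys UNIV" if "f \<in> cpoly"
    using that by (induction rule: cpoly.induct) (auto intro: polys.intros)
  show "f \<in> cpoly" if "f \<in> polys UNIV"
    using that by (induction rule: polys.induct) (auto intro: cpoly.intros)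
qed

lemma polys_mono: "f \<in> polys A \<Longrightarrow> A \<subseteq> B \<Longrightarrow> f \<in> polys B"
  by (induction rule: polys.induct) (auto intro: polys.intros)

lemma polys_UNIV: "f \<in> polys A \<Longrightarrow> f \<in> polys UNIV"
  by (rule polys_mono) auto

lemma polys_sum: "(\<And>i. i \<in> I \<Longrightarrow> f i \<in> polys A) \<Longrightarrow> (\<lambda>x. \<Sum>i\<in>I. f i x) \<in> polys A"
  by (induction I rule: infinite_finite_induct) (auto intro: polys.intros)

lemma polys_prod: "(\<And>i. i \<in> I \<Longrightarrow> f i \<in> polys A) \<Longrightarrow> (\<lambda>x. \<Prod>i\<in>I. f i x) \<in> polys A"
  by (induction I rule: infinite_finite_induct) (auto intro: polys.intros)

lemma polys_power: "f \<in> polys A \<Longrightarrow> (\<lambda>x. f x ^ k) \<in> polys A"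
  by (induction k) (auto intro: polys.intros)

lemma polys_diff:
  assumes "f \<in> polys A" "g \<in> polys A"
  shows "(\<lambda>x. f x - g x) \<in> polys A"
proof -
  have "(\<lambda>x. f x + (- 1) * g x) \<in> polys A"
    using assms by (intro polys.add polys.mult polys.const)
  then show ?thesis by simp
qed

lemma polys_if:
  assumes "P \<Longrightarrow> f \<in> polys A" "\<not> P \<Longrightarrow> g \<in> polys A"
  shows "(\<lambda>x. if P then f x else g x) \<in> polys A"
  using assms by (cases P) auto

lemma polys_compose:
  assumes "f \<in> polys A" "\<And>i. i \<in> A \<Longrightarrow> (\<lambda>x. p x i) \<in> polys B"
  shows "(\<lambda>x. f (p x)) \<in> polys B"
  using assms by (induction rule: polys.induct) (auto intro: polys.intros)

lemma polys_cong:
  assumes "f \<in> polys A" "\<And>i. i \<in> A \<Longrightarrow> x i = y i"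
  shows "f x = f y"
  using assms by (induction rule: polys.induct) auto

lemma polys_on_line:
  assumes "f \<in> polys A"
  obtains q where "\<And>t. f (\<lambda>i. x i + t * (y i - x i)) = poly q t"
proof -
  have "\<exists>q. \<forall>t. f (\<lambda>i. x i + t * (y i - x i)) = poly q t"
    using assms
  proof (induction rule: polys.induct)
    case (const c)
    show ?case by (rule exI[of _ "[:c:]"]) simp
  next
    case (var i)
    show ?case by (rule exI[of _ "[:x i, y i - x i:]"]) simp
  next
    case (add f g)
    then obtain q r where "\<forall>t. f (\<lambda>i. x i + t * (y i - x i)) = poly q t"
      "\<forall>t. g (\<lambda>i. x i + t * (y i - x i)) = poly r t" by blast
    then show ?case by (intro exI[of _ "q + r"]) simp
  next
    case (mult f g)
    then obtain q r where "\<forall>t. f (\<lambda>i. x i + t * (y i - x i)) = poly q t"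
      "\<forall>t. g (\<lambda>i. x i + t * (y i - x i)) = poly r t" by blast
    then show ?case by (intro exI[of _ "q * r"]) simp
  qed
  then show ?thesis using that by blast
qed

text \<open>Two nonempty Zariski-open sets meet: on the complex line through \<open>x\<close> and
  \<open>y\<close> both polynomials restrict to nonzero univariate ones, and their product has only
  finitely many roots.\<close>

lemma polys_common_nonzero:
  assumes "f \<in> polys A" "g \<in> polys B" "f x \<noteq> 0" "g y \<noteq> 0"
  shows "\<exists>z. f z \<noteq> 0 \<and> g z \<noteq> 0"
proof -
  obtain q where q: "\<And>t. f (\<lambda>i. x i + t * (y i - x i)) = poly q t"
    by (rule polys_on_line[OF assms(1), of x y]) (use that in blast)
  obtain r where r: "\<And>t. g (\<lambda>i. x i + t * (y i - x i)) = poly r t"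
    by (rule polys_on_line[OF assms(2), of x y]) (use that in blast)
  have "poly q 0 \<noteq> 0" "poly r 1 \<noteq> 0"
    using q[of 0] r[of 1] assms by auto
  then have "q * r \<noteq> 0" by auto
  then have "finite {t. poly (q * r) t = 0}" by (rule poly_roots_finite)
  then have "{t. poly (q * r) t = 0} \<noteq> UNIV"
    using infinite_UNIV_char_0[where 'a = complex] by metis
  then obtain t where "poly (q * r) t \<noteq> 0" by auto
  then show ?thesis
    using q[of t] r[of t] by (intro exI[of _ "\<lambda>i. x i + t * (y i - x i)"]) auto
qed

section \<open>Algebraic dependence by counting monomials\<close>

lemma sum_PiE_insert:
  assumes "a \<notin> A"
  shows "(\<Sum>e\<in>PiE (insert a A) (\<lambda>_. B). F e) = (\<Sum>k\<in>B. \<Sum>e\<in>PiE A (\<lambda>_. B). F (e(a := k)))"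
proof -
  have "(\<Sum>k\<in>B. \<Sum>e\<in>PiE A (\<lambda>_. B). F (e(a := k))) =
        (\<Sum>(k, e)\<in>B \<times> PiE A (\<lambda>_. B). F (e(a := k)))"
    by (rule sum.cartesian_product)
  also have "\<dots> = (\<Sum>e\<in>PiE (insert a A) (\<lambda>_. B). F e)"
    unfolding PiE_insert_eq
    by (subst sum.reindex[OF inj_combinator[OF assms]]) (simp add: case_prod_unfold)
  finally show ?thesis by simp
qed

text \<open>Induction on the variables: at a point where the coefficient of degree
  \<open>e0 a\<close> in the new variable is nonzero, the sum is a nonzero univariate polynomial in
  that variable.\<close>

lemma sum_monomials_nonzero:
  fixes c :: "('v \<Rightarrow> nat) \<Rightarrow> complex"
  assumes "finite A" "e0 \<in> PiE A (\<lambda>_. {..<D})" "c e0 \<noteq> 0"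
  shows "\<exists>z. (\<Sum>e\<in>PiE A (\<lambda>_. {..<D}). c e * (\<Prod>i\<in>A. z i ^ e i)) \<noteq> 0"
  using assms
proof (induction A arbitrary: c e0 rule: finite_induct)
  case empty
  then show ?case by simp
next
  case (insert a A)
  let ?e = "restrict e0 A"
  have e: "?e \<in> PiE A (\<lambda>_. {..<D})" "e0 a < D" "?e(a := e0 a) = e0"
    using insert.prems(1) by (auto simp: fun_eq_iff PiE_def extensional_def)
  define p where "p k z = (\<Sum>e\<in>PiE A (\<lambda>_. {..<D}). c (e(a := k)) * (\<Prod>i\<in>A. z i ^ e i))" for k z
  obtain z where z: "p (e0 a) z \<noteq> 0"
    using insert.IH[OF e(1), of "\<lambda>e. c (e(a := e0 a))"] insert.prems(2)
    unfolding p_def e(3) by blast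
  define q where "q = (\<Sum>k<D. monom (p k z) k)"
  have "coeff q (e0 a) = p (e0 a) z"
    using e(2) by (simp add: q_def coeff_sum sum.delta)
  with z have "q \<noteq> 0" by auto
  then have "finite {t. poly q t = 0}" by (rule poly_roots_finite)
  then have "{t. poly q t = 0} \<noteq> UNIV"
    using infinite_UNIV_char_0[where 'a = complex] by metis
  then obtain t where t: "poly q t \<noteq> 0" by auto
  let ?z = "z(a := t)"
  have *: "(\<Prod>i\<in>insert a A. ?z i ^ (e(a := k)) i) = t ^ k * (\<Prod>i\<in>A. z i ^ e i)" for e k
  proof -
    have "(\<Prod>i\<in>A. ?z i ^ (e(a := k)) i) = (\<Prod>i\<in>A. z i ^ e i)"
      by (rule prod.cong) (use insert.hyps(2) in auto)
    then show ?thesis using insert.hyps by simp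
  qed
  have "(\<Sum>e\<in>PiE (insert a A) (\<lambda>_. {..<D}). c e * (\<Prod>i\<in>insert a A. ?z i ^ e i)) = poly q t"
    unfolding sum_PiE_insert[OF insert.hyps(2)] * q_def poly_sum poly_monom p_def
    by (simp add: sum_distrib_left sum_distrib_right mult_ac)
  with t show ?case by (intro exI[of _ ?z]) simp
qed

text \<open>Functions of the variables as a vector space, so that algebraic dependence becomes
  linear dependence of products.\<close>

interpretation fs: vector_space "\<lambda>c (f :: ('v \<Rightarrow> complex) \<Rightarrow> complex) x. c * f x"
  by unfold_locales (auto simp: algebra_simps fun_eq_iff)

context vector_space
begin

text \<open>The relation is indexed by \<open>I\<close> and not by the set of values, since
  different exponents may give the same function; such a repetition is itself a relation, with
  coefficients 1 and -1.\<close>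

lemma dependent_family:
  assumes "finite I" "finite T" "card T < card I" "u ` I \<subseteq> span T"
  shows "\<exists>c. (\<exists>i\<in>I. c i \<noteq> 0) \<and> (\<Sum>i\<in>I. scale (c i) (u i)) = 0"
proof (cases "inj_on u I")
  case False
  then obtain i j where ij: "i \<in> I" "j \<in> I" "i \<noteq> j" "u i = u j"
    unfolding inj_on_def by blast
  define c :: "_ \<Rightarrow> 'a" where "c k = (if k = i then 1 else if k = j then - 1 else 0)" for k
  have "(\<Sum>k\<in>I. scale (c k) (u k)) = (\<Sum>k\<in>{i, j}. scale (c k) (u k))"
    using assms(1) ij by (intro sum.mono_neutral_right) (auto simp: c_def)
  also have "\<dots> = 0" using ij by (simp add: c_def)
  finally show ?thesis using ij(1) by (intro exI[of _ c]) (auto simp: c_def)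
next
  case True
  have "dependent (u ` I)"
    using independent_span_bound[OF assms(2) _ assms(4)] assms(3) card_image[OF True] by auto
  then obtain v where v: "\<exists>w\<in>u ` I. v w \<noteq> 0" "(\<Sum>w\<in>u ` I. scale (v w) w) = 0"
    using dependent_finite[of "u ` I"] assms(1) by auto
  then show ?thesis
    using sum.reindex[OF True, of "\<lambda>w. scale (v w) w"] by (intro exI[of _ "v \<circ> u"]) auto
qed

end

lemma sum_fun_apply: "(\<Sum>i\<in>I. f i) x = (\<Sum>i\<in>I. f i x)"
  for f :: "'i \<Rightarrow> 'a \<Rightarrow> 'b::comm_monoid_add"
  by (induction I rule: infinite_finite_induct) auto

text \<open>Degrees are bounded in each variable separately: the count is then at most the pure
  power \<open>(D + 1) ^ card A\<close>, and bounds add under multiplication.\<close>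

definition monomials :: "'v set \<Rightarrow> nat \<Rightarrow> (('v \<Rightarrow> complex) \<Rightarrow> complex) set" where
  "monomials A D = (\<lambda>e z. \<Prod>i\<in>A. z i ^ e i) ` PiE A (\<lambda>_. {..D})"

abbreviation bounded_polys :: "'v set \<Rightarrow> nat \<Rightarrow> (('v \<Rightarrow> complex) \<Rightarrow> complex) set" where
  "bounded_polys A D \<equiv> fs.span (monomials A D)"

lemma finite_monomials: "finite A \<Longrightarrow> finite (monomials A D)"
  by (simp add: monomials_def finite_PiE)

lemma card_monomials: "finite A \<Longrightarrow> card (monomials A D) \<le> (D + 1) ^ card A"
  unfolding monomials_def
  by (rule order_trans[OF card_image_le]) (auto simp: finite_PiE card_PiE)

lemma bounded_polys_mono: "D \<le> D' \<Longrightarrow> f \<in> bounded_polys A D \<Longrightarrow> f \<in> bounded_polys A D'"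
  using fs.span_mono[of "monomials A D" "monomials A D'"]
  by (fastforce simp: monomials_def PiE_def Pi_def)

lemma monomials_mult:
  assumes "f \<in> monomials A D" "g \<in> monomials A D'"
  shows "(\<lambda>z. f z * g z) \<in> monomials A (D + D')"
proof -
  obtain e e' where e: "e \<in> PiE A (\<lambda>_. {..D})" "f = (\<lambda>z. \<Prod>i\<in>A. z i ^ e i)"
    "e' \<in> PiE A (\<lambda>_. {..D'})" "g = (\<lambda>z. \<Prod>i\<in>A. z i ^ e' i)"
    using assms unfolding monomials_def by blast
  have "restrict (\<lambda>i. e i + e' i) A \<in> PiE A (\<lambda>_. {..D + D'})"
    using e by (auto simp: PiE_def Pi_def intro: add_mono)
  moreover have "(\<lambda>z. f z * g z) = (\<lambda>z. \<Prod>i\<in>A. z i ^ restrict (\<lambda>i. e i + e' i) A i)"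
    using e by (auto simp: fun_eq_iff power_add prod.distrib intro!: prod.cong)
  ultimately show ?thesis unfolding monomials_def by blast
qed

lemma bounded_polys_mult:
  assumes "f \<in> bounded_polys A D" "g \<in> bounded_polys A D'"
  shows "(\<lambda>z. f z * g z) \<in> bounded_polys A (D + D')"
proof -
  let ?B = "bounded_polys A (D + D')"
  have 1: "(\<lambda>z. f z * g z) \<in> ?B" if f: "f \<in> monomials A D" for f
    using assms(2)
  proof (induction rule: fs.span_induct_alt)
    case base
    show ?case using fs.span_zero by (simp add: zero_fun_def)
  next
    case (step c x y)
    have "(\<lambda>z. f z * x z) \<in> ?B"
      using monomials_mult[OF f step(1)] by (rule fs.span_base)
    from fs.span_add[OF fs.span_scale[OF this, of c] step(2)]
    show ?case by (simp add: plus_fun_def algebra_simps)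
  qed
  show ?thesis
    using assms(1)
  proof (induction rule: fs.span_induct_alt)
    case base
    show ?case using fs.span_zero by (simp add: zero_fun_def)
  next
    case (step c x y)
    from fs.span_add[OF fs.span_scale[OF 1[OF step(1)], of c] step(2)]
    show ?case by (simp add: plus_fun_def algebra_simps)
  qed
qed

lemma bounded_polys_one: "(\<lambda>z. 1) \<in> bounded_polys A D"
proof -
  have "(\<lambda>z. 1) \<in> monomials A D"
    unfolding monomials_def by (rule image_eqI[of _ _ "restrict (\<lambda>_. 0) A"]) auto
  then show ?thesis by (rule fs.span_base)
qed

lemma bounded_polys_power: "f \<in> bounded_polys A D \<Longrightarrow> (\<lambda>z. f z ^ k) \<in> bounded_polys A (k * D)"
  by (induction k) (auto intro: bounded_polys_one bounded_polys_mult)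

lemma bounded_polys_prod:
  "finite Y \<Longrightarrow> (\<And>y. y \<in> Y \<Longrightarrow> f y \<in> bounded_polys A D) \<Longrightarrow>
   (\<lambda>z. \<Prod>y\<in>Y. f y z) \<in> bounded_polys A (card Y * D)"
  by (induction Y rule: finite_induct) (auto intro: bounded_polys_one bounded_polys_mult)

lemma polys_imp_bounded:
  assumes "finite A" "f \<in> polys A"
  shows "\<exists>D. f \<in> bounded_polys A D"
  using assms(2)
proof (induction rule: polys.induct)
  case (const c)
  have "(\<lambda>z. c * 1) \<in> bounded_polys A 0"
    by (rule fs.span_scale[OF bounded_polys_one])
  then show ?case by auto
next
  case (var i)
  have "(\<lambda>z. z i :: complex) = (\<lambda>z. \<Prod>j\<in>A. z j ^ restrict (\<lambda>j. if j = i then 1 else 0) A j)"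
  proof
    fix z :: "'a \<Rightarrow> complex"
    have "(\<Prod>j\<in>A. z j ^ restrict (\<lambda>j. if j = i then 1 else 0) A j) = (\<Prod>j\<in>A. if j = i then z j else 1)"
      by (rule prod.cong) auto
    then show "z i = (\<Prod>j\<in>A. z j ^ restrict (\<lambda>j. if j = i then 1 else 0) A j)"
      using var assms(1) by (simp add: prod.delta)
  qed
  then have "(\<lambda>z. z i) \<in> monomials A 1"
    unfolding monomials_def
    by (rule image_eqI[of _ _ "restrict (\<lambda>j. if j = i then 1 else 0) A"]) auto
  then show ?case using fs.span_base by blast
next
  case (add f g)
  then obtain D D' where "f \<in> bounded_polys A D" "g \<in> bounded_polys A D'" by blast
  then have "f \<in> bounded_polys A (D + D')" "g \<in> bounded_polys A (D + D')"
    by (auto intro: bounded_polys_mono[rotated])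
  from fs.span_add[OF this] show ?case by (auto simp: plus_fun_def)
next
  case (mult f g)
  then show ?case using bounded_polys_mult by blast
qed

text \<open>The \<open>card Y + 1\<close> polynomials \<open>g\<close> and \<open>P\<close> in \<open>card A \<le> card Y\<close> variables are algebraically
  dependent. After cancelling the largest power of \<open>g\<close> from a relation, its part of degree \<open>0\<close> in \<open>g\<close>
  is a nonzero polynomial that vanishes on the image of the zero set of \<open>g\<close>.\<close>

lemma image_of_zero_set_in_hypersurface:
  fixes P :: "('v \<Rightarrow> complex) \<Rightarrow> 'y \<Rightarrow> complex"
  assumes A: "finite A" and Y: "finite Y" and card: "card A \<le> card Y"
    and P: "\<And>y. y \<in> Y \<Longrightarrow> (\<lambda>z. P z y) \<in> polys A"
    and g: "g \<in> polys A" "g z0 \<noteq> 0"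
  shows "\<exists>f\<in>polys Y. (\<exists>x. f x \<noteq> 0) \<and> (\<forall>z. f (P z) \<noteq> 0 \<longrightarrow> g z \<noteq> 0)"
proof -
  obtain d where d: "\<And>y. y \<in> Y \<Longrightarrow> (\<lambda>z. P z y) \<in> bounded_polys A (d y)"
    using polys_imp_bounded[OF A P] by metis
  obtain d' where d': "g \<in> bounded_polys A d'"
    using polys_imp_bounded[OF A g(1)] by blast
  define \<delta> where "\<delta> = d' + (\<Sum>y\<in>Y. d y)"
  have Pd: "(\<lambda>z. P z y) \<in> bounded_polys A \<delta>" if "y \<in> Y" for y
    using d[OF that] member_le_sum[OF that, of d] Y
    by (auto simp: \<delta>_def intro: bounded_polys_mono[rotated] trans_le_add2)
  have gd: "g \<in> bounded_polys A \<delta>"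
    using d' by (auto simp: \<delta>_def intro: bounded_polys_mono[rotated])
  \<comment> \<open>A product of powers of \<open>g\<close> and the \<open>P y\<close> with
    exponents below \<open>D\<close> has degrees less than \<open>M * D\<close>, so it lies in a
    space of dimension at most \<open>(M * D) ^ card A\<close>. The choice of \<open>D\<close>
    brings this below the number \<open>D * D ^ card Y\<close> of such products.\<close>
  define M where "M = (card Y + 1) * \<delta> + 1"
  define D where "D = M ^ card A + 1"
  define u where "u = (\<lambda>(k, e) z. g z ^ k * (\<Prod>y\<in>Y. P z y ^ e y))"
  define E where "E = PiE Y (\<lambda>_. {..<D})"
  have finE: "finite E" using Y by (simp add: E_def finite_PiE)
  have u: "u i \<in> bounded_polys A (D * \<delta> + card Y * (D * \<delta>))" if "i \<in> {..<D} \<times> E" for i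
  proof -
    obtain k e where i: "i = (k, e)" by (cases i)
    have k: "k < D" and e: "\<And>y. y \<in> Y \<Longrightarrow> e y < D"
      using that by (auto simp: E_def i)
    have "(\<lambda>z. P z y ^ e y) \<in> bounded_polys A (D * \<delta>)" if "y \<in> Y" for y
      by (rule bounded_polys_mono[OF _ bounded_polys_power[OF Pd[OF that]]])
        (use e[OF that] in auto)
    moreover have "(\<lambda>z. g z ^ k) \<in> bounded_polys A (D * \<delta>)"
      by (rule bounded_polys_mono[OF _ bounded_polys_power[OF gd]]) (use k in auto)
    ultimately show ?thesis
      unfolding u_def i using Y by (auto intro!: bounded_polys_mult bounded_polys_prod)
  qed
  have "card (monomials A (D * \<delta> + card Y * (D * \<delta>))) \<le> (D * \<delta> + card Y * (D * \<delta>) + 1) ^ card A"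
    by (rule card_monomials[OF A])
  also have "\<dots> \<le> (M * D) ^ card A"
    by (rule power_mono) (auto simp: M_def D_def algebra_simps)
  also have "\<dots> = M ^ card A * D ^ card A" by (rule power_mult_distrib)
  also have "\<dots> < D * D ^ card A" by (simp add: D_def)
  also have "\<dots> \<le> D * D ^ card Y"
    using card by (intro mult_left_mono power_increasing) (auto simp: D_def)
  also have "\<dots> = card ({..<D} \<times> E)"
    using Y by (simp add: E_def card_PiE card_cartesian_product)
  finally have "card (monomials A (D * \<delta> + card Y * (D * \<delta>))) < card ({..<D} \<times> E)" .
  moreover have "u ` ({..<D} \<times> E) \<subseteq> bounded_polys A (D * \<delta> + card Y * (D * \<delta>))"
    using u by blast
  ultimately obtain c where c: "\<exists>i\<in>{..<D} \<times> E. c i \<noteq> 0"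
    "(\<Sum>i\<in>{..<D} \<times> E. (\<lambda>z. c i * u i z)) = 0"
    using fs.dependent_family[of "{..<D} \<times> E"] finE finite_monomials[OF A] by blast
  define k0 where "k0 = (LEAST k. k < D \<and> (\<exists>e\<in>E. c (k, e) \<noteq> 0))"
  have "\<exists>k. k < D \<and> (\<exists>e\<in>E. c (k, e) \<noteq> 0)" using c(1) by auto
  then have k0: "k0 < D" "\<exists>e\<in>E. c (k0, e) \<noteq> 0"
    unfolding k0_def using LeastI_ex[where P = "\<lambda>k. k < D \<and> (\<exists>e\<in>E. c (k, e) \<noteq> 0)"] by auto
  have below: "c (k, e) = 0" if "k < k0" "e \<in> E" for k e
    using not_less_Least[of k "\<lambda>k. k < D \<and> (\<exists>e\<in>E. c (k, e) \<noteq> 0)"] that k0(1)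
    unfolding k0_def[symmetric] by auto
  define Q where "Q k x = (\<Sum>e\<in>E. c (k, e) * (\<Prod>y\<in>Y. x y ^ e y))" for k and x :: "'y \<Rightarrow> complex"
  have QP: "Q k \<in> polys Y" for k
    unfolding Q_def by (intro polys_sum polys.mult polys.const polys_prod polys_power polys.var)
  define R where "R z = (\<Sum>k\<in>{k0..<D}. g z ^ (k - k0) * Q k (P z))" for z
  have R: "R \<in> polys A"
    unfolding R_def
    by (intro polys_sum polys.mult polys_power g polys_compose[OF QP] P)
  have gR: "g z ^ k0 * R z = 0" for z
  proof -
    have "0 = (\<Sum>i\<in>{..<D} \<times> E. (\<lambda>z. c i * u i z)) z" by (simp add: c(2))
    also have "\<dots> = (\<Sum>i\<in>{..<D} \<times> E. c i * u i z)"
      by (rule sum_fun_apply)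
    also have "\<dots> = (\<Sum>k<D. \<Sum>e\<in>E. c (k, e) * u (k, e) z)"
      unfolding sum.cartesian_product by (rule sum.cong) auto
    also have "\<dots> = (\<Sum>k<D. g z ^ k * Q k (P z))"
      by (simp add: u_def Q_def sum_distrib_left mult_ac)
    also have "\<dots> = (\<Sum>k\<in>{k0..<D}. g z ^ k * Q k (P z))"
      by (rule sum.mono_neutral_right) (auto simp: Q_def below)
    also have "\<dots> = g z ^ k0 * R z"
      unfolding R_def sum_distrib_left
      by (rule sum.cong) (auto simp: mult.assoc[symmetric] power_add[symmetric])
    finally show ?thesis by simp
  qed
  \<comment> \<open>\<open>g ^ k0 * R\<close> vanishes identically and \<open>g\<close> is not the
    zero polynomial, so \<open>R\<close> vanishes on the zero set of \<open>g\<close> too.\<close>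
  have R0: "R z = 0" for z
    using polys_common_nonzero[OF polys_power[OF g(1), of k0] R, of z0 z] g(2) gR by force
  obtain e0 where "e0 \<in> E" "c (k0, e0) \<noteq> 0" using k0(2) by blast
  then obtain x where "Q k0 x \<noteq> 0"
    using sum_monomials_nonzero[OF Y, of e0 D "\<lambda>e. c (k0, e)"] unfolding E_def Q_def by blast
  moreover have "g z \<noteq> 0" if "Q k0 (P z) \<noteq> 0" for z
  proof
    assume "g z = 0"
    then have "R z = (\<Sum>k\<in>{k0..<D}. if k = k0 then Q k0 (P z) else 0)"
      unfolding R_def by (intro sum.cong) auto
    also have "\<dots> = Q k0 (P z)" using k0(1) by (subst sum.delta) auto
    finally show False using R0 that by simp
  qed
  ultimately show ?thesis using QP by blast
qed

section \<open>Linear independence is an open condition\<close>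

text \<open>Stated for indexed families, so that a repetition counts as dependence, and for any type
  of coordinates, so that it also covers vectors in a direct sum of copies of the ambient
  space.\<close>

definition lin_indep :: "'l set \<Rightarrow> ('l \<Rightarrow> 'i \<Rightarrow> complex) \<Rightarrow> bool" where
  "lin_indep I v \<longleftrightarrow> (\<forall>c. (\<forall>i. (\<Sum>l\<in>I. c l * v l i) = 0) \<longrightarrow> (\<forall>l\<in>I. c l = 0))"

lemma lin_indepI:
  "(\<And>c l. (\<And>i. (\<Sum>l\<in>I. c l * v l i) = 0) \<Longrightarrow> l \<in> I \<Longrightarrow> c l = 0) \<Longrightarrow> lin_indep I v"
  unfolding lin_indep_def by blast

lemma lin_indepD:
  "lin_indep I v \<Longrightarrow> (\<And>i. (\<Sum>l\<in>I. c l * v l i) = 0) \<Longrightarrow> l \<in> I \<Longrightarrow> c l = 0"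
  unfolding lin_indep_def by blast

lemma lin_indep_subset:
  assumes "lin_indep I v" "J \<subseteq> I" "finite I"
  shows "lin_indep J v"
proof (rule lin_indepI)
  fix c l assume c: "\<And>i. (\<Sum>l\<in>J. c l * v l i) = 0" and l: "l \<in> J"
  define c' where "c' l = (if l \<in> J then c l else 0)" for l
  have *: "(\<Sum>l\<in>I. c' l * v l i) = (\<Sum>l\<in>J. c l * v l i)" for i
    using assms by (intro sum.mono_neutral_cong_right) (auto simp: c'_def)
  have "c' l = 0"
    by (rule lin_indepD[OF assms(1)]) (use * c l assms in auto)
  then show "c l = 0" using l by (simp add: c'_def)
qed

text \<open>Gaussian elimination without division: a coordinate \<open>i\<close> with
  \<open>v z0 a i\<close> nonzero serves as pivot, the family \<open>v'\<close> has this coordinate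
  eliminated, and \<open>g\<close> is the product of the pivots.\<close>

lemma lin_indep_open:
  assumes "finite I" "\<And>l i. l \<in> I \<Longrightarrow> (\<lambda>z. v z l i) \<in> polys A" "lin_indep I (v z0)"
  shows "\<exists>g\<in>polys A. g z0 \<noteq> 0 \<and> (\<forall>z. g z \<noteq> 0 \<longrightarrow> lin_indep I (v z))"
  using assms
proof (induction I arbitrary: v rule: finite_induct)
  case empty
  show ?case by (rule bexI[of _ "\<lambda>_. 1"]) (auto simp: lin_indep_def intro: polys.const)
next
  case (insert a I)
  have "\<exists>i. v z0 a i \<noteq> 0"
  proof (rule ccontr)
    assume "\<nexists>i. v z0 a i \<noteq> 0"
    then have "(\<Sum>l\<in>insert a I. (if l = a then 1 else 0) * v z0 l i) = 0" for i
      by (intro sum.neutral) auto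
    from lin_indepD[OF insert.prems(2) this, of a] show False by simp
  qed
  then obtain i where i: "v z0 a i \<noteq> 0" by blast
  define v' where "v' z l j = v z a i * v z l j - v z l i * v z a j" for z l j
  have sum': "(\<Sum>l\<in>I. c l * v' z l j) =
      v z a i * (\<Sum>l\<in>I. c l * v z l j) - (\<Sum>l\<in>I. c l * v z l i) * v z a j" for c z j
    by (simp add: v'_def sum_distrib_left sum_distrib_right sum_subtractf algebra_simps)
  have "lin_indep I (v' z0)"
  proof (rule lin_indepI)
    fix c l assume c: "\<And>j. (\<Sum>l\<in>I. c l * v' z0 l j) = 0" and l: "l \<in> I"
    define c' where "c' l = (if l = a then - (\<Sum>l\<in>I. c l * v z0 l i) else v z0 a i * c l)" for l
    have *: "(\<Sum>l\<in>I. c' l * v z0 l j) = v z0 a i * (\<Sum>l\<in>I. c l * v z0 l j)" for j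
      unfolding sum_distrib_left
      by (rule sum.cong) (use insert.hyps in \<open>auto simp: c'_def\<close>)
    have "(\<Sum>l\<in>insert a I. c' l * v z0 l j) = 0" for j
      using c[of j] insert.hyps by (simp add: * sum') (simp add: c'_def)
    from lin_indepD[OF insert.prems(2) this, of l] show "c l = 0"
      using l i insert.hyps by (auto simp: c'_def split: if_splits)
  qed
  moreover have "(\<lambda>z. v' z l j) \<in> polys A" if "l \<in> I" for l j
    unfolding v'_def using that insert.prems(1) by (intro polys_diff polys.mult) auto
  ultimately obtain g where g: "g \<in> polys A" "g z0 \<noteq> 0" "\<And>z. g z \<noteq> 0 \<Longrightarrow> lin_indep I (v' z)"
    using insert.IH[of v'] by blast
  have "lin_indep (insert a I) (v z)" if "g z * v z a i \<noteq> 0" for z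
  proof (rule lin_indepI)
    fix c l assume c: "\<And>j. (\<Sum>l\<in>insert a I. c l * v z l j) = 0" and l: "l \<in> insert a I"
    have c': "(\<Sum>l\<in>I. c l * v z l j) = - (c a * v z a j)" for j
      using c[of j] insert.hyps by (simp add: add_eq_0_iff)
    have z: "c l = 0" if "l \<in> I" for l
      by (rule lin_indepD[OF g(3), of z]) (use \<open>g z * v z a i \<noteq> 0\<close> that in \<open>auto simp: sum' c'\<close>)
    then have "c a * v z a i = 0" using c'[of i] by simp
    then show "c l = 0" using z l that by auto
  qed
  then show ?case
    using g i insert.prems(1)
    by (intro bexI[of _ "\<lambda>z. g z * v z a i"]) (auto intro: polys.mult)
qed

section \<open>Generic conditions\<close>

definition generic :: "((nat \<Rightarrow> complex) \<Rightarrow> bool) \<Rightarrow> bool" where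
  "generic P \<longleftrightarrow> (\<exists>f\<in>cpoly. (\<exists>x. f x \<noteq> 0) \<and> (\<forall>x. f x \<noteq> 0 \<longrightarrow> P x))"

lemma generic_mono: "generic P \<Longrightarrow> (\<And>x. P x \<Longrightarrow> Q x) \<Longrightarrow> generic Q"
  unfolding generic_def by blast

lemma generic_conj:
  assumes "generic P" "generic Q"
  shows "generic (\<lambda>x. P x \<and> Q x)"
proof -
  obtain f g x y where fg: "f \<in> cpoly" "g \<in> cpoly" "f x \<noteq> 0" "g y \<noteq> 0"
    "\<And>x. f x \<noteq> 0 \<Longrightarrow> P x" "\<And>x. g x \<noteq> 0 \<Longrightarrow> Q x"
    using assms unfolding generic_def by blast
  then obtain z where "f z \<noteq> 0 \<and> g z \<noteq> 0"
    using polys_common_nonzero[of f UNIV g UNIV x y] unfolding cpoly_eq_polys by blast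
  then show ?thesis
    unfolding generic_def using fg by (intro bexI[of _ "\<lambda>x. f x * g x"]) (auto intro: cpoly.mult)
qed

lemma generic_True: "generic (\<lambda>x. True)"
  unfolding generic_def by (rule bexI[of _ "\<lambda>x. 1"]) (auto intro: cpoly.const)

lemma generic_ball:
  assumes "finite C" "\<And>c. c \<in> C \<Longrightarrow> generic (P c)"
  shows "generic (\<lambda>x. \<forall>c\<in>C. P c x)"
  using assms
  by (induction C rule: finite_induct) (auto simp: generic_True intro: generic_conj)

section \<open>Dimensions of finite-dimensional subspaces\<close>

context vector_space
begin

lemma independent_Un:
  assumes "finite A" "finite B" "independent A" "independent B" "span A \<inter> span B \<subseteq> {0}"
  shows "independent (A \<union> B) \<and> A \<inter> B = {}"
proof
  show dis: "A \<inter> B = {}"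
    using assms dependent_zero[of A] by (auto dest: span_base)
  show "independent (A \<union> B)"
  proof (rule independent_if_scalars_zero)
    show "finite (A \<union> B)" using assms by simp
    fix f x assume f: "(\<Sum>x\<in>A \<union> B. scale (f x) x) = 0" and x: "x \<in> A \<union> B"
    let ?a = "\<Sum>x\<in>A. scale (f x) x" and ?b = "\<Sum>x\<in>B. scale (f x) x"
    have ab: "?a + ?b = 0"
      using f assms dis by (simp add: sum.union_disjoint)
    have "?a \<in> span A" "?b \<in> span B"
      by (auto intro: span_sum span_scale span_base)
    moreover have "?a = - ?b" using ab by (simp add: add_eq_0_iff2)
    ultimately have "?a \<in> span A \<inter> span B" by (simp add: span_neg)
    then have "?a = 0" "?b = 0" using assms(5) ab by auto
    then show "f x = 0"
      using x assms independentD[of A A f x] independentD[of B B f x] by auto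
  qed
qed

lemma span_Diff_Int:
  assumes "finite C" "independent C" "B \<subseteq> C"
  shows "span (C - B) \<inter> span B \<subseteq> {0}"
proof
  fix x assume "x \<in> span (C - B) \<inter> span B"
  then have "x \<in> range (\<lambda>u. \<Sum>y\<in>C - B. scale (u y) y)" "x \<in> range (\<lambda>v. \<Sum>y\<in>B. scale (v y) y)"
    using assms span_finite[of "C - B"] span_finite[of B] finite_subset[of B C] by blast+
  then obtain u v where u: "x = (\<Sum>y\<in>C - B. scale (u y) y)" and v: "x = (\<Sum>y\<in>B. scale (v y) y)"
    by (elim imageE)
  define w where "w y = (if y \<in> B then - v y else u y)" for y
  have "(\<Sum>y\<in>C. scale (w y) y) = (\<Sum>y\<in>C - B. scale (w y) y) + (\<Sum>y\<in>B. scale (w y) y)"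
    using assms by (simp add: sum.subset_diff)
  also have "(\<Sum>y\<in>C - B. scale (w y) y) = x"
    unfolding u by (rule sum.cong) (auto simp: w_def)
  also have "(\<Sum>y\<in>B. scale (w y) y) = - x"
    unfolding v sum_negf[symmetric] by (rule sum.cong) (auto simp: w_def)
  finally have "(\<Sum>y\<in>C. scale (w y) y) = 0" by simp
  then have "\<And>y. y \<in> C \<Longrightarrow> w y = 0" using assms independentD[of C C w] by auto
  then have "\<And>y. y \<in> C - B \<Longrightarrow> u y = 0" unfolding w_def by (metis DiffE)
  then have "x = 0" unfolding u by (simp add: sum.neutral)
  then show "x \<in> {0}" by simp
qed

text \<open>The whole vector space may be infinite-dimensional, as that of all \<open>cvec\<close>
  is; finiteness comes from the set \<open>W\<close>, whose span contains \<open>S\<close>.\<close>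

lemma finite_basis_extend:
  assumes "finite W" "S \<subseteq> span W" "subspace S" "B \<subseteq> S" "independent B"
  obtains C where "B \<subseteq> C" "C \<subseteq> S" "independent C" "finite C" "span C = S" "card C = dim S"
proof -
  obtain C where C: "B \<subseteq> C" "C \<subseteq> S" "independent C" "S \<subseteq> span C"
    using maximal_independent_subset_extend[OF assms(4,5)] by blast
  moreover have "finite C" using independent_span_bound[of W C] assms C by auto
  moreover have "span C = S" using C assms(3) by (simp add: span_subspace)
  ultimately show ?thesis using that basis_card_eq_dim[of C S] by blast
qed

lemma dim_Un_Int:
  assumes W: "finite W" "S \<subseteq> span W" "T \<subseteq> span W" and S: "subspace S" and T: "subspace T"
  shows "dim (span (S \<union> T)) + dim (S \<inter> T) = dim S + dim T"
proof -
  have sub: "subspace (S \<inter> T)" using S T by (simp add: subspace_inter)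
  obtain B where B: "B \<subseteq> S \<inter> T" "independent B" "finite B" "span B = S \<inter> T" "card B = dim (S \<inter> T)"
    by (rule finite_basis_extend[OF W(1) _ sub empty_subsetI independent_empty]) (use W in blast)+
  obtain C where C: "B \<subseteq> C" "C \<subseteq> S" "independent C" "finite C" "span C = S" "card C = dim S"
    by (rule finite_basis_extend[OF W(1,2) S, of B]) (use B in blast)+
  obtain D where D: "B \<subseteq> D" "D \<subseteq> T" "independent D" "finite D" "span D = T" "card D = dim T"
    by (rule finite_basis_extend[OF W(1,3) T, of B]) (use B in blast)+
  have "span (C - B) \<inter> span D \<subseteq> span (C - B) \<inter> span B"
    using span_mono[OF Diff_subset, of C B] B(4) C(5) D(5) by blast
  also have "\<dots> \<subseteq> {0}" by (rule span_Diff_Int[OF C(4,3,1)])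
  finally have ind: "independent ((C - B) \<union> D) \<and> (C - B) \<inter> D = {}"
    by (intro independent_Un finite_Diff C D independent_mono[OF C(3)] Diff_subset)
  have CD: "(C - B) \<union> D = C \<union> D" using D(1) by auto
  have "span (S \<union> T) = span (C \<union> D)"
    unfolding C(5)[symmetric] D(5)[symmetric] span_Un span_span ..
  then have "dim (span (S \<union> T)) = card ((C - B) \<union> D)"
    unfolding CD using ind dim_span_eq_card_independent[of "C \<union> D"] CD by metis
  also have "\<dots> = card (C - B) + card D" using ind C D by (intro card_Un_disjoint) auto
  also have "card (C - B) = card C - card B" using B C by (intro card_Diff_subset) auto
  finally show ?thesis using B C D card_mono[of C B] by simp
qed

lemma dim_subspace_mono:
  assumes "finite W" "T \<subseteq> span W" "subspace T" "subspace S" "S \<subseteq> T"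
  shows "dim S \<le> dim T"
proof -
  obtain B where B: "B \<subseteq> S" "independent B" "finite B" "span B = S" "card B = dim S"
    by (rule finite_basis_extend[OF assms(1) _ assms(4) empty_subsetI independent_empty])
      (use assms in blast)+
  obtain C where C: "B \<subseteq> C" "finite C" "card C = dim T"
    by (rule finite_basis_extend[OF assms(1,2,3), of B]) (use B assms in blast)+
  then show ?thesis using B card_mono[of C B] by simp
qed

lemma subspace_eqI_dim:
  assumes "finite W" "T \<subseteq> span W" "subspace T" "subspace S" "S \<subseteq> T" "dim T \<le> dim S"
  shows "S = T"
proof -
  obtain B where B: "B \<subseteq> S" "independent B" "finite B" "span B = S" "card B = dim S"
    by (rule finite_basis_extend[OF assms(1) _ assms(4) empty_subsetI independent_empty])
      (use assms in blast)+
  obtain C where C: "B \<subseteq> C" "finite C" "card C = dim T" "span C = T"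
    by (rule finite_basis_extend[OF assms(1,2,3), of B]) (use B assms in blast)+
  then have "B = C" using B assms(6) card_seteq[of C B] by simp
  then show ?thesis using B C by simp
qed

end

definition unit :: "nat \<Rightarrow> cvec" where
  "unit i = (\<lambda>j. if j = i then 1 else 0)"

lemma sum_cscale_apply: "(\<Sum>l\<in>I. cscale (c l) (v l)) i = (\<Sum>l\<in>I. c l * v l i)"
  by (induction I rule: infinite_finite_induct) (auto simp: cscale_def)

lemma subspace_ambient: "cv.subspace (ambient N)"
  by (auto simp: cv.subspace_def ambient_def cscale_def)

lemma ambient_expand: "v \<in> ambient N \<Longrightarrow> v = (\<Sum>i<N. cscale (v i) (unit i))"
  by (rule ext) (auto simp: sum_cscale_apply unit_def ambient_def if_distrib sum.delta cong: if_cong)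

lemma unit_in_ambient: "i < N \<Longrightarrow> unit i \<in> ambient N"
  by (auto simp: unit_def ambient_def)

lemma span_units: "cv.span (unit ` {..<N}) = ambient N"
proof
  show "cv.span (unit ` {..<N}) \<subseteq> ambient N"
    by (rule cv.span_minimal) (auto simp: unit_in_ambient subspace_ambient)
  show "ambient N \<subseteq> cv.span (unit ` {..<N})"
  proof
    fix v assume "v \<in> ambient N"
    then have "v = (\<Sum>i<N. cscale (v i) (unit i))" by (rule ambient_expand)
    also have "\<dots> \<in> cv.span (unit ` {..<N})"
      by (intro cv.span_sum cv.span_scale cv.span_base) auto
    finally show "v \<in> cv.span (unit ` {..<N})" .
  qed
qed

lemma lin_indep_independent:
  assumes "finite I" "lin_indep I v"
  shows "inj_on v I \<and> cv.independent (v ` I)"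
proof
  show inj: "inj_on v I"
  proof (rule inj_onI, rule ccontr)
    fix k l assume kl: "k \<in> I" "l \<in> I" "v k = v l" "k \<noteq> l"
    have "(\<Sum>j\<in>I. (if j = k then 1 else if j = l then - 1 else 0) * v j i) = 0" for i
    proof -
      have "(\<Sum>j\<in>I. (if j = k then 1 else if j = l then - 1 else 0) * v j i) =
        (\<Sum>j\<in>{k, l}. (if j = k then 1 else if j = l then - 1 else 0) * v j i)"
        using kl assms(1) by (intro sum.mono_neutral_right) auto
      then show ?thesis using kl by simp
    qed
    from lin_indepD[OF assms(2) this kl(1)] show False by simp
  qed
  show "cv.independent (v ` I)"
  proof (rule cv.independent_if_scalars_zero)
    show "finite (v ` I)" using assms by simp
    fix f x assume f: "(\<Sum>x\<in>v ` I. cscale (f x) x) = 0" and x: "x \<in> v ` I"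
    have "(\<Sum>l\<in>I. f (v l) * v l i) = 0" for i
      using f sum_cscale_apply[of "\<lambda>x. f x" "\<lambda>x. x" "v ` I" i]
      by (simp add: sum.reindex[OF inj])
    from lin_indepD[OF assms(2) this] x show "f x = 0" by auto
  qed
qed

lemma lin_indep_dim:
  "finite I \<Longrightarrow> lin_indep I v \<Longrightarrow> cv.dim (cv.span (v ` I)) = card I"
  using lin_indep_independent[of I v] cv.dim_span_eq_card_independent[of "v ` I"]
  by (auto simp: card_image)

lemma lin_indep_units: "finite I \<Longrightarrow> lin_indep I unit"
proof (rule lin_indepI)
  fix c :: "nat \<Rightarrow> complex" and l assume I: "finite I" and c: "\<And>i. (\<Sum>l\<in>I. c l * unit l i) = 0" and l: "l \<in> I"
  have "(\<Sum>k\<in>I. c k * unit k l) = (\<Sum>k\<in>I. if k = l then c k else 0)"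
    by (rule sum.cong) (auto simp: unit_def)
  then show "c l = 0" using c[of l] l I by (simp add: sum.delta)
qed

lemma dim_ambient: "cv.dim (ambient N) = N"
  using lin_indep_dim[OF _ lin_indep_units, of "{..<N}"] by (simp add: span_units)

lemma dim_zero: "cv.dim {0} = 0"
  using cv.dim_le_card[of "{0}" "{}"] by simp

lemma dim_csum:
  assumes "cv.subspace S" "cv.subspace T" "S \<subseteq> ambient N" "T \<subseteq> ambient N"
  shows "cv.dim (csum S T) + cv.dim (S \<inter> T) = cv.dim S + cv.dim T"
  unfolding csum_def using assms
  by (intro cv.dim_Un_Int[of "unit ` {..<N}"]) (auto simp: span_units)

lemma dim_mono:
  assumes "cv.subspace S" "cv.subspace T" "S \<subseteq> T" "T \<subseteq> ambient N"
  shows "cv.dim S \<le> cv.dim T"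
  using assms by (intro cv.dim_subspace_mono[of "unit ` {..<N}"]) (auto simp: span_units)

lemma subspace_eqI:
  assumes "cv.subspace S" "cv.subspace T" "S \<subseteq> T" "T \<subseteq> ambient N" "cv.dim T \<le> cv.dim S"
  shows "S = T"
  using assms by (intro cv.subspace_eqI_dim[of "unit ` {..<N}"]) (auto simp: span_units)

lemma dim_eq_0:
  assumes "cv.subspace S" "S \<subseteq> ambient N" "cv.dim S = 0"
  shows "S = {0}"
  using subspace_eqI[of "{0}" S N] assms by (auto simp: cv.subspace_0 dim_zero)

lemma dim_le_ambient: "cv.subspace S \<Longrightarrow> S \<subseteq> ambient N \<Longrightarrow> cv.dim S \<le> N"
  using dim_mono[OF _ subspace_ambient, of S N N] by (simp add: dim_ambient)

lemma subspace_csum: "cv.subspace (csum S T)"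
  unfolding csum_def by (rule cv.subspace_span)

lemma csum_ambient: "S \<subseteq> ambient N \<Longrightarrow> T \<subseteq> ambient N \<Longrightarrow> csum S T \<subseteq> ambient N"
  unfolding csum_def by (rule cv.span_minimal) (auto simp: subspace_ambient)

lemma csum_upper1: "S \<subseteq> csum S T" and csum_upper2: "T \<subseteq> csum S T"
  unfolding csum_def by (auto intro: cv.span_base)

lemma csum_least: "cv.subspace W \<Longrightarrow> S \<subseteq> W \<Longrightarrow> T \<subseteq> W \<Longrightarrow> csum S T \<subseteq> W"
  unfolding csum_def by (rule cv.span_minimal) auto

lemma csum_commute: "csum S T = csum T S"
  by (simp add: csum_def Un_commute)

lemma csum_mono: "S \<subseteq> S' \<Longrightarrow> T \<subseteq> T' \<Longrightarrow> csum S T \<subseteq> csum S' T'"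
  unfolding csum_def by (rule cv.span_mono) auto

text \<open>The modular law of subspaces; it is what recovers \<open>K\<close> from
  \<open>K \<inter> T h\<close> and \<open>V\<close>, and compares intersections of \<open>K\<close>
  with those of \<open>K \<inter> T h\<close>.\<close>

lemma csum_modular:
  assumes "cv.subspace S" "cv.subspace T" "cv.subspace K" "S \<subseteq> K"
  shows "K \<inter> csum S T = csum S (K \<inter> T)"
proof
  show "csum S (K \<inter> T) \<subseteq> K \<inter> csum S T"
    using assms csum_least[of K S "K \<inter> T"] csum_mono[of S S "K \<inter> T" T] by auto
  show "K \<inter> csum S T \<subseteq> csum S (K \<inter> T)"
  proof
    fix x assume x: "x \<in> K \<inter> csum S T"
    then obtain s t where st: "x = s + t" "s \<in> S" "t \<in> T"
      using assms by (auto simp: csum_def cv.span_Un cv.span_eq_iff[THEN iffD2])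
    then have "t \<in> K" using x assms(3,4) cv.subspace_diff[of K x s] by auto
    then show "x \<in> csum S (K \<inter> T)"
      using st unfolding csum_def by (auto intro!: cv.span_add intro: cv.span_base)
  qed
qed

lemma dim_int_ge:
  assumes "cv.subspace S" "cv.subspace T" "cv.subspace W" "S \<subseteq> W" "T \<subseteq> W" "W \<subseteq> ambient N"
  shows "cv.dim S + cv.dim T \<le> cv.dim (S \<inter> T) + cv.dim W"
proof -
  have "cv.dim (csum S T) \<le> cv.dim W"
    using assms by (intro dim_mono[OF subspace_csum _ csum_least]) auto
  then show ?thesis using dim_csum[of S T N] assms by fastforce
qed

section \<open>Flags spanned by columns and their jumps along a subspace\<close>

text \<open>Column \<open>l\<close> of the \<open>k\<close>-th \<open>N\<close> by \<open>N\<close>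
  matrix of parameters, in the numbering of \<open>flags_of\<close> for the standard frame. The cut
  at \<open>N\<close> keeps it in the ambient space.\<close>

definition col :: "nat \<Rightarrow> (nat \<Rightarrow> complex) \<Rightarrow> nat \<Rightarrow> nat \<Rightarrow> cvec" where
  "col N x k l = (\<lambda>i. if i < N then x ((k * N + l) * N + i) else 0)"

lemma col_in_ambient: "col N x k l \<in> ambient N"
  by (simp add: col_def ambient_def)

lemma qdim_ambient: "qdim {0} (ambient N) = N"
  by (simp add: qdim_def dim_ambient dim_zero)

lemma flags_of_std: "flags_of {0} (ambient N) unit x k j = cv.span (col N x k ` {..<j})"
proof -
  have "(\<Sum>i<N. cscale (x ((k * N + l) * N + i)) (unit i)) = col N x k l" for l
    by (rule ext)
      (auto simp: sum_cscale_apply unit_def col_def if_distrib sum.delta cong: if_cong)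
  then have "{\<Sum>i<N. cscale (x ((k * N + l) * N + i)) (unit i) |l. l < j} = col N x k ` {..<j}"
    by auto
  then show ?thesis by (simp add: flags_of_def qdim_ambient)
qed

lemma frame_std: "frame {0} (ambient N) unit"
  by (auto simp: frame_def subspace_ambient dim_zero qdim_ambient span_units cv.subspace_0)

lemma span_cols_ambient: "cv.span (col N x k ` A) \<subseteq> ambient N"
  by (rule cv.span_minimal) (auto simp: col_in_ambient subspace_ambient)

lemma dim_flag:
  assumes "lin_indep {..<N} v" "m \<le> N"
  shows "cv.dim (cv.span (v ` {..<m})) = m"
  using lin_indep_dim[OF _ lin_indep_subset[OF assms(1)], of "{..<m}"] assms by auto

text \<open>The Schubert position of \<open>H\<close> relative to the flag, with columns numbered
  from 0: \<open>l\<close> is a jump if adding column \<open>l\<close> enlarges the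
  intersection.\<close>

definition flag_jumps :: "nat \<Rightarrow> cvec set \<Rightarrow> (nat \<Rightarrow> cvec) \<Rightarrow> nat set" where
  "flag_jumps N H v = {l. l < N \<and> cv.dim (H \<inter> cv.span (v ` {..<Suc l})) \<noteq> cv.dim (H \<inter> cv.span (v ` {..<l}))}"

context
  fixes N :: nat and H :: "cvec set" and v :: "nat \<Rightarrow> cvec" and F :: "nat \<Rightarrow> cvec set"
  assumes v: "lin_indep {..<N} v" "\<And>l. v l \<in> ambient N"
    and H: "cv.subspace H" "H \<subseteq> ambient N"
  defines "F \<equiv> \<lambda>m. cv.span (v ` {..<m})"
begin

lemma flag_sub: "F m \<subseteq> ambient N"
  unfolding F_def by (rule cv.span_minimal) (auto simp: v subspace_ambient)

lemma flag_mono: "m \<le> m' \<Longrightarrow> F m \<subseteq> F m'"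
  unfolding F_def by (rule cv.span_mono) auto

lemma flag_subspace: "cv.subspace (F m)"
  unfolding F_def by (rule cv.subspace_span)

text \<open>Each step is a hyperplane in the next one, so the intersection with \<open>H\<close>
  grows by at most 1.\<close>

lemma dim_flag_jumps:
  "m \<le> N \<Longrightarrow> cv.dim (H \<inter> F m) = card {l \<in> flag_jumps N H v. l < m}"
proof (induction m)
  case 0
  have "H \<inter> F 0 = {0}" using H by (auto simp: F_def cv.subspace_0)
  then show ?case by (simp add: dim_zero)
next
  case (Suc m)
  have *: "H \<inter> F (Suc m) \<inter> F m = H \<inter> F m" using flag_mono[of m "Suc m"] by auto
  have "cv.dim (H \<inter> F (Suc m)) + cv.dim (F m) \<le> cv.dim (H \<inter> F (Suc m) \<inter> F m) + cv.dim (F (Suc m))"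
    using flag_mono[of m "Suc m"] flag_sub flag_subspace H
    by (intro dim_int_ge) (auto intro: cv.subspace_inter)
  then have le: "cv.dim (H \<inter> F (Suc m)) \<le> cv.dim (H \<inter> F m) + 1"
    unfolding * using dim_flag[OF v(1), of m] dim_flag[OF v(1), of "Suc m"] Suc.prems
    by (simp add: F_def)
  have ge: "cv.dim (H \<inter> F m) \<le> cv.dim (H \<inter> F (Suc m))"
    by (rule dim_mono) (use flag_mono[of m "Suc m"] flag_subspace H in \<open>auto intro: cv.subspace_inter\<close>)
  have "{l \<in> flag_jumps N H v. l < Suc m} =
      (if m \<in> flag_jumps N H v then insert m else id) {l \<in> flag_jumps N H v. l < m}"
    by (auto simp: less_Suc_eq)
  moreover have "finite {l \<in> flag_jumps N H v. l < m}"
    by (rule finite_subset[of _ "{..<m}"]) auto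
  ultimately have "card {l \<in> flag_jumps N H v. l < Suc m} =
      card {l \<in> flag_jumps N H v. l < m} + (if m \<in> flag_jumps N H v then 1 else 0)"
    by auto
  moreover have "m \<in> flag_jumps N H v \<longleftrightarrow> cv.dim (H \<inter> F (Suc m)) \<noteq> cv.dim (H \<inter> F m)"
    using Suc.prems by (simp add: flag_jumps_def F_def)
  ultimately show ?case using Suc le ge by auto
qed

text \<open>At a jump, a vector of \<open>H\<close> that is new in this step can be exchanged for
  the column. So a jump column is redundant modulo \<open>H\<close> and the earlier non-jump
  columns, which is how the charts parametrise it.\<close>

lemma flag_decomposition:
  "m \<le> N \<Longrightarrow> F m \<subseteq> csum H (cv.span (v ` ({..<m} - flag_jumps N H v)))"
proof (induction m)
  case 0
  then show ?case
    using cv.subspace_0[OF subspace_csum] by (auto simp: F_def)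
next
  case (Suc m)
  let ?J = "flag_jumps N H v"
  let ?R = "csum H (cv.span (v ` ({..<Suc m} - ?J)))"
  have "cv.span (v ` ({..<m} - ?J)) \<subseteq> cv.span (v ` ({..<Suc m} - ?J))"
    by (rule cv.span_mono) auto
  then have sub: "F m \<subseteq> ?R"
    using Suc.IH Suc.prems csum_mono[OF order_refl] by (meson Suc_leD subset_trans)
  have "v m \<in> ?R"
  proof (cases "m \<in> ?J")
    case False
    then have "v m \<in> cv.span (v ` ({..<Suc m} - ?J))" by (auto intro: cv.span_base)
    then show ?thesis using csum_upper2 by blast
  next
    case True
    then have "H \<inter> F (Suc m) \<noteq> H \<inter> F m" by (auto simp: flag_jumps_def F_def)
    then obtain w where w: "w \<in> H" "w \<in> F (Suc m)" "w \<notin> F m"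
      using flag_mono[of m "Suc m"] by auto
    then have "v m \<in> cv.span (insert w (v ` {..<m}))"
      by (auto simp: F_def lessThan_Suc intro!: cv.in_span_insert)
    also have "\<dots> \<subseteq> ?R"
    proof (rule cv.span_minimal[OF _ subspace_csum])
      show "insert w (v ` {..<m}) \<subseteq> ?R"
        using w(1) csum_upper1[of H] sub cv.span_superset[of "v ` {..<m}"] unfolding F_def by blast
    qed
    finally show ?thesis .
  qed
  then show ?case
    using sub cv.span_superset[of "v ` {..<m}"] unfolding F_def lessThan_Suc image_insert
    by (intro cv.span_minimal subspace_csum) blast
qed

end

section \<open>Graph charts of the Grassmannian\<close>

text \<open>\<open>\<pi>\<close> orders the coordinates: positions below \<open>s\<close> are the
  pivots, and \<open>X t\<close> gives the graph over pivot \<open>t\<close> in the remaining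
  coordinate directions.\<close>

definition graph_basis :: "(nat \<Rightarrow> nat) \<Rightarrow> nat \<Rightarrow> nat \<Rightarrow> (nat \<Rightarrow> nat \<Rightarrow> complex) \<Rightarrow> nat \<Rightarrow> cvec" where
  "graph_basis \<pi> N s X t = (\<lambda>i. unit (\<pi> t) i + (\<Sum>u\<in>{s..<N}. X t u * unit (\<pi> u) i))"

text \<open>A basis of \<open>H\<close> is completed to one of the ambient space by unit vectors.
  Their indices \<open>R\<close> become the free coordinates and the other indices the pivots, over
  which \<open>H\<close> is a graph.\<close>

lemma subspace_is_graph:
  assumes H: "cv.subspace H" "H \<subseteq> ambient N" "cv.dim H = s"
  obtains \<pi> X where "bij_betw \<pi> {..<N} {..<N}" "\<pi> \<in> {..<N} \<rightarrow>\<^sub>E {..<N}"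
    "cv.span (graph_basis \<pi> N s X ` {..<s}) = H"
proof -
  let ?U = "unit ` {..<N}"
  obtain C where C: "C \<subseteq> H" "cv.independent C" "finite C" "cv.span C = H" "card C = s"
    by (rule cv.finite_basis_extend[of ?U H "{}"])
      (use H cv.independent_empty in \<open>auto simp: span_units\<close>)
  obtain D where D: "C \<subseteq> D" "D \<subseteq> C \<union> ?U" "cv.independent D" "C \<union> ?U \<subseteq> cv.span D"
    using cv.maximal_independent_subset_extend[of C "C \<union> ?U"] C(2) by auto
  have finD: "finite D" using D(2) C(3) finite_subset by blast
  have "?U \<subseteq> ambient N" by (auto simp: unit_in_ambient)
  then have "cv.span D \<subseteq> ambient N"
    using D(2) C(1) H(2) by (intro cv.span_minimal subspace_ambient) blast
  moreover have "ambient N \<subseteq> cv.span D"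
    using D(4) unfolding span_units[symmetric] by (intro cv.span_minimal cv.subspace_span) auto
  ultimately have spanD: "cv.span D = ambient N" by blast
  then have "card D = N"
    using cv.dim_span_eq_card_independent[OF D(3)] by (simp add: dim_ambient)
  define R where "R = {i. i < N \<and> unit i \<in> D - C}"
  have inj: "inj_on unit A" for A
    by (rule inj_onI) (metis unit_def zero_neq_one)
  have DC: "unit ` R = D - C" using D(2) by (auto simp: R_def)
  then have "card R = card (D - C)" using card_image[OF inj] by metis
  also have "\<dots> = N - s" using D(1) C finD \<open>card D = N\<close> by (simp add: card_Diff_subset)
  finally have cR: "card R = N - s" .
  have sN: "s \<le> N" using dim_le_ambient[OF H(1,2)] H(3) by simp
  have R: "R \<subseteq> {..<N}" "finite R" by (auto simp: R_def)
  obtain f where f: "bij_betw f {..<s} ({..<N} - R)"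
    using finite_same_card_bij[of "{..<s}" "{..<N} - R"] R cR sN by (auto simp: card_Diff_subset)
  obtain g where g: "bij_betw g {s..<N} R"
    using finite_same_card_bij[of "{s..<N}" R] R cR by auto
  \<comment> \<open>The restriction leaves only finitely many possible \<open>\<pi>\<close>, hence
    finitely many charts.\<close>
  define \<pi> where "\<pi> = restrict (\<lambda>t. if t < s then f t else g t) {..<N}"
  have pf: "bij_betw \<pi> {..<s} ({..<N} - R)"
    using f sN by (subst bij_betw_cong[of _ _ f]) (auto simp: \<pi>_def)
  have pg: "bij_betw \<pi> {s..<N} R"
    using g by (subst bij_betw_cong[of _ _ g]) (auto simp: \<pi>_def)
  have "bij_betw \<pi> ({..<s} \<union> {s..<N}) (({..<N} - R) \<union> R)"
    by (rule bij_betw_combine[OF pf pg]) auto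
  moreover have "{..<s} \<union> {s..<N} = {..<N}" "({..<N} - R) \<union> R = {..<N}" using sN R by auto
  ultimately have bij: "bij_betw \<pi> {..<N} {..<N}" by simp
  then have "\<pi> ` {..<N} = {..<N}" by (simp add: bij_betw_def)
  moreover have "\<pi> \<in> extensional {..<N}" by (simp add: \<pi>_def)
  ultimately have ext: "\<pi> \<in> {..<N} \<rightarrow>\<^sub>E {..<N}" unfolding PiE_def Pi_def by blast
  have ex: "\<exists>x. (\<lambda>i. unit q i + (\<Sum>u\<in>{s..<N}. x u * unit (\<pi> u) i)) \<in> H" if q: "q < N" for q
  proof -
    have "unit q \<in> cv.span (C \<union> unit ` R)"
      using unit_in_ambient[OF q] spanD DC D(1) by (metis Un_Diff_cancel Un_absorb1)
    then obtain h w where hw: "unit q = h + w" "h \<in> H" "w \<in> cv.span (unit ` R)"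
      by (auto simp: cv.span_Un C(4))
    then obtain c where c: "w = (\<Sum>y\<in>unit ` R. cscale (c y) y)"
      using cv.span_finite[of "unit ` R"] R(2) by auto
    have "w = (\<Sum>u\<in>R. cscale (c (unit u)) (unit u))"
      unfolding c by (subst sum.reindex[OF inj]) simp
    also have "\<dots> = (\<Sum>u\<in>{s..<N}. cscale (c (unit (\<pi> u))) (unit (\<pi> u)))"
      by (rule sum.reindex_bij_betw[OF pg, symmetric])
    finally have w: "w i = (\<Sum>u\<in>{s..<N}. c (unit (\<pi> u)) * unit (\<pi> u) i)" for i
      by (simp add: sum_cscale_apply)
    have "h = (\<lambda>i. unit q i + (\<Sum>u\<in>{s..<N}. - c (unit (\<pi> u)) * unit (\<pi> u) i))"
    proof
      fix i
      have "unit q i = h i + w i" by (simp add: hw(1))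
      then show "h i = unit q i + (\<Sum>u\<in>{s..<N}. - c (unit (\<pi> u)) * unit (\<pi> u) i)"
        by (simp add: w sum_negf)
    qed
    then show ?thesis using hw(2) by (intro exI[of _ "\<lambda>u. - c (unit (\<pi> u))"]) simp
  qed
  have pN: "\<pi> t < N" if "t < N" for t using bij that by (auto simp: bij_betw_def)
  obtain X where X: "\<And>t. t < N \<Longrightarrow> graph_basis \<pi> N s X t \<in> H"
    using ex[OF pN] unfolding graph_basis_def by metis
  let ?B = "graph_basis \<pi> N s X"
  have pinj: "\<pi> a = \<pi> b \<longleftrightarrow> a = b" if "a < N" "b < N" for a b
    using bij that by (auto simp: bij_betw_def inj_on_def)
  have diag: "?B t (\<pi> l) = (if t = l then 1 else 0)" if "t < s" "l < s" for t l
  proof -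
    have "(\<Sum>u\<in>{s..<N}. X t u * unit (\<pi> u) (\<pi> l)) = 0"
      using that sN pinj by (intro sum.neutral) (auto simp: unit_def)
    then show ?thesis using that sN pinj by (auto simp: graph_basis_def unit_def)
  qed
  have "lin_indep {..<s} ?B"
  proof (rule lin_indepI)
    fix c l assume c: "\<And>i. (\<Sum>t\<in>{..<s}. c t * ?B t i) = 0" and l: "l \<in> {..<s}"
    have "(\<Sum>t\<in>{..<s}. c t * ?B t (\<pi> l)) = (\<Sum>t\<in>{..<s}. if t = l then c t else 0)"
      by (rule sum.cong) (use l diag in auto)
    then show "c l = 0" using c[of "\<pi> l"] l by simp
  qed
  then have "cv.dim (cv.span (?B ` {..<s})) = s"
    using lin_indep_dim[of "{..<s}" ?B] by simp
  then have "cv.span (?B ` {..<s}) = H"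
    using H X sN by (intro subspace_eqI[of _ H N] cv.subspace_span cv.span_minimal) auto
  then show ?thesis using that bij ext by blast
qed

section \<open>Counting parameters of a Schubert cell\<close>

text \<open>The last positions that the conditions of \<open>lam\<close> allow for the jumps, hence
  those of a general point of the Schubert variety. The final \<open>- 1\<close> turns the dimension
  of a step into the index of its last column.\<close>

definition schubert_jumps :: "nat \<Rightarrow> nat \<Rightarrow> nat list \<Rightarrow> nat set" where
  "schubert_jumps N s lam = (\<lambda>i. N - s + i - part lam i - 1) ` {1..s}"

text \<open>If \<open>J\<close> is the set of jumps, then \<open>card ({..<l} - J)\<close> is the number of free coefficients in the jump
  column \<open>l\<close> of the charts below.\<close>

lemma count_nonjumps:
  fixes p :: "nat \<Rightarrow> nat"
  assumes J: "J \<subseteq> {..<N}" "card J = s"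
    and p: "\<And>i. i \<in> {1..s} \<Longrightarrow> p i \<le> N - s"
    and cnt: "\<And>i. i \<in> {1..s} \<Longrightarrow> i \<le> card {l \<in> J. l < N - s + i - p i}"
  shows "(\<Sum>l\<in>J. card ({..<l} - J)) + (\<Sum>i\<in>{1..s}. p i) \<le> s * (N - s)"
    and "(\<Sum>l\<in>J. card ({..<l} - J)) + (\<Sum>i\<in>{1..s}. p i) = s * (N - s) \<Longrightarrow>
      J = (\<lambda>i. N - s + i - p i - 1) ` {1..s}"
proof -
  have fin: "finite J" using J finite_subset by blast
  define xs where "xs = sorted_list_of_set J"
  have xs: "set xs = J" "distinct xs" "sorted xs" "length xs = s"
    using fin J by (auto simp: xs_def)
  have sN: "s \<le> N" using J card_mono[of "{..<N}" J] by simp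
  have below: "card {l \<in> J. l < xs ! i} = i" if "i < s" for i
  proof -
    have "{l \<in> J. l < xs ! i} = (!) xs ` {..<i}"
    proof (intro set_eqI iffI)
      fix l assume "l \<in> {l \<in> J. l < xs ! i}"
      then obtain j where "j < s" "l = xs ! j" "xs ! j < xs ! i"
        using xs by (auto simp: in_set_conv_nth)
      then show "l \<in> (!) xs ` {..<i}"
        using sorted_nth_mono[OF xs(3), of i j] xs(4) that by (cases "j < i") auto
    next
      fix l assume "l \<in> (!) xs ` {..<i}"
      then obtain j where j: "j < i" "l = xs ! j" by auto
      then have "xs ! j < xs ! i"
        using sorted_nth_mono[OF xs(3), of j i] xs(2,4) that nth_eq_iff_index_eq[OF xs(2), of j i]
        by (simp add: order.strict_iff_order)
      then show "l \<in> {l \<in> J. l < xs ! i}" using xs j that nth_mem[of j xs] by auto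
    qed
    moreover have "inj_on ((!) xs) {..<i}" using xs that by (auto simp: inj_on_def nth_eq_iff_index_eq)
    ultimately show ?thesis by (simp add: card_image)
  qed
  \<comment> \<open>With numbering from 0, the jump \<open>xs ! i\<close> lies before the bound of
    condition \<open>Suc i\<close>; otherwise at most \<open>i\<close> jumps would.\<close>
  have lt: "xs ! i < N - s + Suc i - p (Suc i)" if "i < s" for i
  proof (rule ccontr)
    assume "\<not> ?thesis"
    then have "card {l \<in> J. l < N - s + Suc i - p (Suc i)} \<le> card {l \<in> J. l < xs ! i}"
      using fin by (intro card_mono) auto
    then show False using cnt[of "Suc i"] below[OF that] that by auto
  qed
  have term_eq: "card ({..<xs ! i} - J) = xs ! i - i" if "i < s" for i
  proof -
    have "{..<xs ! i} - J = {..<xs ! i} - {l \<in> J. l < xs ! i}" by auto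
    also have "card \<dots> = xs ! i - i"
      using below[OF that] fin by (subst card_Diff_subset) auto
    finally show ?thesis .
  qed
  have tle: "card ({..<xs ! i} - J) + p (Suc i) \<le> N - s" if "i < s" for i
    using lt[OF that] p[of "Suc i"] that by (auto simp: term_eq)
  have sum1: "(\<Sum>l\<in>J. card ({..<l} - J)) = (\<Sum>i<s. card ({..<xs ! i} - J))"
  proof -
    have "bij_betw ((!) xs) {..<s} J" using bij_betw_nth[OF xs(2)] xs by auto
    from sum.reindex_bij_betw[OF this, symmetric] show ?thesis .
  qed
  have sum2: "(\<Sum>i\<in>{1..s}. p i) = (\<Sum>i<s. p (Suc i))"
    by (rule sum.reindex_bij_witness[of _ Suc "\<lambda>i. i - 1"]) auto
  have tot: "(\<Sum>l\<in>J. card ({..<l} - J)) + (\<Sum>i\<in>{1..s}. p i) =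
      (\<Sum>i<s. card ({..<xs ! i} - J) + p (Suc i))"
    unfolding sum1 sum2 by (rule sum.distrib[symmetric])
  have "(\<Sum>i<s. card ({..<xs ! i} - J) + p (Suc i)) \<le> (\<Sum>i<s. N - s)"
    by (rule sum_mono) (use tle in auto)
  then show "(\<Sum>l\<in>J. card ({..<l} - J)) + (\<Sum>i\<in>{1..s}. p i) \<le> s * (N - s)"
    unfolding tot by simp
  assume "(\<Sum>l\<in>J. card ({..<l} - J)) + (\<Sum>i\<in>{1..s}. p i) = s * (N - s)"
  then have eq: "(\<Sum>i<s. card ({..<xs ! i} - J) + p (Suc i)) = (\<Sum>i<s. N - s)"
    unfolding tot by simp
  \<comment> \<open>Every term is bounded by \<open>N - s\<close>, so equality of the sums forces
    equality in each term and pins down each jump.\<close>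
  have teq: "card ({..<xs ! i} - J) + p (Suc i) = N - s" if "i < s" for i
  proof (rule ccontr)
    assume "\<not> ?thesis"
    then have "card ({..<xs ! i} - J) + p (Suc i) < N - s" using tle[OF that] by simp
    then have "(\<Sum>i<s. card ({..<xs ! i} - J) + p (Suc i)) < (\<Sum>i<s. N - s)"
      using that tle by (intro sum_strict_mono_ex1) auto
    then show False using eq by simp
  qed
  have ge: "i \<le> xs ! i" if "i < s" for i
    using below[OF that] card_mono[of "{..<xs ! i}" "{l \<in> J. l < xs ! i}"] by auto
  have nth: "xs ! i = N - s + Suc i - p (Suc i) - 1" if "i < s" for i
    using teq[OF that] ge[OF that] by (simp add: term_eq[OF that])
  have "J = (!) xs ` {..<s}" using xs by (auto simp: in_set_conv_nth)
  also have "\<dots> = (\<lambda>i. N - s + Suc i - p (Suc i) - 1) ` {..<s}" using nth by auto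
  also have "\<dots> = (\<lambda>i. N - s + i - p i - 1) ` Suc ` {..<s}" by (simp add: image_image)
  also have "Suc ` {..<s} = {1..s}"
    by (auto simp: image_iff) (metis Suc_le_D Suc_le_lessD lessThan_iff)
  finally show "J = (\<lambda>i. N - s + i - p i - 1) ` {1..s}" .
qed

lemma sum_part: "length lam \<le> s \<Longrightarrow> (\<Sum>i\<in>{1..s}. part lam i) = sum_list lam"
proof -
  assume len: "length lam \<le> s"
  have "(\<Sum>i\<in>{1..s}. part lam i) = (\<Sum>i\<in>{1..length lam}. part lam i)"
    using len by (intro sum.mono_neutral_right) (auto simp: Defs.part_def)
  also have "\<dots> = (\<Sum>i<length lam. lam ! i)"
    by (rule sum.reindex_bij_witness[of _ Suc "\<lambda>i. i - 1"]) (auto simp: Defs.part_def)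
  also have "\<dots> = sum_list lam" by (simp add: sum_list_sum_nth lessThan_atLeast0)
  finally show ?thesis .
qed

lemma part_le: "in_box k l lam \<Longrightarrow> part lam i \<le> l"
  by (auto simp: Defs.part_def in_box_def)

section \<open>Polynomial charts for pairs of a subspace and a tuple of flags\<close>

type_synonym param = "nat \<times> nat \<times> nat \<times> nat"

text \<open>A subspace is parametrised as a graph by the parameters \<open>(0,0,t,u)\<close>. For each flag, the columns
  outside the jump set are free with parameters \<open>(1,k,l,i)\<close>, and a jump column is a vector of the
  subspace with coordinates \<open>(2,k,l,t)\<close> plus a combination with coefficients \<open>(3,k,l,l')\<close> of the preceding
  non-jump columns.\<close>

definition chart_basis :: "(nat \<Rightarrow> nat) \<Rightarrow> nat \<Rightarrow> nat \<Rightarrow> (param \<Rightarrow> complex) \<Rightarrow> nat \<Rightarrow> cvec" where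
  "chart_basis \<pi> N s z = graph_basis \<pi> N s (\<lambda>t u. z (0, 0, t, u))"

definition chart_col ::
  "(nat \<Rightarrow> nat) \<Rightarrow> nat \<Rightarrow> nat \<Rightarrow> (nat \<Rightarrow> nat set) \<Rightarrow> (param \<Rightarrow> complex) \<Rightarrow> nat \<Rightarrow> nat \<Rightarrow> cvec" where
  "chart_col \<pi> N s J z k l = (\<lambda>i. if l \<in> J k
     then (\<Sum>t<s. z (2, k, l, t) * chart_basis \<pi> N s z t i) +
          (\<Sum>l'\<in>{..<l} - J k. z (3, k, l, l') * (if i < N then z (1, k, l', i) else 0))
     else if i < N then z (1, k, l, i) else 0)"

definition chart_vars :: "nat \<Rightarrow> nat \<Rightarrow> nat \<Rightarrow> (nat \<Rightarrow> nat set) \<Rightarrow> param set" where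
  "chart_vars N s r J = {0} \<times> {0} \<times> {..<s} \<times> {s..<N} \<union>
     (\<Union>k<r. ({1} \<times> {k} \<times> ({..<N} - J k) \<times> {..<N} \<union> {2} \<times> {k} \<times> J k \<times> {..<s}) \<union>
       Pair 3 ` Pair k ` (SIGMA l:J k. {..<l} - J k))"

lemma finite_chart_vars:
  assumes "\<And>k. k < r \<Longrightarrow> J k \<subseteq> {..<N}"
  shows "finite (chart_vars N s r J)"
proof -
  have "finite (J k)" if "k < r" for k using assms[OF that] finite_subset by blast
  then show ?thesis unfolding chart_vars_def by (intro finite_UnI finite_UN_I) auto
qed

text \<open>The graph has \<open>s * (N - s)\<close> parameters. Each flag has
  \<open>N * (N - s)\<close> entries of free columns, \<open>s * s\<close> coordinates of its jump
  columns in the subspace, and one coefficient for each non-jump before a jump.\<close>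

lemma card_chart_vars:
  assumes J: "\<And>k. k < r \<Longrightarrow> J k \<subseteq> {..<N}" "\<And>k. k < r \<Longrightarrow> card (J k) = s" and sN: "s \<le> N"
  shows "card (chart_vars N s r J) \<le> s * (N - s) +
    (\<Sum>k<r. N * (N - s) + s * s + (\<Sum>l\<in>J k. card ({..<l} - J k)))"
proof -
  have fin: "finite (J k)" if "k < r" for k using J(1)[OF that] finite_subset by blast
  have one: "card (({1 :: nat} \<times> {k} \<times> ({..<N} - J k) \<times> {..<N} \<union> {2} \<times> {k} \<times> J k \<times> {..<s}) \<union>
       Pair 3 ` Pair k ` (SIGMA l:J k. {..<l} - J k)) \<le>
     N * (N - s) + s * s + (\<Sum>l\<in>J k. card ({..<l} - J k))" if k: "k < r" for k
  proof -
    have "card ({1 :: nat} \<times> {k} \<times> ({..<N} - J k) \<times> {..<N}) = N * (N - s)"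
      using J[OF k] fin[OF k] by (simp add: card_cartesian_product card_Diff_subset)
    moreover have "card ({2 :: nat} \<times> {k} \<times> J k \<times> {..<s}) = s * s"
      using J[OF k] by (simp add: card_cartesian_product)
    moreover have "card (Pair (3 :: nat) ` Pair k ` (SIGMA l:J k. {..<l} - J k)) =
        (\<Sum>l\<in>J k. card ({..<l} - J k))"
      using fin[OF k] by (subst card_image; (subst card_image)?) (auto simp: inj_on_def card_SigmaI)
    ultimately show ?thesis
      by (intro order_trans[OF card_Un_le] add_mono order_trans[OF card_Un_le]) auto
  qed
  have "card (chart_vars N s r J) \<le> card ({0 :: nat} \<times> {0 :: nat} \<times> {..<s} \<times> {s..<N}) +
    card (\<Union>k<r. ({1 :: nat} \<times> {k} \<times> ({..<N} - J k) \<times> {..<N} \<union> {2} \<times> {k} \<times> J k \<times> {..<s}) \<union>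
       Pair 3 ` Pair k ` (SIGMA l:J k. {..<l} - J k))"
    unfolding chart_vars_def by (rule card_Un_le)
  also have "\<dots> \<le> s * (N - s) +
    (\<Sum>k<r. N * (N - s) + s * s + (\<Sum>l\<in>J k. card ({..<l} - J k)))"
    by (intro add_mono order_trans[OF card_UN_le] sum_mono one) (auto simp: card_cartesian_product)
  finally show ?thesis .
qed

lemma chart_basis_polys:
  "t < s \<Longrightarrow> (\<lambda>z. chart_basis \<pi> N s z t i) \<in> polys (chart_vars N s r J)"
  unfolding chart_basis_def graph_basis_def
  by (intro polys.add polys.mult polys.const polys_sum polys.var) (auto simp: chart_vars_def)

lemma chart_col_polys:
  assumes "k < r" "l < N"
  shows "(\<lambda>z. chart_col \<pi> N s J z k l i) \<in> polys (chart_vars N s r J)"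
  unfolding chart_col_def using assms
  by (intro polys_if polys.add polys.mult polys.const polys_sum polys.var chart_basis_polys)
    (auto simp: chart_vars_def image_iff)

lemma span_image_coeffs:
  assumes "finite I" "x \<in> cv.span (v ` I)"
  shows "\<exists>c. x = (\<Sum>l\<in>I. cscale (c l) (v l))"
proof -
  let ?S = "range (\<lambda>c. \<Sum>l\<in>I. cscale (c l) (v l))"
  have "cv.subspace ?S"
  proof (rule cv.subspaceI)
    show "0 \<in> ?S" by (rule image_eqI[of _ _ "\<lambda>_. 0"]) auto
  next
    fix x y assume "x \<in> ?S" "y \<in> ?S"
    then obtain c d where "x = (\<Sum>l\<in>I. cscale (c l) (v l))" "y = (\<Sum>l\<in>I. cscale (d l) (v l))" by blast
    then show "x + y \<in> ?S"
      by (intro image_eqI[of _ _ "\<lambda>l. c l + d l"])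
        (auto simp: cv.scale_left_distrib sum.distrib)
  next
    fix a x assume "x \<in> ?S"
    then obtain c where "x = (\<Sum>l\<in>I. cscale (c l) (v l))" by blast
    then show "cscale a x \<in> ?S"
      by (intro image_eqI[of _ _ "\<lambda>l. a * c l"]) (auto simp: cv.scale_sum_right)
  qed
  moreover have "v ` I \<subseteq> ?S"
  proof
    fix y assume "y \<in> v ` I"
    then obtain k where k: "k \<in> I" "y = v k" by blast
    have "(\<Sum>l\<in>I. cscale (if l = k then 1 else 0) (v l)) = (\<Sum>l\<in>I. if l = k then v l else 0)"
      by (rule sum.cong) auto
    then show "y \<in> ?S"
      using k assms(1) by (intro image_eqI[of _ _ "\<lambda>l. if l = k then 1 else 0"]) auto
  qed
  ultimately have "cv.span (v ` I) \<subseteq> ?S" by (intro cv.span_minimal)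
  then show ?thesis using assms(2) by blast
qed

text \<open>With the jump sets of \<open>schubert_jumps\<close> the chart has at most
  \<open>r * N * N\<close> parameters, so the flags over its bad points lie in a hypersurface. Any
  other chart has fewer parameters, and its whole image lies in one. \<open>opn\<close> makes
  \<open>good\<close> open, and \<open>wit\<close> provides one good point.\<close>

lemma chart_generic:
  fixes good :: "(nat \<Rightarrow> cvec) \<Rightarrow> (nat \<Rightarrow> nat \<Rightarrow> cvec) \<Rightarrow> bool"
  assumes sN: "s \<le> N" and len: "length lams = r"
    and box: "\<And>k. k < r \<Longrightarrow> in_box s (N - s) (lams ! k)"
    and size: "s * (N - s) \<le> sum_list (map sum_list lams)"
    and J: "\<And>k. k < r \<Longrightarrow> J k \<subseteq> {..<N}" "\<And>k. k < r \<Longrightarrow> card (J k) = s"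
    and cnt: "\<And>k i. k < r \<Longrightarrow> i \<in> {1..s} \<Longrightarrow> i \<le> card {l \<in> J k. l < N - s + i - part (lams ! k) i}"
    and opn: "\<And>(A :: param set) B M z0. (\<And>t i. t < s \<Longrightarrow> (\<lambda>z. B z t i) \<in> polys A) \<Longrightarrow>
       (\<And>k l i. k < r \<Longrightarrow> l < N \<Longrightarrow> (\<lambda>z. M z k l i) \<in> polys A) \<Longrightarrow> good (B z0) (M z0) \<Longrightarrow>
       \<exists>g\<in>polys A. g z0 \<noteq> 0 \<and> (\<forall>z. g z \<noteq> 0 \<longrightarrow> good (B z) (M z))"
    and cong: "\<And>B M M'. (\<And>k l. k < r \<Longrightarrow> l < N \<Longrightarrow> M k l = M' k l) \<Longrightarrow> good B M \<Longrightarrow> good B M'"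
    and wit: "\<exists>M. (\<forall>k l i. i \<ge> N \<longrightarrow> M k l i = 0) \<and>
       (\<forall>k<r. \<forall>l\<in>schubert_jumps N s (lams ! k). M k l = (\<lambda>i. 0)) \<and> good (\<lambda>t. unit (\<pi> t)) M"
  shows "generic (\<lambda>x. \<forall>z. (\<forall>k<r. \<forall>l<N. col N x k l = chart_col \<pi> N s J z k l) \<longrightarrow>
    good (chart_basis \<pi> N s z) (chart_col \<pi> N s J z))"
proof -
  let ?A = "chart_vars N s r J" and ?M = "chart_col \<pi> N s J" and ?B = "chart_basis \<pi> N s"
  define Y where "Y = {..<r * N * N}"
  \<comment> \<open>\<open>y\<close> is decoded into flag, column and entry as in
    \<open>col\<close>.\<close>
  define P where "P z y = ?M z (y div N div N) (y div N mod N) (y mod N)" for z and y :: nat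
  define inv where "inv k = (\<Sum>l\<in>J k. card ({..<l} - J k))" for k
  have dec: "y div N div N < r \<and> y div N mod N < N \<and> y mod N < N" if "y \<in> Y" for y
  proof -
    have "y < r * N * N" using that by (simp add: Y_def)
    moreover from this have "N > 0" by (cases N) auto
    ultimately show ?thesis by (simp add: less_mult_imp_div_less)
  qed
  have agree: "x y = P z y" if "y \<in> Y" "\<forall>k<r. \<forall>l<N. col N x k l = ?M z k l" for x z y
  proof -
    have "P z y = col N x (y div N div N) (y div N mod N) (y mod N)"
      using that dec[OF that(1)] by (simp add: P_def)
    also have "\<dots> = x y" using dec[OF that(1)] by (simp add: col_def)
    finally show ?thesis by simp
  qed
  have polyP: "(\<lambda>z. P z y) \<in> polys ?A" if "y \<in> Y" for y
    unfolding P_def using dec[OF that] by (intro chart_col_polys) auto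
  have finA: "finite ?A" by (rule finite_chart_vars[OF J(1)])
  have cardY: "card Y = r * N * N" and finY: "finite Y" by (simp_all add: Y_def)
  have sumlam: "(\<Sum>i\<in>{1..s}. part (lams ! k) i) = sum_list (lams ! k)" if "k < r" for k
    using box[OF that] by (intro sum_part) (simp add: in_box_def)
  have N2: "N * (N - s) + s * s + s * (N - s) = N * N"
  proof -
    obtain d where "N = s + d" using sN le_Suc_ex by blast
    then show ?thesis by (simp add: algebra_simps)
  qed
  have inv_le: "inv k + sum_list (lams ! k) \<le> s * (N - s)" if "k < r" for k
    using count_nonjumps(1)[OF J(1)[OF that] J(2)[OF that] part_le[OF box[OF that]] cnt[OF that]]
    unfolding inv_def sumlam[OF that] by simp
  have inv_eq: "J k = schubert_jumps N s (lams ! k)" if "k < r" "inv k + sum_list (lams ! k) = s * (N - s)" for k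
    using count_nonjumps(2)[OF J(1)[OF that(1)] J(2)[OF that(1)] part_le[OF box[OF that(1)]] cnt[OF that(1)]]
      that(2) unfolding inv_def sumlam[OF that(1)] schubert_jumps_def by simp
  have sizes: "sum_list (map sum_list lams) = (\<Sum>k<r. sum_list (lams ! k))"
    using len by (simp add: sum_list_sum_nth lessThan_atLeast0)
  have cA: "card ?A \<le> s * (N - s) + (\<Sum>k<r. N * (N - s) + s * s + inv k)"
    unfolding inv_def using J sN by (intro card_chart_vars) auto
  have total: "(\<Sum>k<r. N * (N - s) + s * s + inv k) + (\<Sum>k<r. sum_list (lams ! k)) =
      (\<Sum>k<r. N * (N - s) + s * s + (inv k + sum_list (lams ! k)))"
    unfolding sum.distrib[symmetric] by (simp add: add_ac)
  have full: "(\<Sum>k<r. N * (N - s) + s * s + s * (N - s)) = r * N * N"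
    by (simp add: N2)
  have fin: "generic (\<lambda>x. \<forall>z. (\<forall>k<r. \<forall>l<N. col N x k l = ?M z k l) \<longrightarrow> good (?B z) (?M z))"
    if f: "f \<in> polys Y" "f x0 \<noteq> 0" and good: "\<And>z. f (P z) \<noteq> 0 \<Longrightarrow> good (?B z) (?M z)" for f x0
  proof -
    have "good (?B z) (?M z)" if "f x \<noteq> 0" "\<forall>k<r. \<forall>l<N. col N x k l = ?M z k l" for x z
    proof -
      have "f x = f (P z)" by (rule polys_cong[OF f(1)]) (use agree that in blast)
      then show ?thesis using good that by simp
    qed
    then show ?thesis
      unfolding generic_def cpoly_eq_polys using polys_UNIV[OF f(1)] f(2) by blast
  qed
  show ?thesis
  proof (cases "\<forall>k<r. J k = schubert_jumps N s (lams ! k)")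
    case True
    obtain M where M: "\<And>k l i. i \<ge> N \<Longrightarrow> M k l i = 0"
      "\<And>k l. k < r \<Longrightarrow> l \<in> schubert_jumps N s (lams ! k) \<Longrightarrow> M k l = (\<lambda>i. 0)"
      "good (\<lambda>t. unit (\<pi> t)) M"
      using wit by blast
    \<comment> \<open>Only the entries of free columns are nonzero: the subspace becomes a
      coordinate subspace and every jump column is 0, matching \<open>wit\<close>. The columns need
      not be independent here.\<close>
    define z0 :: "param \<Rightarrow> complex" where
      "z0 = (\<lambda>(g, k, l, i). if g = 1 then M k l i else 0)"
    have B0: "?B z0 = (\<lambda>t. unit (\<pi> t))"
      by (auto simp: chart_basis_def graph_basis_def z0_def fun_eq_iff)
    have M0: "M k l = ?M z0 k l" if "k < r" "l < N" for k l
    proof (cases "l \<in> J k")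
      case l: True
      then have "M k l = (\<lambda>i. 0)" using M(2) that True by simp
      then show ?thesis using l by (auto simp: chart_col_def z0_def)
    next
      case False
      then show ?thesis using M(1) by (auto simp: chart_col_def z0_def fun_eq_iff)
    qed
    have "good (?B z0) (?M z0)"
      unfolding B0 by (rule cong[OF M0 M(3)])
    then obtain g where g: "g \<in> polys ?A" "g z0 \<noteq> 0" "\<And>z. g z \<noteq> 0 \<Longrightarrow> good (?B z) (?M z)"
      using opn[of ?B ?A ?M z0] chart_basis_polys chart_col_polys by blast
    have "card ?A + (\<Sum>k<r. sum_list (lams ! k)) \<le> s * (N - s) + r * N * N"
    proof -
      have "(\<Sum>k<r. N * (N - s) + s * s + (inv k + sum_list (lams ! k))) \<le>
        (\<Sum>k<r. N * (N - s) + s * s + s * (N - s))"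
        by (intro sum_mono add_mono inv_le) auto
      then show ?thesis using cA total full by linarith
    qed
    then have "card ?A \<le> card Y" using size sizes cardY by linarith
    then obtain f x0 where "f \<in> polys Y" "f x0 \<noteq> 0" "\<And>z. f (P z) \<noteq> 0 \<Longrightarrow> g z \<noteq> 0"
      using image_of_zero_set_in_hypersurface[where P = P, OF finA finY _ polyP g(1,2)] by blast
    then show ?thesis using fin g(3) by blast
  next
    case False
    \<comment> \<open>An extra variable on which \<open>P\<close> does not depend. Taken as
      \<open>g\<close>, it can be set to 0 over any point of the image, so \<open>f\<close> vanishes
      on the whole image.\<close>
    let ?d = "(4, 0, 0, 0) :: param"
    have d: "?d \<notin> ?A" by (auto simp: chart_vars_def)
    have "card ?A + (\<Sum>k<r. sum_list (lams ! k)) < s * (N - s) + r * N * N"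
    proof -
      obtain k where k: "k < r" "J k \<noteq> schubert_jumps N s (lams ! k)" using False by blast
      then have "inv k + sum_list (lams ! k) < s * (N - s)"
        using inv_le[OF k(1)] inv_eq[OF k(1)] by linarith
      then have "(\<Sum>k<r. N * (N - s) + s * s + (inv k + sum_list (lams ! k))) <
        (\<Sum>k<r. N * (N - s) + s * s + s * (N - s))"
        using k(1) inv_le by (intro sum_strict_mono_ex1) auto
      then show ?thesis using cA total full by linarith
    qed
    then have "card (insert ?d ?A) \<le> card Y" using size sizes cardY finA d by simp
    moreover have "(\<lambda>z. z ?d) \<in> polys (insert ?d ?A)" by (rule polys.var) simp
    moreover have "(\<lambda>z. P z y) \<in> polys (insert ?d ?A)" if "y \<in> Y" for y
      using polys_mono[OF polyP[OF that]] by blast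
    ultimately obtain f x0 where f: "f \<in> polys Y" "f x0 \<noteq> 0" "\<And>z. f (P z) \<noteq> 0 \<Longrightarrow> z ?d \<noteq> 0"
      using image_of_zero_set_in_hypersurface[of "insert ?d ?A" Y P "\<lambda>z. z ?d" "\<lambda>_. 1"] finA finY
      by fastforce
    have "f (P z) = 0" for z
    proof -
      let ?z = "z(?d := 0)"
      have "f (P ?z) = 0" using f(3)[of ?z] by auto
      moreover have "f (P ?z) = f (P z)"
      proof (rule polys_cong[OF f(1)])
        fix y assume "y \<in> Y"
        then show "P ?z y = P z y"
          by (intro polys_cong[OF polyP]) (use d in auto)
      qed
      ultimately show ?thesis by simp
    qed
    then show ?thesis using fin[OF f(1,2)] by blast
  qed
qed

definition chart_codes :: "nat \<Rightarrow> nat \<Rightarrow> nat list list \<Rightarrow> ((nat \<Rightarrow> nat) \<times> (nat \<Rightarrow> nat set)) set" where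
  "chart_codes N s lams = {(\<pi>, J). \<pi> \<in> {..<N} \<rightarrow>\<^sub>E {..<N} \<and> bij_betw \<pi> {..<N} {..<N} \<and>
    J \<in> {..<length lams} \<rightarrow>\<^sub>E Pow {..<N} \<and> (\<forall>k<length lams. card (J k) = s \<and>
      (\<forall>i\<in>{1..s}. i \<le> card {l \<in> J k. l < N - s + i - part (lams ! k) i}))}"

lemma finite_chart_codes: "finite (chart_codes N s lams)"
  by (rule finite_subset[of _ "({..<N} \<rightarrow>\<^sub>E {..<N}) \<times> ({..<length lams} \<rightarrow>\<^sub>E Pow {..<N})"])
    (auto simp: chart_codes_def finite_PiE)

text \<open>The jumps along \<open>H\<close> give \<open>J\<close>, and by
  \<open>dim_flag_jumps\<close> the Schubert conditions turn into the counting conditions of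
  \<open>chart_codes\<close>. The coefficients of the jump columns come from
  \<open>flag_decomposition\<close>.\<close>

lemma chart_cover:
  assumes sN: "s \<le> N" and len: "length lams = r"
    and ind: "\<And>k. k < r \<Longrightarrow> lin_indep {..<N} (col N x k)"
    and H: "H \<in> sol {0} (ambient N) s lams (flags_of {0} (ambient N) unit x)"
  shows "\<exists>\<pi> J z. (\<pi>, J) \<in> chart_codes N s lams \<and>
    (\<forall>k<r. \<forall>l<N. col N x k l = chart_col \<pi> N s J z k l) \<and>
    cv.span (chart_basis \<pi> N s z ` {..<s}) = H"
proof -
  have Hs: "cv.subspace H" "H \<subseteq> ambient N" "cv.dim H = s"
    using H by (auto simp: sol_def grass_def dim_zero)
  have Hk: "i \<le> cv.dim (H \<inter> cv.span (col N x k ` {..<N - s + i - part (lams ! k) i}))"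
    if "k < r" "i \<in> {1..s}" for k i
    using H that len by (auto simp: sol_def schubert_def qdim_ambient dim_zero flags_of_std)
  obtain \<pi> X where pi: "bij_betw \<pi> {..<N} {..<N}" "\<pi> \<in> {..<N} \<rightarrow>\<^sub>E {..<N}"
    and X: "cv.span (graph_basis \<pi> N s X ` {..<s}) = H"
    using subspace_is_graph[OF Hs] by blast
  define J where "J = restrict (\<lambda>k. flag_jumps N H (col N x k)) {..<r}"
  have Jk: "J k = flag_jumps N H (col N x k)" if "k < r" for k using that by (simp add: J_def)
  have JN: "J k \<subseteq> {..<N}" if "k < r" for k using Jk[OF that] by (auto simp: flag_jumps_def)
  have dimJ: "cv.dim (H \<inter> cv.span (col N x k ` {..<m})) = card {l \<in> J k. l < m}" if "k < r" "m \<le> N" for k m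
    using dim_flag_jumps[OF ind[OF that(1)] col_in_ambient Hs(1,2) that(2)] by (simp add: Jk[OF that(1)])
  have cardJ: "card (J k) = s" if k: "k < r" for k
  proof -
    have "cv.span (col N x k ` {..<N}) = ambient N"
      using dim_flag[OF ind[OF k], of N]
      by (intro subspace_eqI[of _ _ N] span_cols_ambient cv.subspace_span subspace_ambient)
        (auto simp: dim_ambient)
    then have "H \<inter> cv.span (col N x k ` {..<N}) = H" using Hs(2) by blast
    moreover have "{l \<in> J k. l < N} = J k" using JN[OF k] by auto
    ultimately show ?thesis using dimJ[OF k, of N] Hs(3) by simp
  qed
  define Q where "Q k l \<tau> \<sigma> \<longleftrightarrow> (\<forall>i. col N x k l i = (\<Sum>t<s. \<tau> t * graph_basis \<pi> N s X t i) +
      (\<Sum>l'\<in>{..<l} - J k. \<sigma> l' * col N x k l' i))" for k l \<tau> \<sigma>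
  have "\<exists>\<tau> \<sigma>. Q k l \<tau> \<sigma>" if k: "k < r" and l: "l \<in> J k" for k l
  proof -
    have lN: "l < N" using JN[OF k] l by auto
    have "{..<Suc l} - J k = {..<l} - J k" using l by (auto simp: less_Suc_eq)
    then have "cv.span (col N x k ` {..<Suc l}) \<subseteq> csum H (cv.span (col N x k ` ({..<l} - J k)))"
      using flag_decomposition[OF ind[OF k] col_in_ambient Hs(1,2), of "Suc l"] lN
      by (simp add: Jk[OF k])
    then have "col N x k l \<in> csum H (cv.span (col N x k ` ({..<l} - J k)))"
      by (auto intro: cv.span_base)
    then obtain a b where ab: "col N x k l = a + b" "a \<in> H" "b \<in> cv.span (col N x k ` ({..<l} - J k))"
      using Hs(1) by (auto simp: csum_def cv.span_Un cv.span_span cv.span_eq_iff[THEN iffD2])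
    obtain \<tau> where \<tau>: "a = (\<Sum>t<s. cscale (\<tau> t) (graph_basis \<pi> N s X t))"
      using span_image_coeffs[of "{..<s}" a] ab(2) X by blast
    obtain \<sigma> where \<sigma>: "b = (\<Sum>l'\<in>{..<l} - J k. cscale (\<sigma> l') (col N x k l'))"
      using span_image_coeffs[of "{..<l} - J k" b] ab(3) by blast
    have "col N x k l i = (\<Sum>t<s. \<tau> t * graph_basis \<pi> N s X t i) +
      (\<Sum>l'\<in>{..<l} - J k. \<sigma> l' * col N x k l' i)" for i
      unfolding ab(1) plus_fun_apply \<tau> \<sigma> sum_cscale_apply ..
    then show ?thesis unfolding Q_def by blast
  qed
  then obtain \<tau> \<sigma> where "\<And>k l. k < r \<Longrightarrow> l \<in> J k \<Longrightarrow> Q k l (\<tau> k l) (\<sigma> k l)"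
    by metis
  then have ts: "\<And>k l i. k < r \<Longrightarrow> l \<in> J k \<Longrightarrow>
      col N x k l i = (\<Sum>t<s. \<tau> k l t * graph_basis \<pi> N s X t i) +
      (\<Sum>l'\<in>{..<l} - J k. \<sigma> k l l' * col N x k l' i)"
    unfolding Q_def by blast
  define z :: "param \<Rightarrow> complex" where "z = (\<lambda>(g, k, l, i). if g = 0 then X l i
    else if g = 1 then col N x k l i else if g = 2 then \<tau> k l i else \<sigma> k l i)"
  have Bz: "chart_basis \<pi> N s z = graph_basis \<pi> N s X"
    by (simp add: chart_basis_def z_def)
  have c0: "(if i < N then z (1, k, l, i) else 0) = col N x k l i" for k l i
    by (simp add: z_def col_def)
  have colz: "col N x k l = chart_col \<pi> N s J z k l" if "k < r" "l < N" for k l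
    unfolding chart_col_def Bz c0 using ts[OF that(1), of l] by (auto simp: fun_eq_iff z_def)
  have cnt: "i \<le> card {l \<in> J k. l < N - s + i - part (lams ! k) i}" if "k < r" "i \<in> {1..s}" for k i
    using Hk[OF that] dimJ[OF that(1), of "N - s + i - part (lams ! k) i"] that(2) sN by auto
  have "J \<in> {..<r} \<rightarrow>\<^sub>E Pow {..<N}" using JN by (auto simp: J_def)
  then have "(\<pi>, J) \<in> chart_codes N s lams"
    unfolding chart_codes_def using pi cardJ cnt len by blast
  then show ?thesis using colz Bz X by (intro exI[of _ \<pi>] exI[of _ J] exI[of _ z]) simp
qed

abbreviation indep_flags :: "nat \<Rightarrow> nat \<Rightarrow> (nat \<Rightarrow> complex) \<Rightarrow> bool" where
  "indep_flags N r x \<equiv> \<forall>k<r. lin_indep {..<N} (col N x k)"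

text \<open>Finitely many charts cover all solutions, so their generic conditions can be
  intersected. The basis \<open>B\<close> is the one belonging to a chart that covers
  \<open>H\<close>.\<close>

lemma generic_solutions:
  fixes good :: "(nat \<Rightarrow> cvec) \<Rightarrow> (nat \<Rightarrow> nat \<Rightarrow> cvec) \<Rightarrow> bool"
  assumes sN: "s \<le> N" and len: "length lams = r"
    and box: "\<And>k. k < r \<Longrightarrow> in_box s (N - s) (lams ! k)"
    and size: "s * (N - s) \<le> sum_list (map sum_list lams)"
    and opn: "\<And>(A :: param set) B M z0. (\<And>t i. t < s \<Longrightarrow> (\<lambda>z. B z t i) \<in> polys A) \<Longrightarrow>
       (\<And>k l i. k < r \<Longrightarrow> l < N \<Longrightarrow> (\<lambda>z. M z k l i) \<in> polys A) \<Longrightarrow> good (B z0) (M z0) \<Longrightarrow>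
       \<exists>g\<in>polys A. g z0 \<noteq> 0 \<and> (\<forall>z. g z \<noteq> 0 \<longrightarrow> good (B z) (M z))"
    and cong: "\<And>B M M'. (\<And>k l. k < r \<Longrightarrow> l < N \<Longrightarrow> M k l = M' k l) \<Longrightarrow> good B M \<Longrightarrow> good B M'"
    and wit: "\<And>\<pi>. bij_betw \<pi> {..<N} {..<N} \<Longrightarrow> \<exists>M. (\<forall>k l i. i \<ge> N \<longrightarrow> M k l i = 0) \<and>
       (\<forall>k<r. \<forall>l\<in>schubert_jumps N s (lams ! k). M k l = (\<lambda>i. 0)) \<and> good (\<lambda>t. unit (\<pi> t)) M"
  shows "generic (\<lambda>x. indep_flags N r x \<longrightarrow>
    (\<forall>H\<in>sol {0} (ambient N) s lams (flags_of {0} (ambient N) unit x).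
       \<exists>B. cv.span (B ` {..<s}) = H \<and> good B (col N x)))"
proof -
  let ?C = "chart_codes N s lams"
  have "generic (\<lambda>x. \<forall>z. (\<forall>k<r. \<forall>l<N. col N x k l = chart_col (fst c) N s (snd c) z k l) \<longrightarrow>
    good (chart_basis (fst c) N s z) (chart_col (fst c) N s (snd c) z))" if "c \<in> ?C" for c
  proof -
    obtain \<pi> J where c: "c = (\<pi>, J)" by (cases c)
    show ?thesis
      using that unfolding c fst_conv snd_conv
      by (intro chart_generic[where good = good, OF sN len box size _ _ _ opn cong wit])
        (auto simp: chart_codes_def len PiE_def Pi_def)
  qed
  from generic_ball[OF finite_chart_codes this]
  have "generic (\<lambda>x. \<forall>c\<in>?C. \<forall>z. (\<forall>k<r. \<forall>l<N. col N x k l = chart_col (fst c) N s (snd c) z k l) \<longrightarrow>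
    good (chart_basis (fst c) N s z) (chart_col (fst c) N s (snd c) z))" .
  then show ?thesis
  proof (rule generic_mono, intro impI ballI)
    fix x H
    assume x: "\<forall>c\<in>?C. \<forall>z. (\<forall>k<r. \<forall>l<N. col N x k l = chart_col (fst c) N s (snd c) z k l) \<longrightarrow>
        good (chart_basis (fst c) N s z) (chart_col (fst c) N s (snd c) z)"
      and ind: "indep_flags N r x"
      and H: "H \<in> sol {0} (ambient N) s lams (flags_of {0} (ambient N) unit x)"
    obtain \<pi> J z where c: "(\<pi>, J) \<in> ?C"
      and z: "\<forall>k<r. \<forall>l<N. col N x k l = chart_col \<pi> N s J z k l"
      and B: "cv.span (chart_basis \<pi> N s z ` {..<s}) = H"
      using chart_cover[OF sN len ind[rule_format] H] by blast
    have "good (chart_basis \<pi> N s z) (chart_col \<pi> N s J z)"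
      using x[rule_format, OF c] z by auto
    then have "good (chart_basis \<pi> N s z) (col N x)"
      by (rule cong[rotated]) (use z in auto)
    then show "\<exists>B. cv.span (B ` {..<s}) = H \<and> good B (col N x)" using B by blast
  qed
qed

section \<open>Transversality of general flags along all solutions\<close>

text \<open>The vectors of this family live in the direct sum over \<open>j \<in> Js\<close> of copies of the ambient space;
  its independence says that the span of the columns in \<open>S\<close> meets the intersection over \<open>j\<close> of the sums of the
  subspace and the columns in \<open>L j\<close> only in \<open>0\<close>, and that all these sums are direct.\<close>

fun diagonal_family :: "nat set \<Rightarrow> (nat \<Rightarrow> cvec) \<Rightarrow> (nat \<Rightarrow> nat \<Rightarrow> cvec) \<Rightarrow>
    (nat \<times> nat) + (nat \<times> (nat + nat \<times> nat)) \<Rightarrow> nat \<times> nat \<Rightarrow> complex" where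
  "diagonal_family Js B M (Inl (k, l)) = (\<lambda>(j, i). if j \<in> Js then M k l i else 0)"
| "diagonal_family Js B M (Inr (j', Inl t)) = (\<lambda>(j, i). if j = j' then B t i else 0)"
| "diagonal_family Js B M (Inr (j', Inr (k, l))) = (\<lambda>(j, i). if j = j' then M k l i else 0)"

lemma lin_indep_cong: "(\<And>l. l \<in> I \<Longrightarrow> v l = w l) \<Longrightarrow> lin_indep I v \<longleftrightarrow> lin_indep I w"
  unfolding lin_indep_def by (auto cong: sum.cong)

lemma diagonal_family_sum:
  assumes "finite Js" "finite S" "\<And>j. j \<in> Js \<Longrightarrow> finite (L j)" "j \<in> Js"
  shows "(\<Sum>\<iota>\<in>S <+> (SIGMA j:Js. {..<s} <+> L j). c \<iota> * diagonal_family Js B M \<iota> (j, i)) =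
    (\<Sum>e\<in>S. c (Inl e) * M (fst e) (snd e) i) + (\<Sum>t<s. c (Inr (j, Inl t)) * B t i) +
    (\<Sum>e\<in>L j. c (Inr (j, Inr e)) * M (fst e) (snd e) i)"
proof -
  have fin: "finite (SIGMA j:Js. {..<s} <+> L j)" using assms by auto
  have inl: "diagonal_family Js B M (Inl e) (j, i) = M (fst e) (snd e) i" for e
    using assms(4) by (cases e) auto
  have inr: "diagonal_family Js B M (Inr (j', \<iota>)) (j, i) =
      (if j' = j then (case \<iota> of Inl t \<Rightarrow> B t i | Inr e \<Rightarrow> M (fst e) (snd e) i) else 0)" for j' \<iota>
    by (cases \<iota>) (auto simp: split_paired_all)
  have "(\<Sum>\<iota>\<in>(SIGMA j:Js. {..<s} <+> L j). c (Inr \<iota>) * diagonal_family Js B M (Inr \<iota>) (j, i)) =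
      (\<Sum>j'\<in>Js. \<Sum>\<iota>\<in>{..<s} <+> L j'. c (Inr (j', \<iota>)) * diagonal_family Js B M (Inr (j', \<iota>)) (j, i))"
    using assms by (subst sum.Sigma) (auto intro!: sum.cong)
  also have "\<dots> = (\<Sum>j'\<in>Js. if j' = j then
      (\<Sum>\<iota>\<in>{..<s} <+> L j. c (Inr (j, \<iota>)) * (case \<iota> of Inl t \<Rightarrow> B t i | Inr e \<Rightarrow> M (fst e) (snd e) i)) else 0)"
    by (rule sum.cong) (auto simp: inr)
  also have "\<dots> = (\<Sum>\<iota>\<in>{..<s} <+> L j. c (Inr (j, \<iota>)) * (case \<iota> of Inl t \<Rightarrow> B t i | Inr e \<Rightarrow> M (fst e) (snd e) i))"
    using assms by (simp add: sum.delta)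
  also have "\<dots> = (\<Sum>t<s. c (Inr (j, Inl t)) * B t i) + (\<Sum>e\<in>L j. c (Inr (j, Inr e)) * M (fst e) (snd e) i)"
    using assms by (subst sum.Plus) auto
  finally show ?thesis
    using assms fin by (subst sum.Plus) (auto simp: inl add.assoc)
qed

lemma diagonal_family_outside:
  assumes "\<iota> \<in> S <+> (SIGMA j:Js. {..<s} <+> L j)" "j \<notin> Js"
  shows "diagonal_family Js B M \<iota> (j, i) = 0"
  using assms by auto

lemma lin_indep_diagonal_familyI:
  assumes "finite Js" "finite S" "\<And>j. j \<in> Js \<Longrightarrow> finite (L j)"
    and "\<And>c \<iota>. (\<And>j i. j \<in> Js \<Longrightarrow> (\<Sum>e\<in>S. c (Inl e) * M (fst e) (snd e) i) +
      (\<Sum>t<s. c (Inr (j, Inl t)) * B t i) + (\<Sum>e\<in>L j. c (Inr (j, Inr e)) * M (fst e) (snd e) i) = 0) \<Longrightarrow>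
      \<iota> \<in> S <+> (SIGMA j:Js. {..<s} <+> L j) \<Longrightarrow> c \<iota> = 0"
  shows "lin_indep (S <+> (SIGMA j:Js. {..<s} <+> L j)) (diagonal_family Js B M)"
proof (rule lin_indepI, rule assms(4))
  fix c \<iota> j i
  assume c: "\<And>p. (\<Sum>\<iota>\<in>S <+> (SIGMA j:Js. {..<s} <+> L j). c \<iota> * diagonal_family Js B M \<iota> p) = 0" and j: "j \<in> Js"
  show "(\<Sum>e\<in>S. c (Inl e) * M (fst e) (snd e) i) + (\<Sum>t<s. c (Inr (j, Inl t)) * B t i) +
    (\<Sum>e\<in>L j. c (Inr (j, Inr e)) * M (fst e) (snd e) i) = 0"
    using c[of "(j, i)"] by (subst (asm) diagonal_family_sum[OF assms(1-3) j])
qed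

lemma lin_indep_diagonal_familyD:
  assumes "finite Js" "finite S" "\<And>j. j \<in> Js \<Longrightarrow> finite (L j)"
    and ind: "lin_indep (S <+> (SIGMA j:Js. {..<s} <+> L j)) (diagonal_family Js B M)"
    and c: "\<And>j i. j \<in> Js \<Longrightarrow> (\<Sum>e\<in>S. c (Inl e) * M (fst e) (snd e) i) +
      (\<Sum>t<s. c (Inr (j, Inl t)) * B t i) + (\<Sum>e\<in>L j. c (Inr (j, Inr e)) * M (fst e) (snd e) i) = 0"
    and \<iota>: "\<iota> \<in> S <+> (SIGMA j:Js. {..<s} <+> L j)"
  shows "c \<iota> = 0"
proof (rule lin_indepD[OF ind _ \<iota>])
  fix p :: "nat \<times> nat"
  obtain j i where p: "p = (j, i)" by (cases p)
  show "(\<Sum>\<iota>\<in>S <+> (SIGMA j:Js. {..<s} <+> L j). c \<iota> * diagonal_family Js B M \<iota> p) = 0"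
  proof (cases "j \<in> Js")
    case True
    show ?thesis unfolding p by (subst diagonal_family_sum[OF assms(1-3) True]) (simp_all add: c[OF True])
  next
    case False
    show ?thesis
      unfolding p using diagonal_family_outside[OF _ False, of _ S s L B M i] by (intro sum.neutral) simp
  qed
qed

abbreviation pcol :: "nat \<Rightarrow> (nat \<Rightarrow> complex) \<Rightarrow> nat \<times> nat \<Rightarrow> cvec" where
  "pcol N x e \<equiv> col N x (fst e) (snd e)"

text \<open>Relations between vectors become relations of the diagonal family: a common vector of
  all the sums gives a relation in every component with the same coefficients on \<open>S\<close>,
  and a relation within one sum is extended by 0 to the other components.\<close>

lemma diagonal_family_transversal:
  assumes fin: "finite Js" "finite S" "\<And>j. j \<in> Js \<Longrightarrow> finite (L j)"
    and ind: "lin_indep (S <+> (SIGMA j:Js. {..<s} <+> L j)) (diagonal_family Js B (col N x))"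
    and H: "cv.span (B ` {..<s}) = H" and SJ: "Js = {} \<Longrightarrow> S = {}"
  shows "j \<in> Js \<Longrightarrow> cv.dim (csum H (cv.span (pcol N x ` L j))) = s + card (L j)"
    and "cv.dim (cv.span (pcol N x ` S)) = card S"
    and "cv.span (pcol N x ` S) \<inter> (\<Inter>j\<in>Js. csum H (cv.span (pcol N x ` L j))) \<subseteq> {0}"
proof -
  note D = lin_indep_diagonal_familyD[OF fin ind]
  {
    assume j: "j \<in> Js"
    let ?v = "case_sum B (pcol N x)"
    have "lin_indep ({..<s} <+> L j) ?v"
    proof (rule lin_indepI)
      fix c \<iota> assume c: "\<And>i. (\<Sum>\<iota>\<in>{..<s} <+> L j. c \<iota> * ?v \<iota> i) = 0" and \<iota>: "\<iota> \<in> {..<s} <+> L j"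
      define c' where "c' \<kappa> = (case \<kappa> of Inl e \<Rightarrow> 0 | Inr p \<Rightarrow> if fst p = j then c (snd p) else 0)"
        for \<kappa> :: "nat \<times> nat + nat \<times> (nat + nat \<times> nat)"
      have "c' (Inr (j, \<iota>)) = 0"
      proof (rule D)
        show "Inr (j, \<iota>) \<in> S <+> (SIGMA j:Js. {..<s} <+> L j)" using j \<iota> by auto
        fix j' i assume "j' \<in> Js"
        have "(\<Sum>t<s. c (Inl t) * B t i) + (\<Sum>e\<in>L j. c (Inr e) * pcol N x e i) = 0"
          using c[of i] fin(3)[OF j] by (subst (asm) sum.Plus) auto
        then show "(\<Sum>e\<in>S. c' (Inl e) * pcol N x e i) + (\<Sum>t<s. c' (Inr (j', Inl t)) * B t i) +
          (\<Sum>e\<in>L j'. c' (Inr (j', Inr e)) * pcol N x e i) = 0"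
          by (cases "j' = j") (simp_all add: c'_def)
      qed
      then show "c \<iota> = 0" by (simp add: c'_def)
    qed
    from lin_indep_dim[OF _ this] have "cv.dim (cv.span (?v ` ({..<s} <+> L j))) = s + card (L j)"
      using fin(3)[OF j] by (simp add: card_Plus)
    moreover have "?v ` ({..<s} <+> L j) = B ` {..<s} \<union> pcol N x ` L j"
      by (force simp: image_iff Plus_def)
    moreover have "cv.span (B ` {..<s} \<union> pcol N x ` L j) = csum H (cv.span (pcol N x ` L j))"
      unfolding H[symmetric] csum_def cv.span_Un cv.span_span ..
    ultimately show "cv.dim (csum H (cv.span (pcol N x ` L j))) = s + card (L j)" by simp
  }
  show "cv.dim (cv.span (pcol N x ` S)) = card S"
  proof (rule lin_indep_dim[OF fin(2)], rule lin_indepI)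
    fix c e assume c: "\<And>i. (\<Sum>e\<in>S. c e * pcol N x e i) = 0" and e: "e \<in> S"
    define c' :: "nat \<times> nat + nat \<times> (nat + nat \<times> nat) \<Rightarrow> complex" where "c' = case_sum c (\<lambda>_. 0)"
    have "c' (Inl e) = 0"
      by (rule D) (use c e in \<open>auto simp: c'_def\<close>)
    then show "c e = 0" by (simp add: c'_def)
  qed
  show "cv.span (pcol N x ` S) \<inter> (\<Inter>j\<in>Js. csum H (cv.span (pcol N x ` L j))) \<subseteq> {0}"
  proof
    fix y assume y: "y \<in> cv.span (pcol N x ` S) \<inter> (\<Inter>j\<in>Js. csum H (cv.span (pcol N x ` L j)))"
    then obtain \<sigma> where \<sigma>: "y = (\<Sum>e\<in>S. cscale (\<sigma> e) (pcol N x e))"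
      using span_image_coeffs[OF fin(2), of y] by blast
    define Q where "Q j \<tau> \<omega> \<longleftrightarrow> (\<forall>i. y i = (\<Sum>t<s. \<tau> t * B t i) + (\<Sum>e\<in>L j. \<omega> e * pcol N x e i))" for j \<tau> \<omega>
    have "\<exists>\<tau> \<omega>. Q j \<tau> \<omega>" if j: "j \<in> Js" for j
    proof -
      have "y \<in> csum H (cv.span (pcol N x ` L j))" using y j by blast
      then obtain a b where ab: "y = a + b" "a \<in> cv.span (B ` {..<s})" "b \<in> cv.span (pcol N x ` L j)"
        unfolding H[symmetric] csum_def cv.span_Un cv.span_span by blast
      obtain \<tau> where \<tau>: "a = (\<Sum>t<s. cscale (\<tau> t) (B t))"
        using span_image_coeffs[of "{..<s}" a B] ab(2) by blast
      obtain \<omega> where \<omega>: "b = (\<Sum>e\<in>L j. cscale (\<omega> e) (pcol N x e))"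
        using span_image_coeffs[OF fin(3)[OF j], of b "pcol N x"] ab(3) by blast
      have "Q j \<tau> \<omega>" unfolding Q_def ab(1) \<tau> \<omega> plus_fun_apply sum_cscale_apply by blast
      then show ?thesis by blast
    qed
    then obtain \<tau> \<omega> where Q: "\<And>j. j \<in> Js \<Longrightarrow> Q j (\<tau> j) (\<omega> j)" by metis
    define c where "c \<kappa> = (case \<kappa> of Inl e \<Rightarrow> \<sigma> e | Inr (j, \<iota>) \<Rightarrow>
        (case \<iota> of Inl t \<Rightarrow> - \<tau> j t | Inr e \<Rightarrow> - \<omega> j e))" for \<kappa>
    have "\<sigma> e = 0" if "e \<in> S" for e
    proof -
      have "c (Inl e) = 0"
      proof (rule D)
        show "Inl e \<in> S <+> (SIGMA j:Js. {..<s} <+> L j)" using that by (rule InlI)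
        fix j i assume "j \<in> Js"
        from Q[OF this] have "y i = (\<Sum>t<s. \<tau> j t * B t i) + (\<Sum>e\<in>L j. \<omega> j e * pcol N x e i)"
          unfolding Q_def by blast
        moreover have "y i = (\<Sum>e\<in>S. \<sigma> e * pcol N x e i)" unfolding \<sigma> sum_cscale_apply ..
        ultimately show "(\<Sum>e\<in>S. c (Inl e) * pcol N x e i) + (\<Sum>t<s. c (Inr (j, Inl t)) * B t i) +
            (\<Sum>e\<in>L j. c (Inr (j, Inr e)) * pcol N x e i) = 0"
          by (simp add: c_def sum_negf)
      qed
      then show ?thesis by (simp add: c_def)
    qed
    then show "y \<in> {0}" unfolding \<sigma> by (simp add: sum.neutral)
  qed
qed

definition transversal :: "nat \<Rightarrow> (nat \<Rightarrow> complex) \<Rightarrow> cvec set \<Rightarrow> nat set \<Rightarrow> (nat \<Rightarrow> (nat \<times> nat) set) \<Rightarrow>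
    (nat \<times> nat) set \<Rightarrow> bool" where
  "transversal N x H Js L S \<longleftrightarrow>
    (\<forall>j\<in>Js. cv.dim (csum H (cv.span (pcol N x ` L j))) = cv.dim H + card (L j)) \<and>
    cv.dim (cv.span (pcol N x ` S)) = card S \<and>
    cv.span (pcol N x ` S) \<inter> (\<Inter>j\<in>Js. csum H (cv.span (pcol N x ` L j))) \<subseteq> {0}"

text \<open>\<open>\<nu>\<close> describes the test point: the subspace is spanned by the unit
  vectors at \<open>\<pi> t\<close> for \<open>t < s\<close>, and column \<open>e\<close> is the
  unit vector at \<open>\<pi> (\<nu> e)\<close>. Values from \<open>s\<close> on keep columns off
  the subspace, injectivity keeps those of one sum apart, and the last condition gives each column
  of \<open>S\<close> a component in which it is visible. Only non-jump columns can be prescribed,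
  whence \<open>nonjump\<close>.\<close>

lemma generic_transversal:
  fixes Js :: "nat set"
  assumes sN: "s \<le> N" and len: "length lams = r"
    and box: "\<And>k. k < r \<Longrightarrow> in_box s (N - s) (lams ! k)"
    and size: "s * (N - s) \<le> sum_list (map sum_list lams)"
    and fin: "finite Js" "finite S" "\<And>j. j \<in> Js \<Longrightarrow> finite (L j)"
    and nonjump: "\<And>k l. (k, l) \<in> S \<union> (\<Union>j\<in>Js. L j) \<Longrightarrow> k < r \<and> l < N \<and> l \<notin> schubert_jumps N s (lams ! k)"
    and \<nu>: "inj_on \<nu> S" "\<And>j. j \<in> Js \<Longrightarrow> inj_on \<nu> (L j)"
      "\<And>e. e \<in> S \<union> (\<Union>j\<in>Js. L j) \<Longrightarrow> s \<le> \<nu> e \<and> \<nu> e < N"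
      "\<And>e. e \<in> S \<Longrightarrow> \<exists>j\<in>Js. \<nu> e \<notin> \<nu> ` L j"
  shows "generic (\<lambda>x. indep_flags N r x \<longrightarrow>
    (\<forall>H\<in>sol {0} (ambient N) s lams (flags_of {0} (ambient N) unit x).
      transversal N x H Js L S))"
proof -
  let ?I = "S <+> (SIGMA j:Js. {..<s} <+> L j)"
  define E where "E = S \<union> (\<Union>j\<in>Js. L j)"
  have finI: "finite ?I" using fin by auto
  have "generic (\<lambda>x. indep_flags N r x \<longrightarrow>
    (\<forall>H\<in>sol {0} (ambient N) s lams (flags_of {0} (ambient N) unit x).
       \<exists>B. cv.span (B ` {..<s}) = H \<and> lin_indep ?I (diagonal_family Js B (col N x))))"
  proof (rule generic_solutions[OF sN len box size])
    fix A :: "param set" and B M z0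
    assume B: "\<And>t i. t < s \<Longrightarrow> (\<lambda>z. B z t i) \<in> polys A"
      and M: "\<And>k l i. k < r \<Longrightarrow> l < N \<Longrightarrow> (\<lambda>z. M z k l i) \<in> polys A"
      and ind: "lin_indep ?I (diagonal_family Js (B z0) (M z0))"
    have pol: "(\<lambda>z. diagonal_family Js (B z) (M z) \<iota> p) \<in> polys A" if "\<iota> \<in> ?I" for \<iota> p
    proof -
      obtain j i where p: "p = (j, i)" by (cases p)
      have *: "(\<lambda>z. M z k l i) \<in> polys A" if "(k, l) \<in> E" for k l
        using nonjump[of k l] that M by (auto simp: E_def)
      show ?thesis
        using that unfolding p
        by (auto simp: E_def intro!: polys_if B polys.const *)
    qed
    show "\<exists>g\<in>polys A. g z0 \<noteq> 0 \<and> (\<forall>z. g z \<noteq> 0 \<longrightarrow> lin_indep ?I (diagonal_family Js (B z) (M z)))"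
      by (rule lin_indep_open[where v = "\<lambda>z. diagonal_family Js (B z) (M z)", OF finI pol ind])
  next
    fix B :: "nat \<Rightarrow> cvec" and M M' :: "nat \<Rightarrow> nat \<Rightarrow> cvec"
    assume eq: "\<And>k l. k < r \<Longrightarrow> l < N \<Longrightarrow> M k l = M' k l"
      and ind: "lin_indep ?I (diagonal_family Js B M)"
    have *: "M k l = M' k l" if "(k, l) \<in> E" for k l
      using nonjump[of k l] that eq by (auto simp: E_def)
    have "diagonal_family Js B M \<iota> = diagonal_family Js B M' \<iota>" if "\<iota> \<in> ?I" for \<iota>
    proof -
      have "e \<in> E" if "e \<in> S" for e using that by (simp add: E_def)
      moreover have "e \<in> E" if "j \<in> Js" "e \<in> L j" for e j using that by (auto simp: E_def)
      ultimately show ?thesis using that * by auto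
    qed
    then show "lin_indep ?I (diagonal_family Js B M')" using ind lin_indep_cong by blast
  next
    fix \<pi> :: "nat \<Rightarrow> nat" assume \<pi>: "bij_betw \<pi> {..<N} {..<N}"
    define M where "M k l = (if (k, l) \<in> E then unit (\<pi> (\<nu> (k, l))) else (\<lambda>i. 0))" for k l
    have ME: "M (fst e) (snd e) i = unit (\<pi> (\<nu> e)) i" if "e \<in> E" for e i
      using that by (simp add: M_def)
    have pN: "\<pi> m < N" if "m < N" for m using \<pi> that by (auto simp: bij_betw_def)
    have pinj: "\<pi> m = \<pi> n \<longleftrightarrow> m = n" if "m < N" "n < N" for m n
      using \<pi> that by (auto simp: bij_betw_def inj_on_def)
    have nE: "s \<le> \<nu> e" "\<nu> e < N" if "e \<in> E" for e using \<nu>(3) that by (auto simp: E_def)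
    have SE: "S \<subseteq> E" and LE: "\<And>j. j \<in> Js \<Longrightarrow> L j \<subseteq> E" by (auto simp: E_def)
    have "lin_indep ?I (diagonal_family Js (\<lambda>t. unit (\<pi> t)) M)"
    proof (rule lin_indep_diagonal_familyI[OF fin])
      fix c \<iota>
      assume c: "\<And>j i. j \<in> Js \<Longrightarrow> (\<Sum>e\<in>S. c (Inl e) * M (fst e) (snd e) i) +
        (\<Sum>t<s. c (Inr (j, Inl t)) * unit (\<pi> t) i) + (\<Sum>e\<in>L j. c (Inr (j, Inr e)) * M (fst e) (snd e) i) = 0"
        and \<iota>: "\<iota> \<in> ?I"
      have eq: "(\<Sum>e\<in>S. if \<nu> e = m then c (Inl e) else 0) +
        (\<Sum>t<s. if t = m then c (Inr (j, Inl t)) else 0) +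
        (\<Sum>e\<in>L j. if \<nu> e = m then c (Inr (j, Inr e)) else 0) = 0" if j: "j \<in> Js" and m: "m < N" for j m
      proof -
        have "(\<Sum>e\<in>S. if \<nu> e = m then c (Inl e) else 0) = (\<Sum>e\<in>S. c (Inl e) * M (fst e) (snd e) (\<pi> m))"
          using SE by (intro sum.cong refl) (auto simp: ME unit_def pinj nE m subsetD)
        moreover have "(\<Sum>t<s. if t = m then c (Inr (j, Inl t)) else 0) =
            (\<Sum>t<s. c (Inr (j, Inl t)) * unit (\<pi> t) (\<pi> m))"
          using sN m by (intro sum.cong refl) (auto simp: unit_def pinj)
        moreover have "(\<Sum>e\<in>L j. if \<nu> e = m then c (Inr (j, Inr e)) else 0) =
            (\<Sum>e\<in>L j. c (Inr (j, Inr e)) * M (fst e) (snd e) (\<pi> m))"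
          using LE[OF j] by (intro sum.cong refl) (auto simp: ME unit_def pinj nE m subsetD)
        ultimately show ?thesis using c[OF j, of "\<pi> m"] by simp
      qed
      have cS: "c (Inl e) = 0" if e: "e \<in> S" for e
      proof -
        \<comment> \<open>In component \<open>j\<close> the coordinate
          \<open>\<pi> (\<nu> e)\<close> sees column \<open>e\<close> of \<open>S\<close> and
          nothing else.\<close>
        obtain j where j: "j \<in> Js" "\<nu> e \<notin> \<nu> ` L j" using \<nu>(4)[OF e] by blast
        have eN: "s \<le> \<nu> e" "\<nu> e < N" using nE[OF subsetD[OF SE e]] by auto
        have "(\<Sum>e'\<in>S. if \<nu> e' = \<nu> e then c (Inl e') else 0) = (\<Sum>e'\<in>S. if e' = e then c (Inl e') else 0)"
          using \<nu>(1) e by (intro sum.cong refl) (auto dest: inj_onD)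
        moreover have "(\<Sum>t<s. if t = \<nu> e then c (Inr (j, Inl t)) else 0) = 0"
          using eN by (intro sum.neutral) auto
        moreover have "(\<Sum>e'\<in>L j. if \<nu> e' = \<nu> e then c (Inr (j, Inr e')) else 0) = 0"
          using j(2) by (intro sum.neutral) (auto simp: image_iff)
        ultimately show ?thesis using eq[OF j(1) eN(2)] e fin(2) by simp
      qed
      then have S0: "(\<Sum>e\<in>S. if \<nu> e = m then c (Inl e) else 0) = 0" for m
        by (intro sum.neutral) auto
      have cB: "c (Inr (j, Inl t)) = 0" if j: "j \<in> Js" and t: "t < s" for j t
      proof -
        have "(\<Sum>e\<in>L j. if \<nu> e = t then c (Inr (j, Inr e)) else 0) = 0"
          using LE[OF j] nE t by (intro sum.neutral) fastforce
        then show ?thesis using eq[OF j, of t] t sN S0 by simp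
      qed
      have cL: "c (Inr (j, Inr e)) = 0" if j: "j \<in> Js" and e: "e \<in> L j" for j e
      proof -
        have eN: "s \<le> \<nu> e" "\<nu> e < N" using nE[OF subsetD[OF LE[OF j] e]] by auto
        have "(\<Sum>e'\<in>L j. if \<nu> e' = \<nu> e then c (Inr (j, Inr e')) else 0) =
            (\<Sum>e'\<in>L j. if e' = e then c (Inr (j, Inr e')) else 0)"
          using \<nu>(2)[OF j] e by (intro sum.cong refl) (auto dest: inj_onD)
        moreover have "(\<Sum>t<s. if t = \<nu> e then c (Inr (j, Inl t)) else 0) = 0"
          using eN by (intro sum.neutral) auto
        ultimately show ?thesis using eq[OF j eN(2)] S0 fin(3)[OF j] e by simp
      qed
      show "c \<iota> = 0" using \<iota> cS cB cL by auto
    qed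
    moreover have "\<forall>k l i. i \<ge> N \<longrightarrow> M k l i = 0"
      using pN nE by (fastforce simp: M_def unit_def)
    moreover have "\<forall>k<r. \<forall>l\<in>schubert_jumps N s (lams ! k). M k l = (\<lambda>i. 0)"
      using nonjump by (auto simp: M_def E_def)
    ultimately show "\<exists>M. (\<forall>k l i. i \<ge> N \<longrightarrow> M k l i = 0) \<and>
       (\<forall>k<r. \<forall>l\<in>schubert_jumps N s (lams ! k). M k l = (\<lambda>i. 0)) \<and>
       lin_indep ?I (diagonal_family Js (\<lambda>t. unit (\<pi> t)) M)" by blast
  qed
  then show ?thesis
  proof (rule generic_mono, intro impI ballI)
    fix x H
    assume x: "indep_flags N r x \<longrightarrow>
      (\<forall>H\<in>sol {0} (ambient N) s lams (flags_of {0} (ambient N) unit x).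
       \<exists>B. cv.span (B ` {..<s}) = H \<and> lin_indep ?I (diagonal_family Js B (col N x)))"
      "indep_flags N r x"
      and H: "H \<in> sol {0} (ambient N) s lams (flags_of {0} (ambient N) unit x)"
    then obtain B where B: "lin_indep ?I (diagonal_family Js B (col N x))" "cv.span (B ` {..<s}) = H"
      by blast
    have SJ: "Js = {} \<Longrightarrow> S = {}" using \<nu>(4) by blast
    have "cv.dim H = s" using H by (simp add: sol_def grass_def dim_zero)
    then show "transversal N x H Js L S"
      unfolding transversal_def using diagonal_family_transversal[OF fin B SJ] by simp
  qed
qed

text \<open>At the test point \<open>x0\<close> the columns in \<open>E\<close> are distinct unit
  vectors.\<close>

lemma generic_independent_columns:
  assumes E: "finite E" "inj_on \<nu> E" "\<And>e. e \<in> E \<Longrightarrow> \<nu> e < N" "\<And>k l. (k, l) \<in> E \<Longrightarrow> l < N"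
  shows "generic (\<lambda>x. lin_indep E (pcol N x))"
proof -
  define x0 where "x0 y = (if \<exists>e\<in>E. y = (fst e * N + snd e) * N + \<nu> e then 1 else 0 :: complex)" for y
  have x0: "pcol N x0 e i = unit (\<nu> e) i" if e: "e \<in> E" for e i
  proof (cases "i < N")
    case True
    have "(\<exists>e'\<in>E. (fst e * N + snd e) * N + i = (fst e' * N + snd e') * N + \<nu> e') \<longleftrightarrow> i = \<nu> e"
    proof
      assume "\<exists>e'\<in>E. (fst e * N + snd e) * N + i = (fst e' * N + snd e') * N + \<nu> e'"
      then obtain e' where e': "e' \<in> E" "(fst e * N + snd e) * N + i = (fst e' * N + snd e') * N + \<nu> e'" by blast
      have lt: "\<nu> e' < N" "snd e < N" "snd e' < N"
        using E(3,4) e e' by (auto simp: prod.collapse) (metis prod.collapse)+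
      have d: "fst e * N + snd e = fst e' * N + snd e'" "i = \<nu> e'"
        using arg_cong[OF e'(2), of "\<lambda>y. y div N"] arg_cong[OF e'(2), of "\<lambda>y. y mod N"] True lt by auto
      have "fst e = fst e'" using arg_cong[OF d(1), of "\<lambda>y. y div N"] lt by simp
      moreover have "snd e = snd e'" using arg_cong[OF d(1), of "\<lambda>y. y mod N"] lt by simp
      ultimately have "e = e'" by (simp add: prod_eq_iff)
      then show "i = \<nu> e" using d by simp
    qed (use e in auto)
    then show ?thesis using True by (auto simp: col_def x0_def unit_def)
  next
    case False
    then show ?thesis using E(3)[OF e] by (auto simp: col_def unit_def)
  qed
  have "lin_indep E (pcol N x0)"
  proof (rule lin_indepI)
    fix c e assume c: "\<And>i. (\<Sum>e\<in>E. c e * pcol N x0 e i) = 0" and e: "e \<in> E"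
    have "(\<Sum>e'\<in>E. c e' * pcol N x0 e' (\<nu> e)) = (\<Sum>e'\<in>E. if e' = e then c e' else 0)"
      by (intro sum.cong refl) (use E(2) e in \<open>auto simp: x0 unit_def dest: inj_onD\<close>)
    then show "c e = 0" using c[of "\<nu> e"] e E(1) by simp
  qed
  moreover have "(\<lambda>x. pcol N x e i) \<in> polys UNIV" for e i
    unfolding col_def by (intro polys_if polys.var polys.const) auto
  ultimately obtain g where "g \<in> polys UNIV" "g x0 \<noteq> 0" "\<forall>x. g x \<noteq> 0 \<longrightarrow> lin_indep E (pcol N x)"
    using lin_indep_open[OF E(1), of "pcol N" UNIV x0] by blast
  then show ?thesis unfolding generic_def cpoly_eq_polys by blast
qed

hide_const (open) FuncSet.compose

section \<open>Parts of composed partitions\<close>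

lemma part_box: "1 \<le> i \<Longrightarrow> part (box k l) i = (if i \<le> k then l else 0)"
  by (auto simp: Defs.part_def box_def)

lemma part_padd: "1 \<le> i \<Longrightarrow> part (padd mu nu) i = part mu i + part nu i"
  by (cases i) (auto simp: padd_def Defs.part_def)

lemma padd_box: "padd (box k x) (box k y) = box k (x + y)"
  by (auto simp: padd_def box_def Defs.part_def intro!: nth_equalityI)

lemma rev_sort_id: "sorted_wrt (\<ge>) xs \<Longrightarrow> rev (sort xs) = (xs :: nat list)"
proof -
  assume "sorted_wrt (\<ge>) xs"
  then have "sorted (rev xs)" by (simp add: sorted_wrt_rev)
  then have "sort xs = rev xs" by (intro properties_for_sort) auto
  then show ?thesis by simp
qed

lemma sorted_wrt_replicate: "P x x \<Longrightarrow> sorted_wrt P (replicate n x)"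
  by (induction n) auto

lemma pcat_box:
  assumes "is_partition al" "\<forall>x\<in>set al. x \<le> z"
  shows "pcat (box k z) al = box k z @ al"
  unfolding pcat_def using assms
  by (intro rev_sort_id) (auto simp: is_partition_def sorted_wrt_append box_def sorted_wrt_replicate)

lemma part_append_box:
  assumes "is_partition al" "\<forall>x\<in>set al. x \<le> z" "1 \<le> i"
  shows "part (box k z @ al) i = (if i \<le> k then z else part al (i - k))"
proof (cases "z = 0")
  case True
  then have "al = []" using assms by (cases al) (auto simp: is_partition_def)
  then show ?thesis using True assms(3) by (auto simp: box_def Defs.part_def)
next
  case False
  then show ?thesis using assms(3) by (auto simp: box_def Defs.part_def nth_append)
qed

lemma pcat_box_box: "pcat (box k z) (box l z) = box (k + l) z"
  unfolding pcat_def by (subst rev_sort_id) (auto simp: box_def sorted_wrt_append sorted_wrt_replicate replicate_add)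

lemma sum_list_box: "sum_list (box k l) = k * l"
  by (simp add: box_def sum_list_replicate)

lemma sum_list_padd: "sum_list (padd mu nu) = sum_list mu + sum_list nu"
proof -
  let ?s = "max (length mu) (length nu)"
  have "sum_list (padd mu nu) = (\<Sum>i\<in>{1..?s}. part (padd mu nu) i)"
    by (rule sum_part[symmetric]) (simp add: padd_def)
  also have "\<dots> = (\<Sum>i\<in>{1..?s}. part mu i) + (\<Sum>i\<in>{1..?s}. part nu i)"
    by (simp add: part_padd sum.distrib[symmetric])
  also have "\<dots> = sum_list mu + sum_list nu"
    by (subst (1 2) sum_part) auto
  finally show ?thesis .
qed

lemma in_box_box: "k \<le> k' \<Longrightarrow> l \<le> l' \<Longrightarrow> in_box k' l' (box k l)"
  by (auto simp: in_box_def box_def)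

lemma in_box_padd:
  assumes "length mu \<le> k" "length nu \<le> k" "\<And>i. part mu i + part nu i \<le> l"
  shows "in_box k l (padd mu nu)"
  using assms by (auto simp: in_box_def padd_def)

lemma part_beyond: "length lam < i \<Longrightarrow> part lam i = 0"
  by (simp add: Defs.part_def)

section \<open>The composed problem: parts, sizes and index shifts\<close>

locale block_composition =
  fixes a1 a2 b1 b2 c d :: nat and ms ns :: "nat list" and alphas betas gammas :: "nat list list"
  assumes sum_ms: "sum_list ms = b1" and sum_ns: "sum_list ns = b2"
    and len_alphas: "length alphas = 2" and len_betas: "length betas = length ms + length ns"
    and rho_problem: "schubert_problem c d (alphas @ betas @ gammas)"
begin

definition "a = a1 + a2"
definition "b = b1 + b2"
definition "N = a + b + c + d"
definition "q = length ms + length ns"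
definition "r = 2 + q + length gammas"
definition "m j = (ms @ ns) ! j"
text \<open>\<open>e' j\<close> counts the rows of the \<open>j\<close>-th box after the first two
  in the block column problem, and \<open>e j\<close> the rows it leaves free.\<close>

definition "e j = (if j < length ms then a1 else a2)"
definition "e' j = (if j < length ms then a2 else a1)"
definition "rho = alphas @ betas @ gammas"
definition "kap = compose [box a1 b1, box a2 b2] (map (box a2) ms @ map (box a1) ns)
   [a1, a2] (ms @ ns) c d alphas betas gammas"
definition "lam = block_column a1 a2 b1 b2 ms ns"

text \<open>A solution \<open>h\<close> of \<open>lam\<close> in the subspace \<open>V\<close> is the same as a solution in the ambient space of this Schubert
  problem on the Grassmannian of \<open>a\<close>-planes, given by the original flags.\<close>

definition "lamt = [box a1 (b1 + c + d), box a2 (b2 + c + d)] @ map (\<lambda>j. box (e' j) (m j)) [0..<q] @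
  replicate (length gammas) []"

text \<open>The fibre flags are cut out by the subspaces of dimension \<open>sh k + l\<close> of the \<open>k\<close>-th flag, which meet the
  solution \<open>h\<close> in dimension \<open>u k\<close>.\<close>

definition "sh k = (if k = 0 then b + a1 else if k = 1 then b + a2 else if k < 2 + q then b - m (k - 2) else b)"
definition "u k = (if k = 0 then a1 else if k = 1 then a2 else 0)"

lemma sum_m: "(\<Sum>j<q. m j) = b"
proof -
  have "(\<Sum>j<q. m j) = sum_list (ms @ ns)"
    unfolding sum_list_sum_nth by (simp add: m_def q_def lessThan_atLeast0)
  then show ?thesis by (simp add: sum_ms sum_ns b_def)
qed

lemma sum_e_m: "(\<Sum>j<q. e' j * m j) = a2 * b1 + a1 * b2"
proof -
  have split: "(\<Sum>k<x + y. f k) = (\<Sum>k<x. f k) + (\<Sum>k<y. f (x + k))" for x y and f :: "nat \<Rightarrow> nat"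
    by (induction y) (auto simp: add.assoc)
  have "(\<Sum>j<q. e' j * m j) = (\<Sum>j<length ms. a2 * ms ! j) + (\<Sum>j<length ns. a1 * ns ! j)"
    unfolding q_def split by (simp add: e'_def m_def nth_append)
  also have "\<dots> = a2 * sum_list ms + a1 * sum_list ns"
    unfolding sum_list_sum_nth by (simp add: sum_distrib_left lessThan_atLeast0)
  finally show ?thesis by (simp add: sum_ms sum_ns)
qed

lemma m_le: "j < q \<Longrightarrow> m j \<le> b"
  using member_le_sum[of j "{..<q}" m] sum_m by simp

lemma e_add: "e j + e' j = a"
  by (simp add: e_def e'_def a_def)

lemma length_rho: "length rho = r"
  by (simp add: rho_def r_def q_def len_alphas len_betas)

lemma length_kap: "length kap = r"
  by (simp add: kap_def Defs.compose_def r_def q_def)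

lemma length_lam: "length lam = 2 + q"
  by (simp add: lam_def block_column_def q_def)

lemma length_lamt: "length lamt = r"
  by (simp add: lamt_def r_def)

lemma rho_nth:
  "rho ! 0 = alphas ! 0" "rho ! 1 = alphas ! 1"
  "j < q \<Longrightarrow> rho ! (2 + j) = betas ! j"
  "k < length gammas \<Longrightarrow> rho ! (2 + q + k) = gammas ! k"
  by (auto simp: rho_def nth_append len_alphas len_betas q_def)

lemma rho_box: "k < r \<Longrightarrow> is_partition (rho ! k) \<and> in_box c d (rho ! k)"
  using rho_problem nth_mem[of k rho] unfolding schubert_problem_def length_rho rho_def[symmetric]
  by blast

lemma rho_size: "sum_list (map sum_list rho) = c * d"
  using rho_problem by (simp add: schubert_problem_def rho_def)

lemma rho_part_le: "k < r \<Longrightarrow> part (rho ! k) i \<le> d"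
  using rho_box part_le by blast

lemma rho_part_0: "k < r \<Longrightarrow> c < i \<Longrightarrow> part (rho ! k) i = 0"
  using rho_box[of k] by (intro part_beyond) (simp add: in_box_def)

lemma nus_nth: "j < q \<Longrightarrow> (map (box a2) ms @ map (box a1) ns) ! j = box (e' j) (m j)"
  by (auto simp: nth_append e'_def m_def q_def)

lemma kap_nth:
  "kap ! 0 = box a1 (d + b1) @ rho ! 0"
  "kap ! 1 = box a2 (d + b2) @ rho ! 1"
  "j < q \<Longrightarrow> kap ! (2 + j) = padd (box (c + e' j) (m j)) (rho ! (2 + j))"
  "k < length gammas \<Longrightarrow> kap ! (2 + q + k) = rho ! (2 + q + k)"
proof -
  have al: "is_partition (rho ! k)" "\<forall>x\<in>set (rho ! k). x \<le> d + z" if "k < r" for k z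
    using rho_box[OF that] by (auto simp: in_box_def intro: trans_le_add1)
  have [simp]: "0 < r" "1 < r" "Suc 0 < r" by (auto simp: r_def)
  have k0: "kap ! 0 = pcat (padd (box a1 d) (box a1 b1)) (rho ! 0)"
    and k1: "kap ! 1 = pcat (padd (box a2 d) (box a2 b2)) (rho ! 1)"
    by (simp_all add: kap_def Defs.compose_def rho_nth rho_nth(2)[unfolded One_nat_def])
  show "kap ! 0 = box a1 (d + b1) @ rho ! 0" "kap ! 1 = box a2 (d + b2) @ rho ! 1"
    unfolding k0 k1 padd_box by (intro pcat_box al; simp)+
  show "kap ! (2 + j) = padd (box (c + e' j) (m j)) (rho ! (2 + j))" if "j < q"
  proof -
    have "kap ! (2 + j) = padd (pcat (box c (m j)) (box (e' j) (m j))) (rho ! (2 + j))"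
      unfolding rho_nth(3)[OF that]
      using that by (auto simp: kap_def Defs.compose_def nth_append q_def m_def e'_def)
    then show ?thesis by (simp add: pcat_box_box)
  qed
  show "kap ! (2 + q + k) = rho ! (2 + q + k)" if "k < length gammas"
    unfolding rho_nth(4)[OF that] using that by (simp add: kap_def Defs.compose_def nth_append q_def)
qed

lemma flag_cases:
  assumes "k < r"
  obtains "k = 0" | "k = 1" | j where "j < q" "k = 2 + j" | j where "j < length gammas" "k = 2 + q + j"
proof -
  have "k = 0 \<or> k = 1 \<or> (\<exists>j<q. k = 2 + j) \<or> (\<exists>j<length gammas. k = 2 + q + j)"
  proof (cases "k < 2 + q")
    case True
    then show ?thesis by (cases "k < 2") (auto intro!: exI[of _ "k - 2"])
  next
    case False
    then show ?thesis using assms by (auto simp: r_def intro!: exI[of _ "k - (2 + q)"])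
  qed
  then show ?thesis using that by blast
qed

lemma kap_part:
  assumes "1 \<le> i"
  shows "part (kap ! 0) i = (if i \<le> a1 then b1 + d else part (rho ! 0) (i - a1))"
    and "part (kap ! 1) i = (if i \<le> a2 then b2 + d else part (rho ! 1) (i - a2))"
    and "j < q \<Longrightarrow> part (kap ! (2 + j)) i = (if i \<le> c + e' j then m j else 0) + part (rho ! (2 + j)) i"
    and "k < length gammas \<Longrightarrow> part (kap ! (2 + q + k)) i = part (rho ! (2 + q + k)) i"
proof -
  have al: "is_partition (rho ! k)" "\<forall>x\<in>set (rho ! k). x \<le> d + z" if "k < r" for k z
    using rho_box[OF that] by (auto simp: in_box_def intro: trans_le_add1)
  have r: "0 < r" "1 < r" by (auto simp: r_def)
  show "part (kap ! 0) i = (if i \<le> a1 then b1 + d else part (rho ! 0) (i - a1))"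
    unfolding kap_nth part_append_box[OF al(1)[OF r(1)] al(2)[OF r(1)] assms] by simp
  show "part (kap ! 1) i = (if i \<le> a2 then b2 + d else part (rho ! 1) (i - a2))"
    unfolding kap_nth part_append_box[OF al(1)[OF r(2)] al(2)[OF r(2)] assms] by simp
  show "j < q \<Longrightarrow> part (kap ! (2 + j)) i = (if i \<le> c + e' j then m j else 0) + part (rho ! (2 + j)) i"
    using assms by (simp only: kap_nth part_padd part_box)
  show "k < length gammas \<Longrightarrow> part (kap ! (2 + q + k)) i = part (rho ! (2 + q + k)) i"
    by (simp only: kap_nth)
qed

lemma kap_box: assumes "k < r" shows "in_box (a + c) (b + d) (kap ! k)"
  using assms
proof (cases rule: flag_cases)
  case 1
  then show ?thesis
    using rho_box[of 0] assms by (auto simp: kap_nth in_box_def box_def a_def b_def intro: trans_le_add2)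
next
  case 2
  then show ?thesis
    using rho_box[of 1] assms unfolding 2 kap_nth
    by (auto simp: in_box_def box_def a_def b_def intro: trans_le_add2)
next
  case (3 j)
  have "length (rho ! (2 + j)) \<le> a + c" using rho_box[OF assms] 3 by (simp add: in_box_def)
  moreover have "length (box (c + e' j) (m j)) \<le> a + c" by (auto simp: box_def e'_def a_def)
  moreover have "part (box (c + e' j) (m j)) i + part (rho ! (2 + j)) i \<le> b + d" for i
    using m_le[OF 3(1)] rho_part_le[OF assms] part_le[OF in_box_box[OF order_refl order_refl]] 3(2)
    by (meson add_mono order_trans)
  ultimately show ?thesis unfolding 3(2) kap_nth(3)[OF 3(1)] by (intro in_box_padd)
next
  case (4 j)
  then show ?thesis
    using rho_box[OF assms] unfolding 4(2) kap_nth(4)[OF 4(1)] by (auto simp: in_box_def intro: trans_le_add2)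
qed

lemma sum_flags: "(\<Sum>k<r. f k) = f 0 + f 1 + (\<Sum>j<q. f (2 + j)) + (\<Sum>k<length gammas. f (2 + q + k) :: nat)"
proof -
  have split: "(\<Sum>k<m + n. f k) = (\<Sum>k<m. f k) + (\<Sum>k<n. f (m + k))" for m n
    by (induction n) (auto simp: add.assoc)
  show ?thesis unfolding r_def split by (simp add: numeral_2_eq_2)
qed

lemma kap_size: "sum_list (map sum_list kap) = (a + c) * (b + d)"
proof -
  have "sum_list (map sum_list kap) = (\<Sum>k<r. sum_list (kap ! k))"
    by (simp add: sum_list_sum_nth length_kap lessThan_atLeast0)
  also have "\<dots> = a1 * (d + b1) + a2 * (d + b2) + (\<Sum>j<q. (c + e' j) * m j) + (\<Sum>k<r. sum_list (rho ! k))"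
  proof -
    have "(\<Sum>j<q. sum_list (kap ! (2 + j))) = (\<Sum>j<q. (c + e' j) * m j + sum_list (rho ! (2 + j)))"
      by (intro sum.cong refl) (simp only: kap_nth sum_list_padd sum_list_box lessThan_iff)
    moreover have "(\<Sum>k<length gammas. sum_list (kap ! (2 + q + k))) =
        (\<Sum>k<length gammas. sum_list (rho ! (2 + q + k)))"
      by (intro sum.cong refl) (simp only: kap_nth lessThan_iff)
    ultimately show ?thesis
      unfolding sum_flags kap_nth(1,2) sum_list_append sum_list_box sum.distrib by linarith
  qed
  also have "(\<Sum>k<r. sum_list (rho ! k)) = c * d"
    using rho_size by (simp add: sum_list_sum_nth length_rho lessThan_atLeast0)
  also have "(\<Sum>j<q. (c + e' j) * m j) = c * b + (a2 * b1 + a1 * b2)"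
    unfolding sum_e_m[symmetric] sum_m[symmetric]
    by (simp add: sum_distrib_left sum.distrib add_mult_distrib)
  finally show ?thesis by (simp add: a_def b_def algebra_simps)
qed

lemma lamt_nth:
  "lamt ! 0 = box a1 (b1 + c + d)" "lamt ! 1 = box a2 (b2 + c + d)"
  "j < q \<Longrightarrow> lamt ! (2 + j) = box (e' j) (m j)"
  "k < length gammas \<Longrightarrow> lamt ! (2 + q + k) = []"
  by (auto simp: lamt_def nth_append)

lemma lam_nth:
  "lam ! 0 = box a1 b1" "lam ! 1 = box a2 b2" "j < q \<Longrightarrow> lam ! (2 + j) = box (e' j) (m j)"
  using nus_nth by (auto simp: lam_def block_column_def)

lemma lamt_box: assumes "k < r" shows "in_box a (N - a) (lamt ! k)"
  using assms
proof (cases rule: flag_cases)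
  case 1
  then show ?thesis by (auto simp: lamt_nth a_def N_def b_def intro!: in_box_box)
next
  case 2
  then show ?thesis unfolding 2 lamt_nth by (auto simp: a_def N_def b_def intro!: in_box_box)
next
  case (3 j)
  then show ?thesis unfolding 3(2) lamt_nth(3)[OF 3(1)]
    using m_le[OF 3(1)] by (auto simp: e'_def a_def N_def intro!: in_box_box)
next
  case (4 j)
  then show ?thesis unfolding 4(2) lamt_nth(4)[OF 4(1)] by (simp add: in_box_def)
qed

text \<open>Widening the first two boxes by \<open>c + d\<close> costs \<open>a * (c + d)\<close>,
  exactly the growth of the dimension of the Grassmannian of \<open>a\<close>-planes from
  \<open>V\<close> to the ambient space.\<close>

lemma lamt_size: "sum_list (map sum_list lamt) = a * (N - a)"
proof -
  have "sum_list (map sum_list lamt) = (\<Sum>k<r. sum_list (lamt ! k))"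
    by (simp add: sum_list_sum_nth length_lamt lessThan_atLeast0)
  also have "\<dots> = a1 * (b1 + c + d) + a2 * (b2 + c + d) + (\<Sum>j<q. e' j * m j)"
  proof -
    have "(\<Sum>j<q. sum_list (lamt ! (2 + j))) = (\<Sum>j<q. e' j * m j)"
      by (intro sum.cong refl) (simp only: lamt_nth sum_list_box lessThan_iff)
    moreover have "(\<Sum>k<length gammas. sum_list (lamt ! (2 + q + k))) = 0"
      by (intro sum.neutral ballI) (simp only: lamt_nth lessThan_iff sum_list.Nil)
    ultimately show ?thesis unfolding sum_flags lamt_nth sum_list_box by simp
  qed
  finally show ?thesis unfolding sum_e_m by (simp add: a_def b_def N_def algebra_simps)
qed

text \<open>The origin of \<open>sh\<close> and \<open>u\<close>: condition \<open>u k + i\<close>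
  of \<open>kap ! k\<close> turns into condition \<open>i\<close> of \<open>rho ! k\<close> once
  steps are counted from \<open>sh k\<close> and intersections from \<open>u k\<close>.\<close>

lemma u_sh:
  assumes "k < r" "i \<in> {1..c}"
  shows "b + d + (u k + i) - part (kap ! k) (u k + i) = sh k + (d + i - part (rho ! k) i)"
    and "u k + i \<le> a + c"
proof -
  have le: "part (rho ! k) i \<le> d" using rho_part_le[OF assms(1)] .
  show "b + d + (u k + i) - part (kap ! k) (u k + i) = sh k + (d + i - part (rho ! k) i)"
    using assms(1)
  proof (cases rule: flag_cases)
    case 1
    then show ?thesis using le assms(2) by (simp add: u_def sh_def kap_part)
  next
    case 2
    show ?thesis unfolding 2 using le assms(2) by (subst kap_part) (auto simp: u_def sh_def 2)
  next
    case (3 j)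
    have "u k = 0" "sh k = b - m j" using 3 by (auto simp: u_def sh_def)
    then show ?thesis
      using le assms(2) m_le[OF 3(1)] unfolding 3(2) by (subst kap_part(3)[OF _ 3(1)]) auto
  next
    case (4 j)
    have "u k = 0" "sh k = b" using 4 by (auto simp: u_def sh_def)
    then show ?thesis
      using le assms(2) unfolding 4(2) by (subst kap_part(4)[OF _ 4(1)]) auto
  qed
  show "u k + i \<le> a + c" using assms(2) by (auto simp: u_def a_def)
qed

end

section \<open>The fibration over flags in good position\<close>

lemma flag_drop:
  assumes "cv.subspace H" "cv.subspace A" "cv.subspace B" "A \<subseteq> B" "B \<subseteq> ambient N"
  shows "cv.dim (H \<inter> B) + cv.dim A \<le> cv.dim (H \<inter> A) + cv.dim B"
proof -
  have "H \<inter> B \<inter> A = H \<inter> A" using assms(4) by auto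
  then show ?thesis
    using dim_int_ge[of "H \<inter> B" A B N] assms by (auto simp: cv.subspace_inter)
qed

lemma grass_std: "H \<in> grass {0} W k \<longleftrightarrow> cv.subspace H \<and> H \<subseteq> W \<and> cv.dim H = k"
  by (auto simp: grass_def dim_zero cv.subspace_0)

section \<open>Induced flags and the essential Schubert conditions\<close>

context block_composition
begin

definition "Vf F = csum (F 0 (a1 + b2)) (F 1 (a2 + b1))"
text \<open>Intersecting a flag with \<open>V\<close> lowers indices by the codimension
  \<open>c + d\<close>. Flags 0 and 1 differ: their initial steps lie in \<open>V\<close> already,
  and for flags in good position the next \<open>c + d\<close> steps contribute nothing new to
  \<open>V\<close>.\<close>

definition "Ef F k l = (if k = 0 \<and> l \<le> a1 + b2 then F 0 l else if k = 1 \<and> l \<le> a2 + b1 then F 1 l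
  else Vf F \<inter> F k (l + c + d))"
text \<open>The same step is the corner of the box in two problems: at row \<open>c + e' j\<close>
  for \<open>kap\<close>, and at row \<open>e' j\<close> for \<open>lamt\<close>.\<close>

definition "Gf F j = F (2 + j) (N - e j - m j)" for F :: "nat \<Rightarrow> nat \<Rightarrow> cvec set"
definition "Tf F h = {v \<in> ambient N. \<forall>j<q. v \<in> csum h (Gf F j)}"
text \<open>The flag induced in \<open>T h / h\<close>, transported to \<open>U / V\<close> by
  adding \<open>V\<close>; before step \<open>sh k\<close> the flag meets \<open>T h\<close> no
  further than \<open>h\<close> does.\<close>

definition "Fhf F h k l = csum (Vf F) (Tf F h \<inter> F k (sh k + l))"

text \<open>Solutions of \<open>kap\<close> by their essential conditions: the corners of the block
  column boxes, and the conditions coming from \<open>rho\<close>.\<close>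

definition "Hsol F = {H. cv.subspace H \<and> H \<subseteq> ambient N \<and> cv.dim H = a + c \<and>
  a1 \<le> cv.dim (H \<inter> F 0 (a1 + b2)) \<and> a2 \<le> cv.dim (H \<inter> F 1 (a2 + b1)) \<and>
  (\<forall>j<q. c + e' j \<le> cv.dim (H \<inter> Gf F j)) \<and>
  (\<forall>k<r. \<forall>i\<in>{1..c}. u k + i \<le> cv.dim (H \<inter> F k (sh k + (d + i - part (rho ! k) i))))}"

definition "hsol F = {h. cv.subspace h \<and> h \<subseteq> ambient N \<and> cv.dim h = a \<and>
  a1 \<le> cv.dim (h \<inter> F 0 (a1 + b2)) \<and> a2 \<le> cv.dim (h \<inter> F 1 (a2 + b1)) \<and>
  (\<forall>j<q. e' j \<le> cv.dim (h \<inter> Gf F j))}"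

definition "flags_ok F \<longleftrightarrow> (\<forall>k<r. (\<forall>j\<le>N. cv.subspace (F k j) \<and> F k j \<subseteq> ambient N \<and> cv.dim (F k j) = j) \<and>
  (\<forall>j\<le>N. \<forall>i\<le>j. F k i \<subseteq> F k j))"

lemma flags_okD:
  assumes "flags_ok F" "k < r" "j \<le> N"
  shows "cv.subspace (F k j)" "F k j \<subseteq> ambient N" "cv.dim (F k j) = j" "i \<le> j \<Longrightarrow> F k i \<subseteq> F k j"
  using assms by (auto simp: flags_ok_def)

text \<open>Descending from step \<open>j\<close> to step \<open>i\<close> loses at most
  \<open>j - i\<close> dimensions, so the condition at a corner implies those in the rows above
  it.\<close>

lemma flags_ok_drop:
  assumes "flags_ok F" "k < r" "j \<le> N" "i \<le> j" "cv.subspace H"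
  shows "cv.dim (H \<inter> F k j) + i \<le> cv.dim (H \<inter> F k i) + j"
proof -
  note D = flags_okD[OF assms(1,2)]
  have i: "i \<le> N" using assms by simp
  show ?thesis
    using flag_drop[OF assms(5) D(1)[OF i] D(1)[OF assms(3)] D(4)[OF assms(3,4)] D(2)[OF assms(3)]]
      D(3)[OF i] D(3)[OF assms(3)] by simp
qed

lemma flags_ok_top: "flags_ok F \<Longrightarrow> k < r \<Longrightarrow> F k N = ambient N"
  using flags_okD[of F k N] by (intro subspace_eqI[of _ _ N]) (auto simp: subspace_ambient dim_ambient)

lemma flags_ok_codim:
  assumes "flags_ok F" "k < r" "i \<le> N" "cv.subspace H" "H \<subseteq> ambient N"
  shows "cv.dim H + i \<le> cv.dim (H \<inter> F k i) + N"
proof -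
  have "H \<inter> F k N = H" using assms flags_ok_top by auto
  then show ?thesis using flags_ok_drop[OF assms(1,2) order_refl assms(3,4)] by simp
qed

lemma r_gt: "0 < r" "1 < r" "j < q \<Longrightarrow> 2 + j < r" "j < q \<Longrightarrow> Suc (Suc j) < r"
  by (auto simp: r_def)

lemma e'_le: "e' j \<le> a" and e_le: "e j \<le> a"
  by (auto simp: e_def e'_def a_def)

lemma G_index: "j < q \<Longrightarrow> N - e j - m j = b + d + (c + e' j) - m j"
  using e_add[of j] by (simp add: N_def)

lemma sh_le: "sh k + c + d \<le> N"
  by (auto simp: sh_def N_def a_def)

lemma dim_int_mono:
  assumes "flags_ok F" "k < r" "j \<le> N" "i \<le> j" "cv.subspace H"
  shows "cv.dim (H \<inter> F k i) \<le> cv.dim (H \<inter> F k j)"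
proof -
  note D = flags_okD[OF assms(1,2)]
  have "i \<le> N" using assms by simp
  then show ?thesis
    using D(1) D(2)[OF assms(3)] D(4)[OF assms(3,4)] assms(3,5)
    by (intro dim_mono[of _ _ N] cv.subspace_inter) blast+
qed

text \<open>Rows carrying parts of \<open>rho\<close> are translated by \<open>u_sh\<close>, the
  remaining rows of a box follow from its corner by \<open>flags_ok_drop\<close>, and in later rows
  the part is 0 and the condition holds for every subspace of dimension
  \<open>a + c\<close>.\<close>

lemma sol_kap:
  assumes ok: "flags_ok F"
  shows "H \<in> sol {0} (ambient N) (a + c) kap F \<longleftrightarrow> H \<in> Hsol F"
proof -
  have Nac: "N - (a + c) = b + d" by (simp add: N_def)
  have sol: "H \<in> sol {0} (ambient N) (a + c) kap F \<longleftrightarrow> cv.subspace H \<and> H \<subseteq> ambient N \<and> cv.dim H = a + c \<and>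
      (\<forall>k<r. \<forall>i\<in>{1..a + c}. i \<le> cv.dim (H \<inter> F k (b + d + i - part (kap ! k) i)))"
    by (auto simp: sol_def schubert_def grass_std length_kap qdim_ambient dim_zero Nac)
  show ?thesis
  proof
    assume "H \<in> sol {0} (ambient N) (a + c) kap F"
    then have H: "cv.subspace H" "H \<subseteq> ambient N" "cv.dim H = a + c"
      and cond: "\<And>k i. k < r \<Longrightarrow> i \<in> {1..a + c} \<Longrightarrow> i \<le> cv.dim (H \<inter> F k (b + d + i - part (kap ! k) i))"
      unfolding sol by auto
    have "a1 \<le> cv.dim (H \<inter> F 0 (a1 + b2))"
    proof (cases "a1 = 0")
      case False
      then show ?thesis using cond[OF r_gt(1), of a1] by (simp add: kap_part a_def b_def add.commute)
    qed simp
    moreover have "a2 \<le> cv.dim (H \<inter> F 1 (a2 + b1))"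
    proof (cases "a2 = 0")
      case False
      then have "part (kap ! 1) a2 = b2 + d" by (subst kap_part(2)) auto
      then show ?thesis using cond[OF r_gt(2), of a2] False by (simp add: a_def b_def add.commute)
    qed simp
    moreover have "c + e' j \<le> cv.dim (H \<inter> Gf F j)" if j: "j < q" for j
    proof (cases "c + e' j = 0")
      case False
      let ?i = "c + e' j"
      have i: "?i \<in> {1..a + c}" using False e'_le[of j] by auto
      have "?i \<le> cv.dim (H \<inter> F (2 + j) (b + d + ?i - part (kap ! (2 + j)) ?i))"
        using cond[OF r_gt(3)[OF j] i] .
      \<comment> \<open>Only an inequality: if \<open>e' j = 0\<close>, row \<open>c\<close> may
        also carry a part of \<open>rho\<close>, which makes the step smaller.\<close>
      also have "\<dots> \<le> cv.dim (H \<inter> F (2 + j) (N - e j - m j))"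
        unfolding G_index[OF j] using i j r_gt(3)[OF j] e'_le[of j]
        by (intro dim_int_mono[OF ok]) (auto simp: kap_part H N_def simp del: add_2_eq_Suc)
      finally show ?thesis by (simp add: Gf_def)
    qed simp
    moreover have "u k + i \<le> cv.dim (H \<inter> F k (sh k + (d + i - part (rho ! k) i)))" if "k < r" "i \<in> {1..c}" for k i
      using cond[OF that(1), of "u k + i"] u_sh[OF that] that(2) by auto
    ultimately show "H \<in> Hsol F" using H unfolding Hsol_def by blast
  next
    assume "H \<in> Hsol F"
    then have H: "cv.subspace H" "H \<subseteq> ambient N" "cv.dim H = a + c"
      and A: "a1 \<le> cv.dim (H \<inter> F 0 (a1 + b2))" "a2 \<le> cv.dim (H \<inter> F 1 (a2 + b1))"
      and G: "\<And>j. j < q \<Longrightarrow> c + e' j \<le> cv.dim (H \<inter> Gf F j)"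
      and R: "\<And>k i. k < r \<Longrightarrow> i \<in> {1..c} \<Longrightarrow> u k + i \<le> cv.dim (H \<inter> F k (sh k + (d + i - part (rho ! k) i)))"
      unfolding Hsol_def by auto
    have top: "i \<le> cv.dim (H \<inter> F k (b + d + i))" if "k < r" "i \<le> a + c" for k i
      using flags_ok_codim[OF ok that(1) _ H(1,2), of "b + d + i"] that(2) H(3) by (simp add: N_def)
    have mid: "u k + i \<le> cv.dim (H \<inter> F k (b + d + (u k + i) - part (kap ! k) (u k + i)))"
      if "k < r" "i \<in> {1..c}" for k i
      using R[OF that] u_sh(1)[OF that] by simp
    have "i \<le> cv.dim (H \<inter> F k (b + d + i - part (kap ! k) i))" if k: "k < r" and i: "i \<in> {1..a + c}" for k i
      using k
    proof (cases rule: flag_cases)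
      case 1
      consider "i \<le> a1" | "a1 < i" "i \<le> a1 + c" | "a1 + c < i" by linarith
      then show ?thesis
      proof cases
        case 1
        have "part (kap ! k) i = b1 + d" using i 1 \<open>k = 0\<close> by (simp add: kap_part)
        then have p: "b + d + i - part (kap ! k) i = b2 + i" by (simp add: b_def)
        show ?thesis
          unfolding p using flags_ok_drop[OF ok r_gt(1), of "a1 + b2" "b2 + i" H] H(1) A(1) 1 \<open>k = 0\<close>
          by (simp add: N_def a_def b_def)
      next
        case 2
        then have "i - a1 \<in> {1..c}" by auto
        from mid[OF k this] show ?thesis using 2 \<open>k = 0\<close> by (simp add: u_def)
      next
        case 3
        then have "part (kap ! k) i = 0" using i rho_part_0[OF k, of "i - a1"] \<open>k = 0\<close> by (simp add: kap_part)
        then show ?thesis using top[OF k] i by simp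
      qed
    next
      case 2
      consider "i \<le> a2" | "a2 < i" "i \<le> a2 + c" | "a2 + c < i" by linarith
      then show ?thesis
      proof cases
        case 1
        have "part (kap ! 1) i = b2 + d" using i 1 by (subst kap_part(2)) auto
        then have p: "b + d + i - part (kap ! k) i = b1 + i" using \<open>k = 1\<close> by (simp add: b_def)
        show ?thesis
          unfolding p using flags_ok_drop[OF ok r_gt(2), of "a2 + b1" "b1 + i" H] H(1) A(2) 1 \<open>k = 1\<close>
          by (simp add: N_def a_def b_def)
      next
        case 2
        then have "i - a2 \<in> {1..c}" by auto
        from mid[OF k this] show ?thesis using 2 \<open>k = 1\<close> by (simp add: u_def)
      next
        case 3
        then have "part (kap ! 1) i = 0"
          using i rho_part_0[OF r_gt(2), of "i - a2"] by (subst kap_part(2)) auto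
        then show ?thesis using top[OF k] i \<open>k = 1\<close> by simp
      qed
    next
      case (3 j)
      have uk: "u k = 0" using 3 by (simp add: u_def)
      consider "i \<le> c" | "c < i" "i \<le> c + e' j" | "c + e' j < i" by linarith
      then show ?thesis
      proof cases
        case 1
        then show ?thesis using mid[OF k, of i] i uk by simp
      next
        case 2
        have "part (kap ! k) i = m j"
          unfolding 3(2) using i 2 rho_part_0[OF k, of i] 3 by (subst kap_part(3)[OF _ 3(1)]) auto
        then have p: "b + d + i - part (kap ! k) i = b + d + i - m j" by simp
        have x: "N - e j - m j = (b + d + i - m j) + (c + e' j - i)"
          unfolding G_index[OF 3(1)] using 2 m_le[OF 3(1)] by simp
        have "cv.dim (H \<inter> F k (N - e j - m j)) + (b + d + i - m j) \<le>
            cv.dim (H \<inter> F k (b + d + i - m j)) + (N - e j - m j)"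
          by (rule flags_ok_drop[OF ok k _ _ H(1)]) (use x in auto)
        moreover have "c + e' j \<le> cv.dim (H \<inter> F k (N - e j - m j))"
          using G[OF 3(1)] by (simp add: Gf_def 3(2))
        ultimately show ?thesis unfolding p using x 2 by linarith
      next
        case 3
        have "part (kap ! k) i = 0"
          unfolding \<open>k = 2 + j\<close> using i 3 rho_part_0[OF k, of i] \<open>k = 2 + j\<close>
          by (subst kap_part(3)[OF _ \<open>j < q\<close>]) auto
        then show ?thesis using top[OF k] i by simp
      qed
    next
      case (4 j)
      have uk: "u k = 0" using 4 by (simp add: u_def)
      show ?thesis
      proof (cases "i \<le> c")
        case True
        then show ?thesis using mid[OF k, of i] i uk by simp
      next
        case False
        have "part (kap ! k) i = 0"
          unfolding 4(2) using i False rho_part_0[OF k, of i] 4(2)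
          by (subst kap_part(4)[OF _ 4(1)]) auto
        then show ?thesis using top[OF k] i by simp
      qed
    qed
    then show "H \<in> sol {0} (ambient N) (a + c) kap F" unfolding sol using H by blast
  qed
qed

lemma lamt_part:
  assumes "1 \<le> i"
  shows "part (lamt ! 0) i = (if i \<le> a1 then b1 + c + d else 0)"
    and "part (lamt ! 1) i = (if i \<le> a2 then b2 + c + d else 0)"
    and "j < q \<Longrightarrow> part (lamt ! (2 + j)) i = (if i \<le> e' j then m j else 0)"
    and "k < length gammas \<Longrightarrow> part (lamt ! (2 + q + k)) i = 0"
  using assms by (simp_all only: lamt_nth part_box) (simp add: Defs.part_def)

lemma sol_lamt:
  assumes ok: "flags_ok F"
  shows "h \<in> sol {0} (ambient N) a lamt F \<longleftrightarrow> h \<in> hsol F"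
proof -
  have Na: "N - a = b + c + d" by (simp add: N_def)
  have sol: "h \<in> sol {0} (ambient N) a lamt F \<longleftrightarrow> cv.subspace h \<and> h \<subseteq> ambient N \<and> cv.dim h = a \<and>
      (\<forall>k<r. \<forall>i\<in>{1..a}. i \<le> cv.dim (h \<inter> F k (b + c + d + i - part (lamt ! k) i)))"
    by (auto simp: sol_def schubert_def grass_std length_lamt qdim_ambient dim_zero Na)
  have G: "N - e j - m j = b + c + d + e' j - m j" for j using e_add[of j] by (simp add: N_def)
  show ?thesis
  proof
    assume "h \<in> sol {0} (ambient N) a lamt F"
    then have H: "cv.subspace h" "h \<subseteq> ambient N" "cv.dim h = a"
      and cond: "\<And>k i. k < r \<Longrightarrow> i \<in> {1..a} \<Longrightarrow> i \<le> cv.dim (h \<inter> F k (b + c + d + i - part (lamt ! k) i))"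
      unfolding sol by auto
    have "a1 \<le> cv.dim (h \<inter> F 0 (a1 + b2))"
    proof (cases "a1 = 0")
      case False
      then show ?thesis using cond[OF r_gt(1), of a1] by (simp add: lamt_part a_def b_def add.commute)
    qed simp
    moreover have "a2 \<le> cv.dim (h \<inter> F 1 (a2 + b1))"
    proof (cases "a2 = 0")
      case False
      then have "part (lamt ! 1) a2 = b2 + c + d" by (subst lamt_part(2)) auto
      then show ?thesis using cond[OF r_gt(2), of a2] False by (simp add: a_def b_def add.commute)
    qed simp
    moreover have "e' j \<le> cv.dim (h \<inter> Gf F j)" if j: "j < q" for j
    proof (cases "e' j = 0")
      case False
      then have "part (lamt ! (2 + j)) (e' j) = m j" by (subst lamt_part(3)[OF _ j]) auto
      then show ?thesis unfolding Gf_def G using cond[OF r_gt(3)[OF j], of "e' j"] e'_le[of j] False by simp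
    qed simp
    ultimately show "h \<in> hsol F" using H unfolding hsol_def by blast
  next
    assume "h \<in> hsol F"
    then have H: "cv.subspace h" "h \<subseteq> ambient N" "cv.dim h = a"
      and A: "a1 \<le> cv.dim (h \<inter> F 0 (a1 + b2))" "a2 \<le> cv.dim (h \<inter> F 1 (a2 + b1))"
      and Gh: "\<And>j. j < q \<Longrightarrow> e' j \<le> cv.dim (h \<inter> Gf F j)"
      unfolding hsol_def by auto
    have top: "i \<le> cv.dim (h \<inter> F k (b + c + d + i - part (lamt ! k) i))"
      if "k < r" "i \<le> a" "part (lamt ! k) i = 0" for k i
      using flags_ok_codim[OF ok that(1) _ H(1,2), of "b + c + d + i"] that(2,3) H(3) by (simp add: N_def)
    have "i \<le> cv.dim (h \<inter> F k (b + c + d + i - part (lamt ! k) i))" if k: "k < r" and i: "i \<in> {1..a}" for k i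
      using k
    proof (cases rule: flag_cases)
      case 1
      show ?thesis
      proof (cases "i \<le> a1")
        case True
        then have p: "b + c + d + i - part (lamt ! k) i = b2 + i"
          using i \<open>k = 0\<close> by (simp add: lamt_part b_def)
        show ?thesis
          unfolding p using flags_ok_drop[OF ok r_gt(1), of "a1 + b2" "b2 + i" h] H(1) A(1) True \<open>k = 0\<close>
          by (simp add: N_def a_def b_def)
      next
        case False
        then show ?thesis using i 1 by (intro top[OF k]) (auto simp: lamt_part)
      qed
    next
      case 2
      show ?thesis
      proof (cases "i \<le> a2")
        case True
        have "part (lamt ! 1) i = b2 + c + d" using i True by (subst lamt_part(2)) auto
        then have p: "b + c + d + i - part (lamt ! k) i = b1 + i"
          using \<open>k = 1\<close> by (simp add: b_def)
        show ?thesis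
          unfolding p using flags_ok_drop[OF ok r_gt(2), of "a2 + b1" "b1 + i" h] H(1) A(2) True \<open>k = 1\<close>
          by (simp add: N_def a_def b_def)
      next
        case False
        then have "part (lamt ! 1) i = 0" using i by (subst lamt_part(2)) auto
        then show ?thesis using i 2 by (intro top[OF k]) auto
      qed
    next
      case (3 j)
      have p: "part (lamt ! k) i = (if i \<le> e' j then m j else 0)"
        unfolding 3(2) using i by (intro lamt_part(3)[OF _ 3(1)]) auto
      show ?thesis
      proof (cases "i \<le> e' j")
        case True
        then have p: "b + c + d + i - part (lamt ! k) i = b + c + d + i - m j" using p by simp
        have x: "N - e j - m j = (b + c + d + i - m j) + (e' j - i)"
          unfolding G using True m_le[OF 3(1)] by simp
        have "cv.dim (h \<inter> F k (N - e j - m j)) + (b + c + d + i - m j) \<le>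
            cv.dim (h \<inter> F k (b + c + d + i - m j)) + (N - e j - m j)"
          by (rule flags_ok_drop[OF ok k _ _ H(1)]) (use x in auto)
        moreover have "e' j \<le> cv.dim (h \<inter> F k (N - e j - m j))"
          using Gh[OF 3(1)] by (simp add: Gf_def 3(2))
        ultimately show ?thesis unfolding p using x True by linarith
      next
        case False
        then show ?thesis using i p by (intro top[OF k]) auto
      qed
    next
      case (4 j)
      have "part (lamt ! k) i = 0" unfolding 4(2) using i by (intro lamt_part(4)[OF _ 4(1)]) auto
      then show ?thesis using i by (intro top[OF k]) auto
    qed
    then show "h \<in> sol {0} (ambient N) a lamt F" unfolding sol using H by blast
  qed
qed

end

context block_composition
begin

text \<open>The dimension bounds are all upper bounds. The opposite inequalities follow from the
  Schubert conditions or from adding codimensions, so each becomes an equality.\<close>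

definition "good F \<longleftrightarrow> flags_ok F \<and>
  F 0 (a1 + b2 + c + d) \<inter> F 1 (a2 + b1) = {0} \<and> F 0 (a1 + b2) \<inter> F 1 (a2 + b1 + c + d) = {0} \<and>
  (\<forall>j<q. Vf F \<inter> F (2 + j) (c + d) = {0}) \<and>
  (\<forall>H\<in>Hsol F. cv.dim (H \<inter> Vf F) \<le> a) \<and>
  (\<forall>h\<in>hsol F. (\<forall>j<q. cv.dim (h \<inter> Gf F j) \<le> e' j) \<and>
     (\<forall>k<r. cv.dim (h \<inter> F k (sh k + c + d)) \<le> u k) \<and>
     cv.dim (Tf F h \<inter> Vf F) \<le> a \<and> (\<forall>k<r. cv.dim (Tf F h \<inter> F k (sh k)) \<le> u k))"

end

lemma dim_finite_inter:
  fixes n N :: nat and m :: "nat \<Rightarrow> nat"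
  assumes "\<And>j. j < n \<Longrightarrow> cv.subspace (W j)" "\<And>j. j < n \<Longrightarrow> W j \<subseteq> ambient N"
    "\<And>j. j < n \<Longrightarrow> N \<le> cv.dim (W j) + m j"
  shows "cv.subspace {v \<in> ambient N. \<forall>j<n. v \<in> W j} \<and> N \<le> cv.dim {v \<in> ambient N. \<forall>j<n. v \<in> W j} + (\<Sum>j<n. m j)"
  using assms
proof (induction n)
  case 0
  then show ?case by (simp add: subspace_ambient dim_ambient)
next
  case (Suc n)
  let ?A = "{v \<in> ambient N. \<forall>j<n. v \<in> W j}"
  have IH: "cv.subspace ?A" "N \<le> cv.dim ?A + (\<Sum>j<n. m j)" using Suc by auto
  have eq: "{v \<in> ambient N. \<forall>j<Suc n. v \<in> W j} = ?A \<inter> W n" by (auto simp: less_Suc_eq)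
  have "cv.dim ?A + cv.dim (W n) \<le> cv.dim (?A \<inter> W n) + cv.dim (ambient N)"
    using IH Suc.prems by (intro dim_int_ge[of _ _ _ N] subspace_ambient) auto
  then show ?case
    unfolding eq using IH Suc.prems(1,3)[of n] by (auto simp: dim_ambient cv.subspace_inter)
qed

lemma dim_inter_mono:
  assumes "cv.subspace h" "cv.subspace H" "cv.subspace A" "h \<subseteq> H" "H \<subseteq> ambient N"
  shows "cv.dim (h \<inter> A) \<le> cv.dim (H \<inter> A)"
  using assms by (intro dim_mono[of _ _ N] cv.subspace_inter) blast+

section \<open>Dimensions forced by good position\<close>

locale good_flags = block_composition +
  fixes F :: "nat \<Rightarrow> nat \<Rightarrow> cvec set"
  assumes good: "good F"
begin

abbreviation "U \<equiv> ambient N"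
abbreviation "V \<equiv> Vf F"
abbreviation "A1 \<equiv> F 0 (a1 + b2)"
abbreviation "A2 \<equiv> F 1 (a2 + b1)"
abbreviation "G \<equiv> Gf F"
abbreviation "T \<equiv> Tf F"

lemma ok: "flags_ok F" using good by (simp add: good_def)

lemmas D = flags_okD[OF ok]

lemma index_le: "a1 + b2 + c + d \<le> N" "a2 + b1 + c + d \<le> N" "a1 + b2 \<le> N" "a2 + b1 \<le> N"
  by (auto simp: N_def a_def b_def)

lemmas D1 = D[OF r_gt(1) index_le(3)] and D2 = D[OF r_gt(2) index_le(4)]

lemma A_disjoint: "A1 \<inter> A2 = {0}"
proof -
  have "A1 \<subseteq> F 0 (a1 + b2 + c + d)" using D(4)[OF r_gt(1) index_le(1)] by simp
  moreover have "F 0 (a1 + b2 + c + d) \<inter> A2 = {0}" using good by (simp add: good_def)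
  ultimately show ?thesis using cv.subspace_0[OF D1(1)] cv.subspace_0[OF D2(1)] by blast
qed

lemma V_subspace: "cv.subspace V" and V_sub: "V \<subseteq> U" and A1_V: "A1 \<subseteq> V" and A2_V: "A2 \<subseteq> V"
  unfolding Vf_def by (rule subspace_csum csum_ambient[OF D1(2) D2(2)] csum_upper1 csum_upper2)+

lemma V_dim: "cv.dim V = a + b"
  using dim_csum[OF D1(1) D2(1) D1(2) D2(2)] D1(3) D2(3) A_disjoint
  by (simp add: Vf_def dim_zero a_def b_def)

lemma qdim_V: "qdim {0} V = a + b" and qdim_U: "qdim V U = c + d"
  by (simp_all add: qdim_def V_dim dim_zero dim_ambient N_def)

text \<open>If a step is a complement of some \<open>W\<close> inside \<open>V\<close>, then every
  later step spans the ambient space together with \<open>V\<close>. For flags 0 and 1 the role of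
  \<open>W\<close> is played by \<open>A2\<close> and \<open>A1\<close>, for the others by
  \<open>V\<close>.\<close>

lemma dim_V_int:
  assumes W: "cv.subspace W" "W \<subseteq> V" and k: "k < r" "s \<le> i" "i \<le> N"
    and "W \<inter> F k s = {0}" "cv.dim W + s = N"
  shows "cv.dim (V \<inter> F k i) + (c + d) = i"
proof -
  have s: "s \<le> N" using k by simp
  have "cv.dim (csum W (F k s)) = N"
    using dim_csum[of W "F k s" N] W V_sub D[OF k(1) s] assms(6,7) by (auto simp: dim_zero)
  moreover have "csum W (F k s) \<subseteq> csum V (F k i)" by (rule csum_mono[OF W(2) D(4)[OF k(1,3,2)]])
  moreover have sub: "csum V (F k i) \<subseteq> U" using V_sub D[OF k(1,3)] by (intro csum_ambient)
  ultimately have "N \<le> cv.dim (csum V (F k i))"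
    using dim_mono[OF subspace_csum subspace_csum, of W "F k s" V "F k i" N] by simp
  moreover have "cv.dim (csum V (F k i)) \<le> N" using dim_le_ambient[OF subspace_csum sub] .
  ultimately show ?thesis
    using dim_csum[OF V_subspace D(1)[OF k(1,3)] V_sub D(2)[OF k(1,3)]] V_dim D(3)[OF k(1,3)]
    by (simp add: N_def)
qed

lemma E_int: "h \<subseteq> V \<Longrightarrow> h \<inter> (V \<inter> X) = h \<inter> X" by blast

lemma Ef_facts:
  assumes k: "k < 2 + q" and l: "l \<le> a + b"
  shows "cv.subspace (Ef F k l)" "Ef F k l \<subseteq> V" "cv.dim (Ef F k l) = l"
proof -
  have kr: "k < r" using k by (simp add: r_def)
  have lN: "l + c + d \<le> N" "l \<le> N" using l by (simp_all add: N_def)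
  have *: "cv.subspace (V \<inter> F k (l + c + d))" using V_subspace D(1)[OF kr lN(1)] by (rule cv.subspace_inter)
  consider (A) "k = 0" "l \<le> a1 + b2" | (B) "k = 1" "l \<le> a2 + b1"
    | (C) "Ef F k l = V \<inter> F k (l + c + d)" "k = 0" "a1 + b2 < l"
    | (E) "Ef F k l = V \<inter> F k (l + c + d)" "k = 1" "a2 + b1 < l"
    | (O) "Ef F k l = V \<inter> F k (l + c + d)" "2 \<le> k"
    by (force simp: Ef_def)
  then have "cv.subspace (Ef F k l) \<and> Ef F k l \<subseteq> V \<and> cv.dim (Ef F k l) = l"
  proof cases
    case A
    then show ?thesis using D[OF r_gt(1) lN(2)] D1(4)[of l] A1_V by (auto simp: Ef_def)
  next
    case B
    then show ?thesis using D[OF r_gt(2) lN(2)] D2(4)[of l] A2_V by (auto simp: Ef_def)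
  next
    case C
    have "cv.dim (V \<inter> F k (l + c + d)) + (c + d) = l + c + d"
      using good C D2 by (intro dim_V_int[OF D2(1) A2_V kr, of "a1 + b2 + c + d"] lN)
        (auto simp: good_def Int_commute N_def a_def b_def)
    then show ?thesis using * C by simp
  next
    case E
    have "cv.dim (V \<inter> F k (l + c + d)) + (c + d) = l + c + d"
      using good E D1 by (intro dim_V_int[OF D1(1) A1_V kr, of "a2 + b1 + c + d"] lN)
        (auto simp: good_def N_def a_def b_def)
    then show ?thesis using * E by simp
  next
    case O
    obtain j where j: "j < q" "k = 2 + j" using O(2) k nat_le_iff_add[of 2 k] by auto
    then have "V \<inter> F k (c + d) = {0}"
      using good unfolding good_def by blast
    then have "cv.dim (V \<inter> F k (l + c + d)) + (c + d) = l + c + d"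
      by (intro dim_V_int[OF V_subspace order_refl kr, of "c + d"] lN) (auto simp: V_dim N_def)
    then show ?thesis using * O by simp
  qed
  then show "cv.subspace (Ef F k l)" "Ef F k l \<subseteq> V" "cv.dim (Ef F k l) = l" by auto
qed

lemma Ef_mono:
  assumes k: "k < 2 + q" and l: "l < a + b"
  shows "Ef F k l \<subseteq> Ef F k (Suc l)"
proof -
  have kr: "k < r" using k by (simp add: r_def)
  have lN: "Suc l + c + d \<le> N" "Suc l \<le> N" using l by (simp_all add: N_def)
  have s: "F k l \<subseteq> F k (Suc l)" "F k (l + c + d) \<subseteq> F k (Suc l + c + d)" "F k l \<subseteq> F k (Suc l + c + d)"
    using D(4)[OF kr lN(1)] D(4)[OF kr lN(2)] by auto
  have "Ef F k l \<subseteq> V" using Ef_facts(2)[OF k] l by simp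
  then show ?thesis using s by (auto simp: Ef_def split: if_splits)
qed

lemma E_instance: "is_instance {0} V (2 + q) (Ef F)"
  unfolding is_instance_def is_flag_def qdim_V
  using Ef_facts Ef_mono cv.subspace_0[OF Ef_facts(1)] by (auto simp: dim_zero)

lemma hsolD:
  assumes "h \<in> hsol F"
  shows "cv.subspace h" "h \<subseteq> U" "cv.dim h = a" "a1 \<le> cv.dim (h \<inter> A1)" "a2 \<le> cv.dim (h \<inter> A2)"
    "j < q \<Longrightarrow> e' j \<le> cv.dim (h \<inter> G j)"
  using assms by (auto simp: hsol_def)

text \<open>\<open>h \<inter> A1\<close> and \<open>h \<inter> A2\<close> are independent of
  dimensions at least \<open>a1\<close> and \<open>a2\<close>, so they already span the
  \<open>a\<close>-dimensional \<open>h\<close>.\<close>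

lemma hsol_sub_V: assumes h: "h \<in> hsol F" shows "h \<subseteq> V"
proof -
  note h' = hsolD[OF h]
  have s1: "cv.subspace (h \<inter> A1)" using h'(1) D1(1) by (rule cv.subspace_inter)
  have s2: "cv.subspace (h \<inter> A2)" using h'(1) D2(1) by (rule cv.subspace_inter)
  have "(h \<inter> A1) \<inter> (h \<inter> A2) = {0}" using A_disjoint cv.subspace_0[OF h'(1)] by blast
  then have "cv.dim (csum (h \<inter> A1) (h \<inter> A2)) \<ge> a"
    using dim_csum[OF s1 s2 le_infI1[OF h'(2)] le_infI1[OF h'(2)]] h'(4,5) by (simp add: dim_zero a_def)
  then have "csum (h \<inter> A1) (h \<inter> A2) = h"
    using h' by (intro subspace_eqI[of _ _ N] subspace_csum csum_least) auto
  moreover have "csum (h \<inter> A1) (h \<inter> A2) \<subseteq> V"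
    using A1_V A2_V by (intro csum_least V_subspace) auto
  ultimately show ?thesis by simp
qed

text \<open>For \<open>h\<close> inside \<open>V\<close>, intersecting with an induced step is the
  same as intersecting with the original step; the base problem in \<open>V\<close> thus reduces to
  corner conditions on the ambient flags.\<close>

lemma sol_lam: "h \<in> sol {0} V a lam (Ef F) \<longleftrightarrow> h \<in> hsol F"
proof -
  have sol: "h \<in> sol {0} V a lam (Ef F) \<longleftrightarrow> cv.subspace h \<and> h \<subseteq> V \<and> cv.dim h = a \<and>
      (\<forall>k<2 + q. \<forall>i\<in>{1..a}. i \<le> cv.dim (h \<inter> Ef F k (b + i - part (lam ! k) i)))"
    by (auto simp: sol_def schubert_def grass_std length_lam qdim_V dim_zero)
  have Gp: "b + e' j - m j + c + d = N - e j - m j" if "j < q" for j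
    using e_add[of j] m_le[OF that] by (simp add: N_def)
  have part2: "part (lam ! (2 + j)) i = (if i \<le> e' j then m j else 0)" if "j < q" "1 \<le> i" for i j
    using that by (simp only: lam_nth part_box)
  have part1: "part (lam ! 1) i = (if i \<le> a2 then b2 else 0)" if "1 \<le> i" for i
    using that by (simp only: lam_nth part_box)
  have EG: "Ef F (2 + j) l = V \<inter> F (2 + j) (l + c + d)" for j l by (simp add: Ef_def)
  show ?thesis
  proof
    assume "h \<in> sol {0} V a lam (Ef F)"
    then have h: "cv.subspace h" "h \<subseteq> V" "cv.dim h = a"
      and cond: "\<And>k i. k < 2 + q \<Longrightarrow> i \<in> {1..a} \<Longrightarrow> i \<le> cv.dim (h \<inter> Ef F k (b + i - part (lam ! k) i))"
      unfolding sol by auto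
    have "a1 \<le> cv.dim (h \<inter> A1)"
    proof (cases "a1 = 0")
      case False
      then show ?thesis using cond[of 0 a1] by (simp add: lam_nth part_box a_def b_def Ef_def add.commute)
    qed simp
    moreover have "a2 \<le> cv.dim (h \<inter> A2)"
    proof (cases "a2 = 0")
      case False
      then show ?thesis using cond[of 1 a2] part1[of a2] by (simp add: a_def b_def Ef_def add.commute)
    qed simp
    moreover have "e' j \<le> cv.dim (h \<inter> G j)" if j: "j < q" for j
    proof (cases "e' j = 0")
      case False
      then have "e' j \<le> cv.dim (h \<inter> (V \<inter> F (2 + j) (b + e' j - m j + c + d)))"
        using cond[of "2 + j" "e' j"] part2[OF j, of "e' j"] e'_le[of j] j unfolding EG by simp
      then show ?thesis unfolding E_int[OF h(2)] Gf_def Gp[OF j] .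
    qed simp
    ultimately show "h \<in> hsol F" using h V_sub unfolding hsol_def by blast
  next
    assume hs: "h \<in> hsol F"
    note h = hsolD[OF hs]
    have hV: "h \<subseteq> V" by (rule hsol_sub_V[OF hs])
    have top: "i \<le> cv.dim (h \<inter> Ef F k (b + i - part (lam ! k) i))"
      if k: "k < 2 + q" and i: "i \<le> a" and "part (lam ! k) i = 0" for k i
    proof -
      have "b + i \<le> a + b" using i by simp
      then have "cv.dim (h \<inter> V) + cv.dim (Ef F k (b + i)) \<le> cv.dim (h \<inter> Ef F k (b + i)) + cv.dim V"
        using Ef_facts[OF k] V_sub V_subspace h(1) by (intro flag_drop[of _ _ _ N]) auto
      moreover have "h \<inter> V = h" using hV by blast
      ultimately show ?thesis
        using that(3) Ef_facts(3)[OF k \<open>b + i \<le> a + b\<close>] V_dim h(3) by simp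
    qed
    have "i \<le> cv.dim (h \<inter> Ef F k (b + i - part (lam ! k) i))" if k: "k < 2 + q" and i: "i \<in> {1..a}" for k i
    proof -
      have "k = 0 \<or> k = 1 \<or> (\<exists>j<q. k = 2 + j)" using k by presburger
      then consider "k = 0" | "k = 1" | j where "j < q" "k = 2 + j" by blast
      then show ?thesis
      proof cases
        case 1
        show ?thesis
        proof (cases "i \<le> a1")
          case True
          then have p: "Ef F k (b + i - part (lam ! k) i) = F 0 (b2 + i)"
            using i 1 by (simp add: lam_nth part_box b_def Ef_def)
          show ?thesis
            unfolding p using flags_ok_drop[OF ok r_gt(1) index_le(3), of "b2 + i" h] h(1,4) True by simp
        next
          case False
          then show ?thesis using i 1 by (intro top[OF k]) (auto simp: lam_nth part_box)
        qed
      next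
        case 2
        show ?thesis
        proof (cases "i \<le> a2")
          case True
          then have p: "Ef F k (b + i - part (lam ! k) i) = F 1 (b1 + i)"
            using i 2 part1[of i] by (simp add: b_def Ef_def)
          show ?thesis
            unfolding p using flags_ok_drop[OF ok r_gt(2) index_le(4), of "b1 + i" h] h(1,5) True by simp
        next
          case False
          then show ?thesis using i 2 part1[of i] by (intro top[OF k]) auto
        qed
      next
        case (3 j)
        show ?thesis
        proof (cases "i \<le> e' j")
          case True
          then have p: "h \<inter> Ef F k (b + i - part (lam ! k) i) = h \<inter> F (2 + j) (b + i - m j + c + d)"
            unfolding 3(2) EG E_int[OF hV] using part2[OF 3(1), of i] i by simp
          have x: "N - e j - m j = (b + i - m j + c + d) + (e' j - i)"
            unfolding Gp[OF 3(1), symmetric] using True m_le[OF 3(1)] by simp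
          have "cv.dim (h \<inter> F (2 + j) (N - e j - m j)) + (b + i - m j + c + d) \<le>
              cv.dim (h \<inter> F (2 + j) (b + i - m j + c + d)) + (N - e j - m j)"
            by (rule flags_ok_drop[OF ok r_gt(3)[OF 3(1)] _ _ h(1)]) (use x in auto)
          then show ?thesis unfolding p using h(6)[OF 3(1)] x True unfolding Gf_def by linarith
        next
          case False
          then show ?thesis using i part2[OF 3(1), of i] unfolding 3(2)
            by (intro top) (use 3 in auto)
        qed
      qed
    qed
    then show "h \<in> sol {0} V a lam (Ef F)" unfolding sol using h hV by blast
  qed
qed

section \<open>The space \<open>T h\<close> and the fibre flags over one base solution\<close>

context
  fixes h assumes hs: "h \<in> hsol F"
begin

lemmas h = hsolD[OF hs] and hV = hsol_sub_V[OF hs]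

lemma G_facts:
  assumes "j < q"
  shows "cv.subspace (G j)" "G j \<subseteq> U" "cv.dim (G j) + e j + m j = N"
proof -
  have le: "N - e j - m j \<le> N" by simp
  show "cv.subspace (G j)" "G j \<subseteq> U" unfolding Gf_def using D[OF r_gt(3)[OF assms] le] by auto
  have "e j + m j \<le> N" using e_le[of j] m_le[OF assms] by (simp add: N_def)
  then show "cv.dim (G j) + e j + m j = N" unfolding Gf_def using D(3)[OF r_gt(3)[OF assms] le] by simp
qed

lemma hG_dim: "j < q \<Longrightarrow> cv.dim (h \<inter> G j) = e' j"
  using good hs h(6) by (fastforce simp: good_def intro: antisym)

text \<open>The overlap \<open>e' j\<close> and the missing \<open>e j\<close> dimensions of
  \<open>G j\<close> together make up \<open>a\<close>, so only the codimension \<open>m j\<close>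
  remains.\<close>

lemma W_dim: assumes "j < q" shows "cv.dim (csum h (G j)) + m j = N"
  using dim_csum[OF h(1) G_facts(1)[OF assms] h(2) G_facts(2)[OF assms]] hG_dim[OF assms] h(3)
    G_facts(3)[OF assms] e_add[of j] by linarith

lemma W_sub: "j < q \<Longrightarrow> csum h (G j) \<subseteq> U"
  using h(2) G_facts(2) by (intro csum_ambient)

lemma T_subspace: "cv.subspace (T h)" and T_dim_ge: "a + c + d \<le> cv.dim (T h)"
  using dim_finite_inter[of q "\<lambda>j. csum h (G j)" N m] W_dim W_sub subspace_csum sum_m
  by (auto simp: Tf_def N_def)

lemma T_sub: "T h \<subseteq> U" by (auto simp: Tf_def)

lemma h_T: "h \<subseteq> T h" using h(2) csum_upper1 by (auto simp: Tf_def)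

lemma T_V: "T h \<inter> V = h"
proof (rule subspace_eqI[symmetric, of _ _ N])
  show "h \<subseteq> T h \<inter> V" using h_T hV by blast
  show "cv.dim (T h \<inter> V) \<le> cv.dim h" using good hs h(3) by (simp add: good_def)
qed (use h T_subspace V_subspace T_sub in \<open>auto intro: cv.subspace_inter\<close>)

text \<open>As \<open>T h \<inter> V = h\<close>, the sum \<open>T h + V\<close> exceeds
  \<open>T h\<close> by \<open>b\<close> dimensions but cannot exceed \<open>N\<close>; together
  with \<open>T_dim_ge\<close> this forces both equalities.\<close>

lemma T_dim: "cv.dim (T h) = a + c + d" and T_V_sum: "csum (T h) V = U"
proof -
  have le: "cv.dim (csum (T h) V) \<le> N" using T_sub V_sub by (intro dim_le_ambient subspace_csum csum_ambient)
  have eq: "cv.dim (csum (T h) V) + a = cv.dim (T h) + (a + b)"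
    using dim_csum[OF T_subspace V_subspace T_sub V_sub] T_V h(3) V_dim by simp
  then show td: "cv.dim (T h) = a + c + d" using le T_dim_ge by (simp add: N_def)
  show "csum (T h) V = U"
    using eq td T_sub V_sub by (intro subspace_eqI[of _ _ N] subspace_csum csum_ambient subspace_ambient)
      (auto simp: dim_ambient N_def)
qed

lemma hF_dim: assumes k: "k < r" and l: "l \<le> c + d" shows "cv.dim (h \<inter> F k (sh k + l)) = u k"
proof (rule antisym)
  have "cv.dim (h \<inter> F k (sh k + l)) \<le> cv.dim (h \<inter> F k (sh k + c + d))"
    using l sh_le[of k] by (intro dim_int_mono[OF ok k _ _ h(1)]) auto
  also have "\<dots> \<le> u k" using good hs k by (simp add: good_def)
  finally show "cv.dim (h \<inter> F k (sh k + l)) \<le> u k" .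
  have le: "sh k + l \<le> N" using l sh_le[of k] by simp
  show "u k \<le> cv.dim (h \<inter> F k (sh k + l))"
  proof (cases "k = 0 \<or> k = 1")
    case False
    then show ?thesis by (simp add: u_def)
  next
    case True
    then show ?thesis
    proof
      assume k0: "k = 0"
      have "cv.dim (h \<inter> F k (a1 + b2)) \<le> cv.dim (h \<inter> F k (sh k + l))"
        using k0 by (intro dim_int_mono[OF ok k le _ h(1)]) (simp add: sh_def b_def)
      then show ?thesis using h(4) k0 by (simp add: u_def)
    next
      assume k1: "k = 1"
      have "cv.dim (h \<inter> F k (a2 + b1)) \<le> cv.dim (h \<inter> F k (sh k + l))"
        using k1 by (intro dim_int_mono[OF ok k le _ h(1)]) (simp add: sh_def b_def)
      then show ?thesis using h(5) k1 by (simp add: u_def)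
    qed
  qed
qed

text \<open>The upper bound propagates from step \<open>sh k\<close>. The lower bound is the count
  of codimensions, which for \<open>k = 2 + j\<close> must be made inside \<open>h + G j\<close>:
  this space contains both \<open>T h\<close> and the step, and the count improves by its
  codimension \<open>m j\<close>.\<close>

lemma TF_dim: assumes k: "k < r" and l: "l \<le> c + d" shows "cv.dim (T h \<inter> F k (sh k + l)) = u k + l"
proof (rule antisym)
  have le: "sh k + l \<le> N" using l sh_le[of k] by simp
  have "cv.dim (T h \<inter> F k (sh k + l)) + sh k \<le> cv.dim (T h \<inter> F k (sh k)) + (sh k + l)"
    using le by (intro flags_ok_drop[OF ok k _ _ T_subspace]) auto
  moreover have "cv.dim (T h \<inter> F k (sh k)) \<le> u k" using good hs k by (simp add: good_def)
  ultimately show "cv.dim (T h \<inter> F k (sh k + l)) \<le> u k + l" by simp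
  have gen: "cv.dim (T h) + (sh k + l) \<le> cv.dim (T h \<inter> F k (sh k + l)) + N"
    by (rule flags_ok_codim[OF ok k le T_subspace T_sub])
  show "u k + l \<le> cv.dim (T h \<inter> F k (sh k + l))"
    using k
  proof (cases rule: flag_cases)
    case (3 j)
    have "sh k + l \<le> N - e j - m j"
      using l m_le[OF 3(1)] 3 e_add[of j] by (simp add: sh_def N_def)
    then have "F k (sh k + l) \<subseteq> G j" unfolding Gf_def 3(2) using r_gt(3)[OF 3(1)] by (intro D(4)) auto
    then have sub: "F k (sh k + l) \<subseteq> csum h (G j)" using csum_upper2 by blast
    have "T h \<subseteq> csum h (G j)" using 3(1) by (auto simp: Tf_def)
    then have "cv.dim (T h) + cv.dim (F k (sh k + l)) \<le> cv.dim (T h \<inter> F k (sh k + l)) + cv.dim (csum h (G j))"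
      using sub W_sub[OF 3(1)] by (intro dim_int_ge[of _ _ _ N] T_subspace D(1)[OF k le] subspace_csum)
    then show ?thesis
      using W_dim[OF 3(1)] T_dim D(3)[OF k le] 3 m_le[OF 3(1)] by (simp add: sh_def u_def N_def)
  qed (use gen T_dim in \<open>auto simp: sh_def u_def N_def\<close>)
qed

lemma V_TF: "V \<inter> (T h \<inter> F k i) = h \<inter> F k i" using T_V by blast

text \<open>The sum with \<open>V\<close> loses the dimension \<open>u k\<close> of
  \<open>h \<inter> F k (sh k + l)\<close>, which is exactly the excess in
  \<open>TF_dim\<close>.\<close>

lemma Fhf_facts:
  assumes k: "k < r" and l: "l \<le> c + d"
  shows "cv.subspace (Fhf F h k l)" "V \<subseteq> Fhf F h k l" "Fhf F h k l \<subseteq> U" "cv.dim (Fhf F h k l) = a + b + l"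
proof -
  have le: "sh k + l \<le> N" using l sh_le[of k] by simp
  show "cv.subspace (Fhf F h k l)" "V \<subseteq> Fhf F h k l" "Fhf F h k l \<subseteq> U"
    unfolding Fhf_def by (rule subspace_csum, rule csum_upper1, rule csum_ambient[OF V_sub]) (use T_sub in blast)
  have "cv.dim (csum V (T h \<inter> F k (sh k + l))) + u k = a + b + (u k + l)"
    using dim_csum[OF V_subspace cv.subspace_inter[OF T_subspace D(1)[OF k le]] V_sub, of ] T_sub
      hF_dim[OF k l] TF_dim[OF k l] V_dim unfolding V_TF by auto
  then show "cv.dim (Fhf F h k l) = a + b + l" by (simp add: Fhf_def)
qed

lemma Fhf_instance: "is_instance V U r (Fhf F h)"
proof -
  have "Fhf F h k l \<subseteq> Fhf F h k (Suc l)" if "k < r" "l < c + d" for k l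
    unfolding Fhf_def using that sh_le[of k] D(4)[OF that(1), of "sh k + Suc l" "sh k + l"]
    by (intro csum_mono) auto
  then show ?thesis
    unfolding is_instance_def is_flag_def qdim_U using Fhf_facts by (simp add: V_dim)
qed

lemma sol_rho:
  "K \<in> sol V U c rho (Fhf F h) \<longleftrightarrow> cv.subspace K \<and> V \<subseteq> K \<and> K \<subseteq> U \<and> cv.dim K = a + b + c \<and>
     (\<forall>k<r. \<forall>i\<in>{1..c}. a + b + i \<le> cv.dim (K \<inter> Fhf F h k (d + i - part (rho ! k) i)))"
  by (auto simp: sol_def schubert_def grass_def length_rho qdim_U V_dim)

text \<open>The modular law does the work: \<open>T h + V = U\<close> gives
  \<open>K = V + (K \<inter> T h)\<close>; \<open>K \<inter> T h\<close> lies in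
  \<open>h + G j\<close>, so it is the sum of \<open>h\<close> and its intersection with
  \<open>G j\<close>; and \<open>K\<close> meets a fibre step in \<open>V\<close> plus the
  intersection of \<open>K \<inter> T h\<close> with the original step.\<close>

lemma lift_solution:
  assumes K: "K \<in> sol V U c rho (Fhf F h)"
  shows "K \<inter> T h \<in> Hsol F" "K \<inter> T h \<inter> V = h" "csum (K \<inter> T h) V = K"
proof -
  let ?H = "K \<inter> T h"
  have K': "cv.subspace K" "V \<subseteq> K" "K \<subseteq> U" "cv.dim K = a + b + c"
    and cond: "\<And>k i. k < r \<Longrightarrow> i \<in> {1..c} \<Longrightarrow> a + b + i \<le> cv.dim (K \<inter> Fhf F h k (d + i - part (rho ! k) i))"
    using K unfolding sol_rho by auto
  have Hs: "cv.subspace ?H" using K'(1) T_subspace by (rule cv.subspace_inter)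
  have HU: "?H \<subseteq> U" using K' by blast
  show HV: "?H \<inter> V = h" using T_V K'(2) by blast
  have "K \<inter> csum V (T h) = csum V ?H" by (rule csum_modular[OF V_subspace T_subspace K'(1,2)])
  then show HVK: "csum ?H V = K" using T_V_sum K'(3) by (auto simp: csum_commute)
  have Hd: "cv.dim ?H = a + c"
    using dim_csum[OF Hs V_subspace HU V_sub] HV HVK K'(4) h(3) V_dim by simp
  have hH: "h \<subseteq> ?H" using HV by blast
  have "a1 \<le> cv.dim (?H \<inter> A1)"
    using h(4) dim_inter_mono[OF h(1) Hs D1(1) hH HU] by simp
  moreover have "a2 \<le> cv.dim (?H \<inter> A2)"
    using h(5) dim_inter_mono[OF h(1) Hs D2(1) hH HU] by simp
  moreover have "c + e' j \<le> cv.dim (?H \<inter> G j)" if j: "j < q" for j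
  proof -
    note Gj = G_facts[OF j]
    have HG: "cv.subspace (?H \<inter> G j)" using Hs Gj(1) by (rule cv.subspace_inter)
    have "?H \<subseteq> csum h (G j)" using j by (auto simp: Tf_def)
    then have "csum h (?H \<inter> G j) = ?H"
      using csum_modular[OF h(1) Gj(1) Hs hH] by blast
    moreover have "h \<inter> (?H \<inter> G j) = h \<inter> G j" using hH by blast
    ultimately have "cv.dim ?H + cv.dim (h \<inter> G j) = cv.dim h + cv.dim (?H \<inter> G j)"
      using dim_csum[OF h(1) HG h(2), of] HU by force
    then show ?thesis using Hd h(3) hG_dim[OF j] by simp
  qed
  moreover have "u k + i \<le> cv.dim (?H \<inter> F k (sh k + (d + i - part (rho ! k) i)))"
    if k: "k < r" and i: "i \<in> {1..c}" for k i
  proof -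
    let ?l = "d + i - part (rho ! k) i"
    have l: "?l \<le> c + d" using i by auto
    have le: "sh k + ?l \<le> N" using l sh_le[of k] by simp
    have TF: "cv.subspace (T h \<inter> F k (sh k + ?l))" using T_subspace D(1)[OF k le] by (rule cv.subspace_inter)
    have HF: "cv.subspace (?H \<inter> F k (sh k + ?l))" using Hs D(1)[OF k le] by (rule cv.subspace_inter)
    have "K \<inter> Fhf F h k ?l = csum V (?H \<inter> F k (sh k + ?l))"
      unfolding Fhf_def using csum_modular[OF V_subspace TF K'(1,2)] by (simp add: Int_assoc)
    moreover have "V \<inter> (?H \<inter> F k (sh k + ?l)) = h \<inter> F k (sh k + ?l)" using HV by blast
    ultimately have "cv.dim (K \<inter> Fhf F h k ?l) + u k = a + b + cv.dim (?H \<inter> F k (sh k + ?l))"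
      using dim_csum[OF V_subspace HF V_sub, of] HU hF_dim[OF k l] V_dim by force
    then show ?thesis using cond[OF k i] by simp
  qed
  ultimately show "?H \<in> Hsol F" unfolding Hsol_def using Hs HU Hd by blast
qed

end

section \<open>From solutions of the composed problem to base and fibre\<close>

lemma HsolD:
  assumes "H \<in> Hsol F"
  shows "cv.subspace H" "H \<subseteq> U" "cv.dim H = a + c" "a1 \<le> cv.dim (H \<inter> A1)" "a2 \<le> cv.dim (H \<inter> A2)"
    "j < q \<Longrightarrow> c + e' j \<le> cv.dim (H \<inter> G j)"
    "k < r \<Longrightarrow> i \<in> {1..c} \<Longrightarrow> u k + i \<le> cv.dim (H \<inter> F k (sh k + (d + i - part (rho ! k) i)))"
  using assms by (auto simp: Hsol_def)

text \<open>The intersections with \<open>A1\<close> and \<open>A2\<close> give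
  \<open>H \<inter> V\<close> dimension at least \<open>a\<close>, and good position gives at most
  \<open>a\<close>. So \<open>H \<inter> V\<close> has codimension \<open>c\<close> in
  \<open>H\<close>, which turns \<open>c + e' j\<close> into \<open>e' j\<close>.\<close>

lemma project_solution:
  assumes HH: "H \<in> Hsol F"
  shows "H \<inter> V \<in> hsol F"
proof -
  note H = HsolD[OF HH]
  let ?h = "H \<inter> V"
  have hs: "cv.subspace ?h" using H(1) V_subspace by (rule cv.subspace_inter)
  have hA: "?h \<inter> A1 = H \<inter> A1" "?h \<inter> A2 = H \<inter> A2" using A1_V A2_V by blast+
  have s1: "cv.subspace (H \<inter> A1)" using H(1) D1(1) by (rule cv.subspace_inter)
  have s2: "cv.subspace (H \<inter> A2)" using H(1) D2(1) by (rule cv.subspace_inter)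
  have "(H \<inter> A1) \<inter> (H \<inter> A2) = {0}" using A_disjoint cv.subspace_0[OF H(1)] by blast
  then have "a \<le> cv.dim (csum (H \<inter> A1) (H \<inter> A2))"
    using dim_csum[OF s1 s2 le_infI1[OF H(2)] le_infI1[OF H(2)]] H(4,5) by (simp add: dim_zero a_def)
  also have "\<dots> \<le> cv.dim ?h"
    using A1_V A2_V H(2) by (intro dim_mono[of _ _ N] subspace_csum hs csum_least) auto
  finally have hd: "cv.dim ?h = a" using good HH by (fastforce simp: good_def intro: antisym)
  moreover have "e' j \<le> cv.dim (?h \<inter> G j)" if j: "j < q" for j
  proof -
    have le: "N - e j - m j \<le> N" by simp
    note Gj = D[OF r_gt(3)[OF j] le, folded Gf_def]
    have "cv.dim (H \<inter> G j) + cv.dim ?h \<le> cv.dim ((H \<inter> G j) \<inter> ?h) + cv.dim H"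
      using H(1,2) hs Gj(1) V_subspace by (intro dim_int_ge[of _ _ _ N] cv.subspace_inter) auto
    moreover have "(H \<inter> G j) \<inter> ?h = ?h \<inter> G j" by blast
    ultimately show ?thesis using H(3) H(6)[OF j] hd by simp
  qed
  ultimately show ?thesis unfolding hsol_def mem_Collect_eq hA using hs H by blast
qed

text \<open>\<open>H \<inter> G j\<close> has dimension at least \<open>c + e' j\<close> and
  overlaps \<open>H \<inter> V\<close> in exactly \<open>e' j\<close>, so together they span the
  \<open>(a + c)\<close>-dimensional \<open>H\<close>.\<close>

lemma solution_in_T:
  assumes HH: "H \<in> Hsol F"
  shows "H \<subseteq> T (H \<inter> V)"
proof
  note H = HsolD[OF HH]
  note hh = project_solution[OF HH]
  let ?h = "H \<inter> V"
  fix v assume v: "v \<in> H"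
  have "v \<in> csum ?h (G j)" if j: "j < q" for j
  proof -
    note Gj = G_facts[OF hh j]
    have HG: "cv.subspace (H \<inter> G j)" using H(1) Gj(1) by (rule cv.subspace_inter)
    have "?h \<inter> (H \<inter> G j) = ?h \<inter> G j" by blast
    then have "cv.dim (csum ?h (H \<inter> G j)) + e' j = a + cv.dim (H \<inter> G j)"
      using dim_csum[OF hsolD(1)[OF hh] HG hsolD(2)[OF hh], of] H(2) hG_dim[OF hh j] hsolD(3)[OF hh] by force
    then have "csum ?h (H \<inter> G j) = H"
      using H(1,2,3) H(6)[OF j] by (intro subspace_eqI[of _ _ N] subspace_csum csum_least) auto
    moreover have "csum ?h (H \<inter> G j) \<subseteq> csum ?h (G j)" by (rule csum_mono) auto
    ultimately show ?thesis using v by blast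
  qed
  then show "v \<in> T ?h" using v H(2) by (auto simp: Tf_def)
qed

text \<open>Since \<open>H\<close> lies in \<open>T (H \<inter> V)\<close>, its intersections with
  the original flags survive in the fibre flags, losing only \<open>u k\<close>. Finally
  \<open>H\<close> and \<open>csum H V \<inter> T (H \<inter> V)\<close> agree by dimension.\<close>

lemma image_solution:
  assumes HH: "H \<in> Hsol F"
  shows "csum H V \<in> sol V U c rho (Fhf F (H \<inter> V))" "csum H V \<inter> T (H \<inter> V) = H"
proof -
  note H = HsolD[OF HH]
  note hh = project_solution[OF HH]
  let ?h = "H \<inter> V" and ?K = "csum H V"
  have Kd: "cv.dim ?K = a + b + c"
    using dim_csum[OF H(1) V_subspace H(2) V_sub] hsolD(3)[OF hh] H(3) V_dim by simp
  have KU: "?K \<subseteq> U" using H(2) V_sub by (rule csum_ambient)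
  have "a + b + i \<le> cv.dim (?K \<inter> Fhf F ?h k (d + i - part (rho ! k) i))" if k: "k < r" and i: "i \<in> {1..c}" for k i
  proof -
    let ?l = "d + i - part (rho ! k) i"
    have l: "?l \<le> c + d" using i by auto
    have le: "sh k + ?l \<le> N" using l sh_le[of k] by simp
    let ?X = "H \<inter> F k (sh k + ?l)"
    have X: "cv.subspace ?X" using H(1) D(1)[OF k le] by (rule cv.subspace_inter)
    have "V \<inter> ?X = ?h \<inter> F k (sh k + ?l)" by blast
    then have "cv.dim (csum V ?X) + u k = a + b + cv.dim ?X"
      using dim_csum[OF V_subspace X V_sub, of] H(2) hF_dim[OF hh k l] V_dim by force
    then have "a + b + i \<le> cv.dim (csum V ?X)" using H(7)[OF k i] by simp
    also have "\<dots> \<le> cv.dim (?K \<inter> Fhf F ?h k ?l)"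
    proof (rule dim_mono[of _ _ N])
      have "?X \<subseteq> T ?h \<inter> F k (sh k + ?l)" using solution_in_T[OF HH] by blast
      then have "csum V ?X \<subseteq> Fhf F ?h k ?l" unfolding Fhf_def by (intro csum_mono) auto
      moreover have "csum V ?X \<subseteq> ?K" unfolding csum_commute[of H V] by (intro csum_mono) auto
      ultimately show "csum V ?X \<subseteq> ?K \<inter> Fhf F ?h k ?l" by blast
    qed (use KU Fhf_facts(1)[OF hh k l] in \<open>auto intro!: cv.subspace_inter subspace_csum\<close>)
    finally show ?thesis .
  qed
  then show K: "?K \<in> sol V U c rho (Fhf F ?h)"
    unfolding sol_rho[OF hh] using Kd KU subspace_csum csum_upper2 by blast
  have "cv.dim (?K \<inter> T ?h) = a + c" using lift_solution(1)[OF hh K] HsolD(3) by blast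
  moreover have "H \<subseteq> ?K \<inter> T ?h" using solution_in_T[OF HH] csum_upper1 by blast
  ultimately show "?K \<inter> T ?h = H"
    using H(1,3) HsolD(1,2)[OF lift_solution(1)[OF hh K]] by (intro subspace_eqI[symmetric, of _ _ N]) auto
qed

lemma fibration:
  "bij_betw (\<lambda>H. (H \<inter> V, csum H V)) (sol {0} U (a + c) kap F)
     (SIGMA h:sol {0} V a lam (Ef F). sol V U c rho (Fhf F h))"
proof (rule bij_betw_byWitness[where f' = "\<lambda>(h, K). K \<inter> T h"])
  show "\<forall>H\<in>sol {0} U (a + c) kap F. (\<lambda>(h, K). K \<inter> T h) (H \<inter> V, csum H V) = H"
    using image_solution(2) by (auto simp: sol_kap[OF ok])
  show "\<forall>p\<in>SIGMA h:sol {0} V a lam (Ef F). sol V U c rho (Fhf F h).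
      ((\<lambda>(h, K). K \<inter> T h) p \<inter> V, csum ((\<lambda>(h, K). K \<inter> T h) p) V) = p"
    using lift_solution(2,3) by (auto simp: sol_lam)
  show "(\<lambda>H. (H \<inter> V, csum H V)) ` sol {0} U (a + c) kap F \<subseteq>
      (SIGMA h:sol {0} V a lam (Ef F). sol V U c rho (Fhf F h))"
    using project_solution image_solution(1) by (auto simp: sol_kap[OF ok] sol_lam)
  show "(\<lambda>(h, K). K \<inter> T h) ` (SIGMA h:sol {0} V a lam (Ef F). sol V U c rho (Fhf F h)) \<subseteq>
      sol {0} U (a + c) kap F"
    using lift_solution(1) by (auto simp: sol_kap[OF ok] sol_lam)
qed

end

section \<open>General flags are in good position\<close>

lemma lin_indep_reindex:
  assumes "inj_on f I"
  shows "lin_indep (f ` I) v \<longleftrightarrow> lin_indep I (v \<circ> f)"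
proof
  assume L: "lin_indep (f ` I) v"
  show "lin_indep I (v \<circ> f)"
  proof (rule lin_indepI)
    fix c l assume c: "\<And>i. (\<Sum>l\<in>I. c l * (v \<circ> f) l i) = 0" and l: "l \<in> I"
    have "(\<Sum>y\<in>f ` I. c (inv_into I f y) * v y i) = 0" for i
      using c[of i] assms by (simp add: sum.reindex)
    from lin_indepD[OF L this, of "f l"] show "c l = 0" using l assms by simp
  qed
next
  assume L: "lin_indep I (v \<circ> f)"
  show "lin_indep (f ` I) v"
  proof (rule lin_indepI)
    fix c l assume c: "\<And>i. (\<Sum>l\<in>f ` I. c l * v l i) = 0" and l: "l \<in> f ` I"
    have "(\<Sum>l\<in>I. (c \<circ> f) l * (v \<circ> f) l i) = 0" for i
      using c[of i] assms by (simp add: sum.reindex)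
    from lin_indepD[OF L this] show "c l = 0" using l by auto
  qed
qed

lemma generic_flag: "generic (\<lambda>x. lin_indep {..<N} (col N x k))"
proof (rule generic_mono[OF generic_independent_columns[of "Pair k ` {..<N}" snd N]])
  fix x assume "lin_indep (Pair k ` {..<N}) (pcol N x)"
  then show "lin_indep {..<N} (col N x k)"
    by (subst (asm) lin_indep_reindex) (auto simp: inj_on_def comp_def)
qed (auto simp: inj_on_def)

lemma lin_indep_disjoint_spans:
  assumes E: "finite E1" "finite E2" "E1 \<inter> E2 = {}" and ind: "lin_indep (E1 \<union> E2) (pcol N x)"
  shows "cv.span (pcol N x ` E1) \<inter> cv.span (pcol N x ` E2) = {0}"
proof -
  have sub: "cv.span (pcol N x ` E) \<subseteq> ambient N" for E
    by (rule cv.span_minimal) (auto simp: col_in_ambient subspace_ambient)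
  have "csum (cv.span (pcol N x ` E1)) (cv.span (pcol N x ` E2)) = cv.span (pcol N x ` (E1 \<union> E2))"
    unfolding csum_def image_Un cv.span_Un cv.span_span ..
  moreover have "cv.dim (cv.span (pcol N x ` (E1 \<union> E2))) = card E1 + card E2"
    using lin_indep_dim[OF _ ind] E by (simp add: card_Un_disjoint)
  moreover have "cv.dim (cv.span (pcol N x ` E1)) = card E1" "cv.dim (cv.span (pcol N x ` E2)) = card E2"
    using E lin_indep_subset[OF ind] by (intro lin_indep_dim; auto)+
  ultimately have "cv.dim (cv.span (pcol N x ` E1) \<inter> cv.span (pcol N x ` E2)) = 0"
    using dim_csum[OF cv.subspace_span cv.subspace_span sub[of E1] sub[of E2]] by simp
  then show ?thesis
    using sub by (intro dim_eq_0[of _ N] cv.subspace_inter cv.subspace_span) auto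
qed

text \<open>Consecutive intervals of lengths \<open>m j\<close>, for \<open>j\<close> in
  \<open>Js\<close> in increasing order, tile an initial segment. They are the windows of the test
  point in \<open>generic_T\<close>.\<close>

lemma interval_cover:
  fixes m :: "nat \<Rightarrow> nat"
  assumes "y < (\<Sum>j\<in>{j \<in> Js. j < n}. m j)"
  shows "\<exists>j\<in>Js. j < n \<and> (\<Sum>i\<in>{i \<in> Js. i < j}. m i) \<le> y \<and> y < (\<Sum>i\<in>{i \<in> Js. i < j}. m i) + m j"
  using assms
proof (induction n)
  case (Suc n)
  have "{j \<in> Js. j < Suc n} = (if n \<in> Js then insert n else id) {j \<in> Js. j < n}"
    by (auto simp: less_Suc_eq)
  then have s: "(\<Sum>j\<in>{j \<in> Js. j < Suc n}. m j) = (\<Sum>j\<in>{j \<in> Js. j < n}. m j) + (if n \<in> Js then m n else 0)"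
    by auto
  show ?case
  proof (cases "y < (\<Sum>j\<in>{j \<in> Js. j < n}. m j)")
    case True
    then show ?thesis using Suc.IH by (meson less_Suc_eq)
  next
    case False
    then have "n \<in> Js" using Suc.prems s by (auto split: if_splits)
    then show ?thesis using False Suc.prems s by (intro bexI[of _ n]) auto
  qed
qed simp

context block_composition
begin

abbreviation "Fx x \<equiv> flags_of {0} (ambient N) unit x"

lemma Fx_pcol: "Fx x k j = cv.span (pcol N x ` (Pair k ` {..<j}))"
  by (simp add: flags_of_std image_image)

lemma flags_ok_Fx:
  assumes "indep_flags N r x"
  shows "flags_ok (Fx x)"
  unfolding flags_ok_def flags_of_std
  using assms dim_flag[of N "col N x k" for k] span_cols_ambient
  by (auto simp: cv.subspace_span intro: cv.span_mono[THEN subsetD, rotated])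

lemma generic_V:
  "generic (\<lambda>x. Fx x 0 (a1 + b2 + c + d) \<inter> Fx x 1 (a2 + b1) = {0})"
  "generic (\<lambda>x. Fx x 0 (a1 + b2) \<inter> Fx x 1 (a2 + b1 + c + d) = {0})"
  "generic (\<lambda>x. \<forall>j<q. Vf (Fx x) \<inter> Fx x (2 + j) (c + d) = {0})"
proof -
  have two: "generic (\<lambda>x. Fx x 0 s \<inter> Fx x 1 t = {0})" if st: "s + t = N" for s t
  proof (rule generic_mono[OF generic_independent_columns[of "Pair 0 ` {..<s} \<union> Pair 1 ` {..<t}"
        "\<lambda>(k, l). if k = 0 then l else s + l" N]])
    fix x assume "lin_indep (Pair 0 ` {..<s} \<union> Pair 1 ` {..<t}) (pcol N x)"
    then show "Fx x 0 s \<inter> Fx x 1 t = {0}"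
      unfolding Fx_pcol by (intro lin_indep_disjoint_spans) auto
  qed (use st in \<open>auto simp: inj_on_def\<close>)
  show "generic (\<lambda>x. Fx x 0 (a1 + b2 + c + d) \<inter> Fx x 1 (a2 + b1) = {0})"
    "generic (\<lambda>x. Fx x 0 (a1 + b2) \<inter> Fx x 1 (a2 + b1 + c + d) = {0})"
    by (rule two; simp add: N_def a_def b_def)+
  have "generic (\<lambda>x. Vf (Fx x) \<inter> Fx x (2 + j) (c + d) = {0})" if "j < q" for j
  proof (rule generic_mono[OF generic_independent_columns[of
        "(Pair 0 ` {..<a1 + b2} \<union> Pair 1 ` {..<a2 + b1}) \<union> Pair (2 + j) ` {..<c + d}"
        "\<lambda>(k, l). if k = 0 then l else if k = 1 then a1 + b2 + l else a + b + l" N]])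
    fix x
    assume ind: "lin_indep ((Pair 0 ` {..<a1 + b2} \<union> Pair 1 ` {..<a2 + b1}) \<union> Pair (2 + j) ` {..<c + d}) (pcol N x)"
    have "Vf (Fx x) = cv.span (pcol N x ` (Pair 0 ` {..<a1 + b2} \<union> Pair 1 ` {..<a2 + b1}))"
      unfolding Vf_def csum_def Fx_pcol image_Un cv.span_Un cv.span_span ..
    then show "Vf (Fx x) \<inter> Fx x (2 + j) (c + d) = {0}"
      unfolding Fx_pcol using ind by (simp only:) (intro lin_indep_disjoint_spans, auto)
  qed (auto simp: inj_on_def N_def a_def b_def split: if_splits)
  then have "generic (\<lambda>x. \<forall>j\<in>{..<q}. Vf (Fx x) \<inter> Fx x (2 + j) (c + d) = {0})"
    by (intro generic_ball) auto
  then show "generic (\<lambda>x. \<forall>j<q. Vf (Fx x) \<inter> Fx x (2 + j) (c + d) = {0})"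
    by (rule generic_mono) auto
qed

text \<open>Of the columns spanning \<open>V\<close>, these \<open>b\<close> ones come before the
  jumps of general solutions of \<open>kap\<close> and of \<open>lamt\<close>; they are to span a
  complement of the solution within \<open>V\<close>.\<close>

definition "VS = Pair (0 :: nat) ` {..<b2} \<union> Pair 1 ` {..<b1}"

lemma VS: "finite VS" "card VS = b"
  by (auto simp: VS_def b_def card_Un_disjoint card_image inj_on_def intro!: card_Un_disjoint[THEN trans])

lemma span_VS: assumes "flags_ok (Fx x)" shows "cv.span (pcol N x ` VS) \<subseteq> Vf (Fx x)"
proof -
  have "pcol N x ` VS \<subseteq> Fx x 0 (a1 + b2) \<union> Fx x 1 (a2 + b1)"
    unfolding VS_def flags_of_std by (auto intro!: cv.span_base)
  also have "\<dots> \<subseteq> Vf (Fx x)" unfolding Vf_def using csum_upper1 csum_upper2 by blast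
  finally show ?thesis unfolding Vf_def by (rule cv.span_minimal[OF _ subspace_csum])
qed

lemma dim_Vf_le:
  assumes ok: "flags_ok F"
  shows "cv.dim (Vf F) \<le> a + b" "cv.subspace (Vf F)" "Vf F \<subseteq> ambient N"
proof -
  have le: "a1 + b2 \<le> N" "a2 + b1 \<le> N" by (auto simp: N_def a_def b_def)
  note D1 = flags_okD[OF ok r_gt(1) le(1)] and D2 = flags_okD[OF ok r_gt(2) le(2)]
  show "cv.dim (Vf F) \<le> a + b"
    using dim_csum[OF D1(1) D2(1) D1(2) D2(2)] D1(3) D2(3) by (simp add: Vf_def a_def b_def)
  show "cv.subspace (Vf F)" "Vf F \<subseteq> ambient N"
    unfolding Vf_def by (rule subspace_csum, rule csum_ambient[OF D1(2) D2(2)])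
qed

lemma kap_nonjump:
  assumes "(k, l) \<in> VS"
  shows "k < r \<and> l < N \<and> l \<notin> schubert_jumps N (a + c) (kap ! k)"
proof -
  have N: "N - (a + c) = b + d" by (simp add: N_def)
  have "l \<noteq> b + d + i - part (kap ! k) i - 1" if i: "1 \<le> i" for i
  proof (cases "k = 0")
    case True
    have "part (kap ! 0) i \<le> b1 + d"
      using rho_part_le[OF r_gt(1), of "i - a1"] by (auto simp: kap_part[OF i])
    then show ?thesis using assms True i by (auto simp: VS_def b_def)
  next
    case False
    then have k: "k = 1" "l < b1" using assms by (auto simp: VS_def)
    have "part (kap ! 1) i \<le> b2 + d"
      using rho_part_le[OF r_gt(2), of "i - a2"] by (subst kap_part(2)[OF i]) auto
    then show ?thesis using k i by (simp add: b_def)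
  qed
  then have "l \<notin> schubert_jumps N (a + c) (kap ! k)"
    unfolding schubert_jumps_def N by (metis (no_types, lifting) atLeastAtMost_iff imageE)
  moreover have "k < r" "l < N" using assms r_gt by (auto simp: VS_def N_def b_def)
  ultimately show ?thesis by blast
qed

text \<open>The span of \<open>VS\<close> is a \<open>b\<close>-dimensional subspace of
  \<open>V\<close> that meets \<open>H\<close> only in 0, which leaves at most \<open>a\<close>
  dimensions for \<open>H \<inter> V\<close>. With empty \<open>L\<close> in a single component,
  transversality says just this.\<close>

lemma generic_A:
  "generic (\<lambda>x. indep_flags N r x \<longrightarrow> (\<forall>H\<in>Hsol (Fx x). cv.dim (H \<inter> Vf (Fx x)) \<le> a))"
proof -
  have "generic (\<lambda>x. indep_flags N r x \<longrightarrow>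
    (\<forall>H\<in>sol {0} (ambient N) (a + c) kap (Fx x).
      transversal N x H {0} (\<lambda>_. {}) VS))"
  proof (rule generic_transversal[where Js = "{0}" and S = VS and L = "\<lambda>_. {}" and
        \<nu> = "\<lambda>(k, l). if k = 0 then a + c + l else a + c + b2 + l"])
    show "a + c \<le> N" by (simp add: N_def)
    show "length kap = r" by (rule length_kap)
    show "in_box (a + c) (N - (a + c)) (kap ! k)" if "k < r" for k
      using kap_box[OF that] by (simp add: N_def)
    show "(a + c) * (N - (a + c)) \<le> sum_list (map sum_list kap)"
      by (simp add: kap_size N_def)
  qed (use VS kap_nonjump in \<open>auto simp: inj_on_def VS_def N_def b_def\<close>)
  then show ?thesis
  proof (rule generic_mono, intro impI ballI)
    fix x H
    assume gen: "indep_flags N r x \<longrightarrow>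
      (\<forall>H\<in>sol {0} (ambient N) (a + c) kap (Fx x).
        transversal N x H {0} (\<lambda>_. {}) VS)"
      and x: "indep_flags N r x" and H: "H \<in> Hsol (Fx x)"
    have ok: "flags_ok (Fx x)" by (rule flags_ok_Fx[OF x])
    have Hs: "cv.subspace H" using H by (simp add: Hsol_def)
    have "H \<in> sol {0} (ambient N) (a + c) kap (Fx x)" using H sol_kap[OF ok] by simp
    with gen x have d: "cv.dim (cv.span (pcol N x ` VS)) = b" and
      z: "cv.span (pcol N x ` VS) \<inter> csum H (cv.span (pcol N x ` {})) \<subseteq> {0}"
      using VS(2) by (auto simp: transversal_def)
    have "H \<inter> Vf (Fx x) \<inter> cv.span (pcol N x ` VS) \<subseteq> {0}"
      using z csum_upper1[of H "cv.span (pcol N x ` {})"] by blast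
    then have "H \<inter> Vf (Fx x) \<inter> cv.span (pcol N x ` VS) = {0}"
      using cv.subspace_0[OF Hs] cv.subspace_0[OF dim_Vf_le(2)[OF ok]] cv.span_zero by blast
    moreover have "cv.dim (H \<inter> Vf (Fx x)) + cv.dim (cv.span (pcol N x ` VS)) \<le>
        cv.dim (H \<inter> Vf (Fx x) \<inter> cv.span (pcol N x ` VS)) + cv.dim (Vf (Fx x))"
      using Hs dim_Vf_le[OF ok] span_VS[OF ok]
      by (intro dim_int_ge[of _ _ _ N] cv.subspace_inter cv.subspace_span) auto
    ultimately show "cv.dim (H \<inter> Vf (Fx x)) \<le> a"
      using d dim_Vf_le(1)[OF ok] by (simp add: dim_zero)
  qed
qed

end

section \<open>Transversality along the solutions of the base problem\<close>

context block_composition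
begin

text \<open>The jumps of a general solution of \<open>lamt\<close> before column
  \<open>sh k + c + d\<close>; only flags 0 and 1 have any.\<close>

definition "jr k = (if k = 0 then {b2..<b2 + a1} else if k = 1 then {b1..<b1 + a2} else {})"

lemma jr: "finite (jr k)" "card (jr k) = u k" "jr k \<subseteq> {..<sh k}"
  by (auto simp: jr_def u_def sh_def b_def)

lemma card_nonjr: "sh k \<le> n \<Longrightarrow> card ({..<n} - jr k) = n - u k"
  using jr[of k] by (subst card_Diff_subset) auto

lemma lamt_nonjump:
  assumes k: "k < r" and l: "l < sh k + c + d" "l \<notin> jr k"
  shows "l < N \<and> l \<notin> schubert_jumps N a (lamt ! k)"
proof -
  have N: "N - a = b + c + d" by (simp add: N_def)
  have "l \<noteq> b + c + d + i - part (lamt ! k) i - 1" if i: "1 \<le> i" for i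
    using k
  proof (cases rule: flag_cases)
    case 1
    then show ?thesis using l i by (auto simp: lamt_part[OF i] jr_def sh_def b_def)
  next
    case 2
    have "part (lamt ! k) i = (if i \<le> a2 then b2 + c + d else 0)" unfolding 2 by (rule lamt_part(2)[OF i])
    then show ?thesis using l i 2 by (auto simp: jr_def sh_def b_def)
  next
    case (3 j)
    have "part (lamt ! k) i = (if i \<le> e' j then m j else 0)" unfolding 3(2) by (rule lamt_part(3)[OF i 3(1)])
    then show ?thesis using l i 3 m_le[OF 3(1)] by (auto simp: sh_def)
  next
    case (4 j)
    have "part (lamt ! k) i = 0" unfolding 4(2) by (rule lamt_part(4)[OF i 4(1)])
    then show ?thesis using l i 4 by (auto simp: sh_def)
  qed
  then have "l \<notin> schubert_jumps N a (lamt ! k)"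
    unfolding schubert_jumps_def N by (metis (no_types, lifting) atLeastAtMost_iff imageE)
  moreover have "l < N" using l(1) sh_le[of k] by simp
  ultimately show ?thesis by blast
qed

lemma lamt_generic:
  fixes Js :: "nat set"
  assumes fin: "finite Js" "finite S" "\<And>j. j \<in> Js \<Longrightarrow> finite (L j)"
    and nonjump: "\<And>k l. (k, l) \<in> S \<union> (\<Union>j\<in>Js. L j) \<Longrightarrow> k < r \<and> l < sh k + c + d \<and> l \<notin> jr k"
    and \<nu>: "inj_on \<nu> S" "\<And>j. j \<in> Js \<Longrightarrow> inj_on \<nu> (L j)"
      "\<And>e. e \<in> S \<union> (\<Union>j\<in>Js. L j) \<Longrightarrow> a \<le> \<nu> e \<and> \<nu> e < N"
      "\<And>e. e \<in> S \<Longrightarrow> \<exists>j\<in>Js. \<nu> e \<notin> \<nu> ` L j"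
  shows "generic (\<lambda>x. indep_flags N r x \<longrightarrow>
    (\<forall>h\<in>hsol (Fx x). transversal N x h Js L S))"
proof -
  have aN: "a \<le> N" by (simp add: N_def)
  have "generic (\<lambda>x. indep_flags N r x \<longrightarrow>
    (\<forall>h\<in>sol {0} (ambient N) a lamt (Fx x). transversal N x h Js L S))"
  proof (rule generic_transversal[where \<nu> = \<nu>, OF aN length_lamt lamt_box])
    show "a * (N - a) \<le> sum_list (map sum_list lamt)" by (simp add: lamt_size)
    show "k < r \<and> l < N \<and> l \<notin> schubert_jumps N a (lamt ! k)" if "(k, l) \<in> S \<union> (\<Union>j\<in>Js. L j)" for k l
      using nonjump[OF that] lamt_nonjump by blast
  qed (use fin \<nu> in blast)+
  then show ?thesis
  proof (rule generic_mono, intro impI)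
    fix x assume gen: "indep_flags N r x \<longrightarrow>
      (\<forall>h\<in>sol {0} (ambient N) a lamt (Fx x). transversal N x h Js L S)"
      and x: "indep_flags N r x"
    have "hsol (Fx x) = sol {0} (ambient N) a lamt (Fx x)"
      using sol_lamt[OF flags_ok_Fx[OF x]] by blast
    with gen x show "\<forall>h\<in>hsol (Fx x). transversal N x h Js L S" by simp
  qed
qed

text \<open>The \<open>sh k + c + d - u k\<close> columns of the step outside \<open>jr k\<close>
  are independent modulo \<open>h\<close>, so at most \<open>u k\<close> dimensions of the step can
  fall into \<open>h\<close>.\<close>

lemma generic_cell:
  assumes k: "k < r"
  shows "generic (\<lambda>x. indep_flags N r x \<longrightarrow>
    (\<forall>h\<in>hsol (Fx x). cv.dim (h \<inter> Fx x k (sh k + c + d)) \<le> u k))"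
proof -
  let ?n = "sh k + c + d"
  define L where "L = Pair k ` ({..<?n} - jr k)"
  define st where "st = (if k = 0 then b2 else b1)"
  have cL: "card L = ?n - u k" unfolding L_def by (subst card_image) (auto simp: card_nonjr inj_on_def)
  have uk: "u k \<le> ?n" using card_mono[OF _ jr(3), of k] jr(2)[of k] by simp
  have nN: "?n \<le> N - a + u k"
    using assms by (cases rule: flag_cases) (auto simp: sh_def u_def N_def a_def b_def)
  have jr': "l \<notin> jr k \<longleftrightarrow> l < st \<or> st + u k \<le> l" for l
    by (auto simp: jr_def st_def u_def)
  have stb: "st \<le> b" by (auto simp: st_def b_def)
  have "generic (\<lambda>x. indep_flags N r x \<longrightarrow>
    (\<forall>h\<in>hsol (Fx x). transversal N x h {0} (\<lambda>_. L) {}))"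
  \<comment> \<open>\<open>\<nu>\<close> closes the gap left by the \<open>u k\<close> jump columns,
    so that the others fit into the \<open>N - a\<close> positions from \<open>a\<close> on.\<close>
  proof (rule lamt_generic[where L = "\<lambda>_. L" and \<nu> = "\<lambda>p. a + (if snd p < st then snd p else snd p - u k)"])
    show "inj_on (\<lambda>p. a + (if snd p < st then snd p else snd p - u k)) L"
      unfolding L_def inj_on_def using jr' by (auto split: if_splits)
    fix p assume "p \<in> {} \<union> (\<Union>j\<in>{0::nat}. L)"
    then show "a \<le> a + (if snd p < st then snd p else snd p - u k) \<and> a + (if snd p < st then snd p else snd p - u k) < N"
      using nN jr' stb unfolding L_def by (auto simp: N_def)
  qed (use k in \<open>auto simp: L_def\<close>)
  then show ?thesis
  proof (rule generic_mono, intro impI ballI)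
    fix x h
    assume gen: "indep_flags N r x \<longrightarrow>
    (\<forall>h\<in>hsol (Fx x). transversal N x h {0} (\<lambda>_. L) {})"
      and x: "indep_flags N r x" and h: "h \<in> hsol (Fx x)"
    have ok: "flags_ok (Fx x)" by (rule flags_ok_Fx[OF x])
    have hs: "cv.subspace h" "h \<subseteq> ambient N" "cv.dim h = a" using h by (auto simp: hsol_def)
    let ?L = "cv.span (pcol N x ` L)"
    have d: "cv.dim (csum h ?L) = a + card L"
      using gen x h hs(3) by (simp add: transversal_def)
    have LF: "?L \<subseteq> Fx x k ?n"
      unfolding Fx_pcol L_def by (intro cv.span_mono) auto
    note Fn = flags_okD[OF ok k sh_le[of k]]
    have "csum h ?L \<subseteq> csum h (Fx x k ?n)" by (rule csum_mono[OF order_refl LF])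
    then have "a + card L \<le> cv.dim (csum h (Fx x k ?n))"
      using dim_mono[OF subspace_csum subspace_csum, of h ?L h "Fx x k ?n" N] d csum_ambient[OF hs(2) Fn(2)] by simp
    then show "cv.dim (h \<inter> Fx x k ?n) \<le> u k"
      using dim_csum[OF hs(1) Fn(1) hs(2) Fn(2)] hs(3) Fn(3) cL uk by simp
  qed
qed

text \<open>Steps of dimension \<open>N - a - m j\<close> stand in for \<open>G_j\<close>, whose
  further columns may be jumps of \<open>h\<close>. In the test, \<open>N - a\<close> coordinates
  remain modulo \<open>h\<close>: the columns of flag \<open>2 + j\<close> take all but a window of
  length \<open>m j\<close>, the windows for different \<open>j\<close> are consecutive, and the
  columns of \<open>S\<close>, as many as all windows together, fill them. Columns of
  \<open>S\<close> must come from other flags, as a column has only one value.\<close>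

lemma generic_T:
  assumes Js: "Js \<subseteq> {..<q}" and S: "finite S" "card S = (\<Sum>j\<in>Js. m j)"
    and nonjump: "\<And>k l. (k, l) \<in> S \<Longrightarrow> k < r \<and> l < sh k + c + d \<and> l \<notin> jr k \<and> (\<forall>j\<in>Js. k \<noteq> 2 + j)"
  shows "generic (\<lambda>x. indep_flags N r x \<longrightarrow>
    (\<forall>h\<in>hsol (Fx x). cv.dim (cv.span (pcol N x ` S)) = card S \<and>
      cv.span (pcol N x ` S) \<inter> (\<Inter>j\<in>Js. csum h (Fx x (2 + j) (N - a - m j))) \<subseteq> {0}))"
proof -
  define L where "L j = Pair (2 + j) ` {..<N - a - m j}" for j
  obtain idx where idx: "bij_betw idx S {..<card S}"
    using ex_bij_betw_finite_nat[OF S(1)] by (auto simp: lessThan_atLeast0)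
  define o' where "o' j = (\<Sum>i\<in>{i \<in> Js. i < j}. m i)" for j
  \<comment> \<open>The window of flag \<open>2 + j\<close> starts at \<open>o' j\<close>; its later
    columns skip over it. \<open>fst p - 2\<close> recovers \<open>j\<close>.\<close>
  define \<nu> where "\<nu> p = a + (if p \<in> S then idx p else if snd p < o' (fst p - 2) then snd p else snd p + m (fst p - 2))" for p
  have finJ: "finite Js" using Js finite_subset by blast
  have LS: "p \<notin> S" if "p \<in> L j" "j \<in> Js" for p j using that nonjump by (auto simp: L_def)
  have sumle: "(\<Sum>j\<in>Js. m j) \<le> b" using sum_mono2[OF finite_lessThan Js, of m] sum_m by simp
  have mb: "m j \<le> b" if "j \<in> Js" for j using m_le that Js by auto
  have \<nu>L: "\<nu> (2 + j, l) = a + (if l < o' j then l else l + m j)" if "j \<in> Js" "l < N - a - m j" for j l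
    using LS[of "(2 + j, l)" j] that by (auto simp: L_def \<nu>_def)
  have "generic (\<lambda>x. indep_flags N r x \<longrightarrow>
    (\<forall>h\<in>hsol (Fx x). transversal N x h Js L S))"
  proof (rule lamt_generic[OF finJ S(1), where \<nu> = \<nu>])
    show "finite (L j)" for j by (simp add: L_def)
    show "inj_on \<nu> S"
      using idx by (auto simp: inj_on_def \<nu>_def bij_betw_def)
    show "inj_on \<nu> (L j)" if "j \<in> Js" for j
    proof (rule inj_onI)
      fix p p' assume "p \<in> L j" "p' \<in> L j" "\<nu> p = \<nu> p'"
      then obtain l l' where "p = (2 + j, l)" "p' = (2 + j, l')" "l < N - a - m j" "l' < N - a - m j"
        by (auto simp: L_def)
      then show "p = p'" using \<open>\<nu> p = \<nu> p'\<close> \<nu>L[OF that] by (auto split: if_splits)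
    qed
    show "k < r \<and> l < sh k + c + d \<and> l \<notin> jr k" if kl: "(k, l) \<in> S \<union> (\<Union>j\<in>Js. L j)" for k l
    proof (cases "(k, l) \<in> S")
      case True
      then show ?thesis using nonjump by blast
    next
      case False
      then obtain j where j: "j \<in> Js" "k = 2 + j" "l < N - a - m j" using kl by (auto simp: L_def)
      then have "j < q" using Js by auto
      then show ?thesis using j r_gt(3)[of j] mb[OF j(1)] by (auto simp: sh_def jr_def N_def)
    qed
    show "a \<le> \<nu> p \<and> \<nu> p < N" if p: "p \<in> S \<union> (\<Union>j\<in>Js. L j)" for p
    proof (cases "p \<in> S")
      case True
      then have "idx p < card S" using idx by (auto simp: bij_betw_def)
      then show ?thesis using True S(2) sumle by (auto simp: \<nu>_def N_def)
    next
      case False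
      then obtain j l where "j \<in> Js" "p = (2 + j, l)" "l < N - a - m j" using p by (auto simp: L_def)
      then show ?thesis using \<nu>L[of j l] by auto
    qed
    show "\<exists>j\<in>Js. \<nu> p \<notin> \<nu> ` L j" if p: "p \<in> S" for p
    proof -
      have "idx p < card S" using p idx by (auto simp: bij_betw_def)
      moreover have "{j \<in> Js. j < q} = Js" using Js by auto
      ultimately obtain j where j: "j \<in> Js" "o' j \<le> idx p" "idx p < o' j + m j"
        using interval_cover[where y = "idx p" and Js = Js and n = q and m = m] S(2) by (auto simp: o'_def)
      have "\<nu> p = a + idx p" using p by (simp add: \<nu>_def)
      moreover have "\<nu> p' \<noteq> a + idx p" if "p' \<in> L j" for p'
      proof -
        obtain l where "p' = (2 + j, l)" "l < N - a - m j" using \<open>p' \<in> L j\<close> by (auto simp: L_def)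
        then show ?thesis using \<nu>L[OF j(1)] j by auto
      qed
      ultimately show ?thesis using j(1) by force
    qed
  qed
  then show ?thesis
    unfolding Fx_pcol L_def transversal_def by (rule generic_mono) blast
qed

lemma dim_int_bound:
  assumes "cv.subspace T" "cv.subspace W" "W \<subseteq> ambient n" "cv.subspace X" "X \<subseteq> W" "X \<inter> T \<subseteq> {0}"
  shows "cv.dim (T \<inter> W) + cv.dim X \<le> cv.dim W"
proof -
  have "T \<inter> W \<inter> X = {0}"
    using assms cv.subspace_0[of T] cv.subspace_0[of W] cv.subspace_0[of X] by blast
  then show ?thesis
    using dim_int_ge[of "T \<inter> W" X W n] assms by (auto simp: cv.subspace_inter dim_zero)
qed

text \<open>\<open>T h\<close> meets \<open>V\<close> and \<open>F k (sh k)\<close> in small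
  dimension because it misses the span of chosen columns there: \<open>VS\<close> in
  \<open>V\<close>, and \<open>Sk k\<close> in the step.\<close>

lemma generic_good: "generic (\<lambda>x. good (Fx x))"
proof -
  define Sk where "Sk k = Pair k ` ({..<sh k} - jr k)" for k
  \<comment> \<open>For \<open>k = 2 + j\<close> the sum \<open>h + G_j\<close> is left out: it
    contains the step \<open>sh k\<close> itself. The remaining codimensions add up to
    \<open>b - m j\<close>, the number of columns in \<open>Sk k\<close>.\<close>
  define Jk where "Jk k = {j. j < q \<and> k \<noteq> 2 + j}" for k
  have cSk: "card (Sk k) = sh k - u k" for k
    unfolding Sk_def by (subst card_image) (auto simp: card_nonjr inj_on_def)
  have sumJk: "(\<Sum>j\<in>Jk k. m j) = sh k - u k" if "k < r" for k
    using that
  proof (cases rule: flag_cases)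
    case (3 j)
    have "Jk k = {..<q} - {j}" using 3 by (auto simp: Jk_def)
    then show ?thesis using 3 sum_m sum.remove[of "{..<q}" j m] by (simp add: sh_def u_def)
  next
    case 1
    then have "Jk k = {..<q}" by (auto simp: Jk_def)
    then show ?thesis using 1 sum_m by (simp add: sh_def u_def)
  next
    case 2
    then have "Jk k = {..<q}" by (auto simp: Jk_def)
    then show ?thesis using 2 sum_m by (simp add: sh_def u_def)
  next
    case (4 j)
    then have "Jk k = {..<q}" by (auto simp: Jk_def)
    then show ?thesis using 4 sum_m by (simp add: sh_def u_def)
  qed
  have uk: "u k \<le> sh k" for k using card_mono[OF _ jr(3), of k] jr(2)[of k] by simp
  have g1: "generic (\<lambda>x. \<forall>k\<in>{..<r}. lin_indep {..<N} (col N x k))"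
    by (intro generic_ball generic_flag) auto
  have g2: "generic (\<lambda>x. \<forall>k\<in>{..<r}. indep_flags N r x \<longrightarrow> (\<forall>h\<in>hsol (Fx x). cv.dim (h \<inter> Fx x k (sh k + c + d)) \<le> u k))"
    by (intro generic_ball generic_cell) auto
  have g3: "generic (\<lambda>x. \<forall>k\<in>{..<r}. indep_flags N r x \<longrightarrow> (\<forall>h\<in>hsol (Fx x).
      cv.dim (cv.span (pcol N x ` Sk k)) = card (Sk k) \<and>
      cv.span (pcol N x ` Sk k) \<inter> (\<Inter>j\<in>Jk k. csum h (Fx x (2 + j) (N - a - m j))) \<subseteq> {0}))"
  proof (intro generic_ball generic_T)
    fix k assume "k \<in> {..<r}"
    then show "card (Sk k) = (\<Sum>j\<in>Jk k. m j)" using cSk sumJk by simp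
    fix k' l assume "(k', l) \<in> Sk k"
    then show "k' < r \<and> l < sh k' + c + d \<and> l \<notin> jr k' \<and> (\<forall>j\<in>Jk k. k' \<noteq> 2 + j)"
      using \<open>k \<in> {..<r}\<close> by (auto simp: Sk_def Jk_def)
  qed (auto simp: Jk_def Sk_def)
  have g4: "generic (\<lambda>x. indep_flags N r x \<longrightarrow> (\<forall>h\<in>hsol (Fx x).
      cv.dim (cv.span (pcol N x ` VS)) = card VS \<and>
      cv.span (pcol N x ` VS) \<inter> (\<Inter>j\<in>{..<q}. csum h (Fx x (2 + j) (N - a - m j))) \<subseteq> {0}))"
  proof (intro generic_T)
    show "card VS = (\<Sum>j<q. m j)" using VS(2) sum_m by simp
    fix k l assume "(k, l) \<in> VS"
    then show "k < r \<and> l < sh k + c + d \<and> l \<notin> jr k \<and> (\<forall>j\<in>{..<q}. k \<noteq> 2 + j)"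
      using r_gt by (auto simp: VS_def sh_def jr_def b_def)
  qed (auto simp: VS(1))
  have "generic (\<lambda>x. ((((((\<forall>k\<in>{..<r}. lin_indep {..<N} (col N x k)) \<and>
      (\<forall>k\<in>{..<r}. indep_flags N r x \<longrightarrow> (\<forall>h\<in>hsol (Fx x). cv.dim (h \<inter> Fx x k (sh k + c + d)) \<le> u k))) \<and>
      (\<forall>k\<in>{..<r}. indep_flags N r x \<longrightarrow> (\<forall>h\<in>hsol (Fx x). cv.dim (cv.span (pcol N x ` Sk k)) = card (Sk k) \<and>
        cv.span (pcol N x ` Sk k) \<inter> (\<Inter>j\<in>Jk k. csum h (Fx x (2 + j) (N - a - m j))) \<subseteq> {0}))) \<and>
      (indep_flags N r x \<longrightarrow> (\<forall>h\<in>hsol (Fx x). cv.dim (cv.span (pcol N x ` VS)) = card VS \<and>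
        cv.span (pcol N x ` VS) \<inter> (\<Inter>j\<in>{..<q}. csum h (Fx x (2 + j) (N - a - m j))) \<subseteq> {0}))) \<and>
      (indep_flags N r x \<longrightarrow> (\<forall>H\<in>Hsol (Fx x). cv.dim (H \<inter> Vf (Fx x)) \<le> a))) \<and>
      (\<forall>j<q. Vf (Fx x) \<inter> Fx x (2 + j) (c + d) = {0})) \<and>
      (Fx x 0 (a1 + b2 + c + d) \<inter> Fx x 1 (a2 + b1) = {0} \<and> Fx x 0 (a1 + b2) \<inter> Fx x 1 (a2 + b1 + c + d) = {0}))"
    by (intro generic_conj g1 g2 g3 g4 generic_A generic_V)
  then show ?thesis
  proof (rule generic_mono, elim conjE)
    fix x
    assume "\<forall>k\<in>{..<r}. lin_indep {..<N} (col N x k)"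
      and 2: "\<forall>k\<in>{..<r}. indep_flags N r x \<longrightarrow> (\<forall>h\<in>hsol (Fx x). cv.dim (h \<inter> Fx x k (sh k + c + d)) \<le> u k)"
      and 3: "\<forall>k\<in>{..<r}. indep_flags N r x \<longrightarrow> (\<forall>h\<in>hsol (Fx x). cv.dim (cv.span (pcol N x ` Sk k)) = card (Sk k) \<and>
        cv.span (pcol N x ` Sk k) \<inter> (\<Inter>j\<in>Jk k. csum h (Fx x (2 + j) (N - a - m j))) \<subseteq> {0})"
      and 4: "indep_flags N r x \<longrightarrow> (\<forall>h\<in>hsol (Fx x). cv.dim (cv.span (pcol N x ` VS)) = card VS \<and>
        cv.span (pcol N x ` VS) \<inter> (\<Inter>j\<in>{..<q}. csum h (Fx x (2 + j) (N - a - m j))) \<subseteq> {0})"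
      and 5: "indep_flags N r x \<longrightarrow> (\<forall>H\<in>Hsol (Fx x). cv.dim (H \<inter> Vf (Fx x)) \<le> a)"
      and 6: "\<forall>j<q. Vf (Fx x) \<inter> Fx x (2 + j) (c + d) = {0}"
      and 7: "Fx x 0 (a1 + b2 + c + d) \<inter> Fx x 1 (a2 + b1) = {0}" "Fx x 0 (a1 + b2) \<inter> Fx x 1 (a2 + b1 + c + d) = {0}"
    then have ind: "indep_flags N r x" by blast
    have ok: "flags_ok (Fx x)" by (rule flags_ok_Fx[OF ind])
    have hc: "(\<forall>j<q. cv.dim (h \<inter> Gf (Fx x) j) \<le> e' j) \<and>
       (\<forall>k<r. cv.dim (h \<inter> Fx x k (sh k + c + d)) \<le> u k) \<and>
       cv.dim (Tf (Fx x) h \<inter> Vf (Fx x)) \<le> a \<and> (\<forall>k<r. cv.dim (Tf (Fx x) h \<inter> Fx x k (sh k)) \<le> u k)"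
      if h: "h \<in> hsol (Fx x)" for h
    proof -
      have hs: "cv.subspace h" "h \<subseteq> ambient N" "cv.dim h = a" using h by (auto simp: hsol_def)
      have cell: "cv.dim (h \<inter> Fx x k (sh k + c + d)) \<le> u k" if "k < r" for k using 2 ind h that by blast
      have shj: "sh (2 + j) + c + d = N - a - m j" if "j < q" for j
        using m_le[OF that] that by (simp add: sh_def N_def)
      have disj: "cv.dim (h \<inter> Fx x (2 + j) (N - a - m j)) = 0" if "j < q" for j
        using cell[OF r_gt(3)[OF that]] unfolding shj[OF that] by (simp add: u_def)
      have Gd: "N - e j - m j = N - a - m j + e' j" if "j < q" for j
        using e_add[of j] m_le[OF that] by (simp add: N_def)
      have Q1: "cv.dim (h \<inter> Gf (Fx x) j) \<le> e' j" if "j < q" for j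
      proof -
        have "cv.dim (h \<inter> Fx x (2 + j) (N - e j - m j)) + (N - a - m j) \<le>
            cv.dim (h \<inter> Fx x (2 + j) (N - a - m j)) + (N - e j - m j)"
          using Gd[OF that] by (intro flags_ok_drop[OF ok r_gt(3)[OF that] _ _ hs(1)]) auto
        then show ?thesis using disj[OF that] Gd[OF that] by (simp add: Gf_def)
      qed
      \<comment> \<open>The shorter step meets \<open>h\<close> only in 0, while \<open>G_j\<close>
        overlaps \<open>h\<close> in at least \<open>e' j\<close> dimensions, just its excess over
        the shorter step.\<close>
      have W: "csum h (Fx x (2 + j) (N - a - m j)) = csum h (Gf (Fx x) j)" if j: "j < q" for j
      proof (rule subspace_eqI[of _ _ N])
        have le: "N - e j - m j \<le> N" "N - a - m j \<le> N" by auto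
        note F1 = flags_okD[OF ok r_gt(3)[OF j] le(1), folded Gf_def] and F2 = flags_okD[OF ok r_gt(3)[OF j] le(2)]
        show "csum h (Fx x (2 + j) (N - a - m j)) \<subseteq> csum h (Gf (Fx x) j)"
          using F1(4)[of "N - a - m j"] Gd[OF j] by (intro csum_mono) auto
        show "csum h (Gf (Fx x) j) \<subseteq> ambient N" by (rule csum_ambient[OF hs(2) F1(2)])
        have "e' j \<le> cv.dim (h \<inter> Gf (Fx x) j)" using h j by (auto simp: hsol_def)
        then show "cv.dim (csum h (Gf (Fx x) j)) \<le> cv.dim (csum h (Fx x (2 + j) (N - a - m j)))"
          using dim_csum[OF hs(1) F1(1) hs(2) F1(2)] dim_csum[OF hs(1) F2(1) hs(2) F2(2)] F1(3) F2(3)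
            disj[OF j] Gd[OF j] by linarith
      qed (rule subspace_csum)+
      have Tsub: "Tf (Fx x) h \<subseteq> (\<Inter>j\<in>J. csum h (Fx x (2 + j) (N - a - m j)))" if "J \<subseteq> {..<q}" for J
        using that W by (fastforce simp: Tf_def)
      have Ts: "cv.subspace (Tf (Fx x) h)"
        unfolding Tf_def cv.subspace_def using cv.subspace_0[OF subspace_csum]
          cv.subspace_add[OF subspace_csum] cv.subspace_scale[OF subspace_csum]
          cv.subspace_0[OF subspace_ambient] cv.subspace_add[OF subspace_ambient] cv.subspace_scale[OF subspace_ambient]
        by auto
      have "cv.dim (Tf (Fx x) h \<inter> Vf (Fx x)) + cv.dim (cv.span (pcol N x ` VS)) \<le> cv.dim (Vf (Fx x))"
        using 4 ind h Tsub[of "{..<q}"]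
        by (intro dim_int_bound[OF Ts dim_Vf_le(2,3)[OF ok] cv.subspace_span span_VS[OF ok]]) blast
      then have Q3: "cv.dim (Tf (Fx x) h \<inter> Vf (Fx x)) \<le> a"
        using 4 ind h VS(2) dim_Vf_le(1)[OF ok] by fastforce
      have Q4: "cv.dim (Tf (Fx x) h \<inter> Fx x k (sh k)) \<le> u k" if k: "k < r" for k
      proof -
        have le: "sh k \<le> N" using sh_le[of k] by simp
        note Fk = flags_okD[OF ok k le]
        have sub: "cv.span (pcol N x ` Sk k) \<subseteq> Fx x k (sh k)"
          unfolding Fx_pcol Sk_def by (intro cv.span_mono) auto
        have S: "cv.dim (cv.span (pcol N x ` Sk k)) = card (Sk k)"
          "cv.span (pcol N x ` Sk k) \<inter> (\<Inter>j\<in>Jk k. csum h (Fx x (2 + j) (N - a - m j))) \<subseteq> {0}"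
          using 3 ind h k by blast+
        have "cv.dim (Tf (Fx x) h \<inter> Fx x k (sh k)) + cv.dim (cv.span (pcol N x ` Sk k)) \<le> cv.dim (Fx x k (sh k))"
        proof (rule dim_int_bound[OF Ts Fk(1,2) cv.subspace_span sub])
          have "Jk k \<subseteq> {..<q}" by (auto simp: Jk_def)
          then show "cv.span (pcol N x ` Sk k) \<inter> Tf (Fx x) h \<subseteq> {0}" using S(2) Tsub by blast
        qed
        then show ?thesis using S(1) cSk[of k] uk[of k] Fk(3) by simp
      qed
      show ?thesis using Q1 cell Q3 Q4 by blast
    qed
    show "good (Fx x)"
      unfolding good_def by (intro conjI ok 7 6 mp[OF 5 ind] ballI hc)
  qed
qed

end

section \<open>Moving each flag by its own linear map\<close>

lemma lin_indep_if_dim: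
  assumes "cv.dim (cv.span (v ` {..<n})) = n"
  shows "lin_indep {..<n} v"
proof (rule lin_indepI, rule ccontr)
  fix c l assume c: "\<And>i. (\<Sum>k<n. c k * v k i) = 0" and l: "l \<in> {..<n}" "c l \<noteq> 0"
  let ?S = "cv.span (v ` ({..<n} - {l}))"
  have "v l = (\<Sum>k\<in>{..<n} - {l}. cscale (- c k / c l) (v k))"
  proof
    fix i
    have "c l * v l i + (\<Sum>k\<in>{..<n} - {l}. c k * v k i) = 0"
      using c[of i] l(1) by (simp add: sum.remove)
    then have "v l i = - (\<Sum>k\<in>{..<n} - {l}. c k * v k i) / c l"
      using l(2) by (simp add: field_simps add_eq_0_iff2)
    then show "v l i = (\<Sum>k\<in>{..<n} - {l}. cscale (- c k / c l) (v k)) i"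
      unfolding sum_cscale_apply by (simp add: sum_divide_distrib sum_negf)
  qed
  also have "\<dots> \<in> ?S"
    by (intro cv.span_sum cv.span_scale cv.span_base) auto
  finally have "v l \<in> ?S" .
  then have "v ` {..<n} \<subseteq> ?S" by (auto intro: cv.span_base)
  then have "cv.span (v ` {..<n}) \<subseteq> ?S" by (rule cv.span_minimal[OF _ cv.subspace_span])
  then have "cv.dim (cv.span (v ` {..<n})) \<le> card (v ` ({..<n} - {l}))"
    by (intro cv.dim_le_card) auto
  also have "\<dots> \<le> n - 1" using card_image_le[of "{..<n} - {l}" v] l(1) by simp
  finally show False using assms l(1) by auto
qed

lemma adapted_basis:
  assumes L: "\<And>j. j \<le> n \<Longrightarrow> cv.subspace (L j) \<and> L j \<subseteq> ambient N \<and> cv.dim (L j) = j"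
    and mono: "\<And>j. j < n \<Longrightarrow> L j \<subseteq> L (Suc j)"
  shows "\<exists>v. \<forall>j\<le>n. cv.span (v ` {..<j}) = L j"
proof -
  have "\<exists>w. w \<in> L (Suc j) \<and> w \<notin> L j" if "j < n" for j
  proof (rule ccontr)
    assume "\<nexists>w. w \<in> L (Suc j) \<and> w \<notin> L j"
    then have "L (Suc j) = L j" using mono[OF that] by blast
    then show False using L[of j] L[of "Suc j"] that by simp
  qed
  then obtain v where v: "\<And>j. j < n \<Longrightarrow> v j \<in> L (Suc j) \<and> v j \<notin> L j" by metis
  have "j \<le> n \<Longrightarrow> cv.span (v ` {..<j}) = L j" for j
  proof (induction j)
    case 0
    then show ?case using dim_eq_0[of "L 0" N] L[of 0] by simp
  next
    case (Suc j)
    let ?X = "cv.span (v ` {..<Suc j})"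
    have jn: "j < n" using Suc.prems by simp
    have IH: "cv.span (v ` {..<j}) = L j" using Suc by simp
    have "L j \<subseteq> ?X" unfolding IH[symmetric] by (rule cv.span_mono) auto
    moreover have "v j \<in> ?X" by (rule cv.span_base) simp
    ultimately have ne: "L j \<subseteq> ?X" "L j \<noteq> ?X" using v[OF jn] by auto
    have XL: "?X \<subseteq> L (Suc j)"
    proof (rule cv.span_minimal)
      have "v ` {..<j} \<subseteq> L j" unfolding IH[symmetric] by (rule cv.span_superset)
      then show "v ` {..<Suc j} \<subseteq> L (Suc j)"
        using v[OF jn] mono[OF jn] unfolding lessThan_Suc image_insert by blast
    qed (use L Suc.prems in blast)
    have LU: "L (Suc j) \<subseteq> ambient N" using L Suc.prems by blast
    have "\<not> cv.dim ?X \<le> cv.dim (L j)"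
      using subspace_eqI[of "L j" ?X N] ne L[of j] jn XL LU cv.subspace_span by auto
    then have "cv.dim (L (Suc j)) \<le> cv.dim ?X" using L[of j] L[of "Suc j"] jn by simp
    then show ?case
      using subspace_eqI[OF cv.subspace_span _ XL LU] L[of "Suc j"] Suc.prems by blast
  qed
  then show ?thesis by blast
qed

interpretation cvp: vector_space_pair cscale cscale
  by unfold_locales

lemma linear_span_image: "Vector_Spaces.linear cscale cscale g \<Longrightarrow> g ` cv.span S = cv.span (g ` S)"
  using module_hom.span_image[of cscale cscale g S] by (simp add: module_hom_iff_linear)

lemma linear_csum: "Vector_Spaces.linear cscale cscale g \<Longrightarrow> g ` csum A B = csum (g ` A) (g ` B)"
  unfolding csum_def by (simp add: linear_span_image image_Un)

lemma linear_fixing_on_span: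
  assumes "Vector_Spaces.linear cscale cscale g" "\<And>v. v \<in> X \<Longrightarrow> g v = v" "v \<in> cv.span X"
  shows "g v = v"
  using cvp.linear_eq_on[OF assms(1) cv.linear_ident assms(3)] assms(2) by simp

lemma linear_sum_scale:
  "Vector_Spaces.linear cscale cscale g \<Longrightarrow> g (\<Sum>l\<in>I. cscale (c l) (v l)) = (\<Sum>l\<in>I. cscale (c l) (g (v l)))"
  by (simp add: cvp.linear_sum cvp.linear_scale)

text \<open>Flags of \<open>Y\<close> with coordinates \<open>y\<close> in the frame
  \<open>w\<close> are reached by moving the \<open>k\<close>-th flag with its own map, the identity
  on \<open>X\<close>. The new columns depend polynomially on \<open>y\<close>, so a polynomial on
  ambient flags pulls back to one in \<open>y\<close>; if it is nonzero at \<open>x0\<close>, the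
  pullback is nonzero at \<open>y0\<close>. For special \<open>y\<close> the map may be
  singular.\<close>

lemma twist:
  assumes X: "cv.subspace X" "X \<subseteq> ambient N" and Y: "cv.subspace Y" "Y \<subseteq> ambient N" "cv.dim Y = n"
    and XY: "X \<inter> Y = {0}" "csum X Y = ambient N"
    and w: "cv.span (w ` {..<n}) = Y" and \<epsilon>: "\<And>k. k < K \<Longrightarrow> cv.span (\<epsilon> k ` {..<n}) = Y"
  shows "\<exists>\<Phi> y0. (\<forall>i. (\<lambda>y. \<Phi> y i) \<in> cpoly) \<and> \<Phi> y0 = x0 \<and>
    (\<forall>y k. k < K \<longrightarrow> (\<exists>g. Vector_Spaces.linear cscale cscale g \<and> (\<forall>v\<in>X. g v = v) \<and>
       (\<forall>l<n. g (\<epsilon> k l) = (\<Sum>i<n. cscale (y ((k * n + l) * n + i)) (w i))) \<and>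
       (\<forall>l<N. col N (\<Phi> y) k l = g (col N x0 k l))))"
proof -
  obtain BX where BX: "finite BX" "cv.independent BX" "cv.span BX = X"
    by (rule cv.finite_basis_extend[of "unit ` {..<N}" X "{}"])
      (use X cv.independent_empty in \<open>auto simp: span_units\<close>)
  define Q where "Q k l \<alpha> s \<longleftrightarrow> s \<in> X \<and> col N x0 k l = (\<Sum>l'<n. cscale (\<alpha> l') (\<epsilon> k l')) + s" for k l \<alpha> s
  have "\<exists>\<alpha> s. Q k l \<alpha> s" if k: "k < K" for k l
  proof -
    have "col N x0 k l \<in> csum Y X" using XY(2) col_in_ambient by (simp add: csum_commute)
    then obtain y s where ys: "col N x0 k l = y + s" "y \<in> Y" "s \<in> X"
      using X(1) Y(1) by (auto simp: csum_def cv.span_Un cv.span_eq_iff[THEN iffD2])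
    obtain \<alpha> where "y = (\<Sum>l'<n. cscale (\<alpha> l') (\<epsilon> k l'))"
      using span_image_coeffs[of "{..<n}" y "\<epsilon> k"] \<epsilon>[OF k] ys(2) by blast
    then show ?thesis using ys unfolding Q_def by blast
  qed
  then obtain \<alpha> s where "\<And>k l. k < K \<Longrightarrow> Q k l (\<alpha> k l) (s k l)" by metis
  then have sX: "\<And>k l. k < K \<Longrightarrow> s k l \<in> X"
    and dec: "\<And>k l. k < K \<Longrightarrow> col N x0 k l = (\<Sum>l'<n. cscale (\<alpha> k l l') (\<epsilon> k l')) + s k l"
    unfolding Q_def by blast+
  define \<eta> where "\<eta> y k l = (\<Sum>i<n. cscale (y ((k * n + l) * n + i)) (w i))" for y :: "nat \<Rightarrow> complex" and k l
  \<comment> \<open>Entries from \<open>K * N * N\<close> on keep their values, so the flags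
    numbered from \<open>K\<close> on do not move.\<close>
  define \<Phi> where "\<Phi> y j = (if j < K * N * N then
      (\<Sum>l'<n. \<alpha> (j div N div N) (j div N mod N) l' * \<eta> y (j div N div N) l' (j mod N)) +
        s (j div N div N) (j div N mod N) (j mod N)
      else x0 j)" for y j
  have \<Phi>_col: "col N (\<Phi> y) k l = (\<Sum>l'<n. cscale (\<alpha> k l l') (\<eta> y k l')) + s k l" if k: "k < K" and l: "l < N" for y k l
  proof
    fix i
    show "col N (\<Phi> y) k l i = ((\<Sum>l'<n. cscale (\<alpha> k l l') (\<eta> y k l')) + s k l) i"
    proof (cases "i < N")
      case True
      let ?j = "(k * N + l) * N + i"
      have "?j < (k * N + l + 1) * N" using True by simp
      also have "\<dots> \<le> ((k + 1) * N) * N" using l by (intro mult_le_mono1) simp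
      also have "\<dots> \<le> K * N * N" using k by (intro mult_le_mono1) simp
      finally have "?j < K * N * N" .
      moreover have "?j div N = k * N + l" "?j mod N = i" using True by simp_all
      moreover have "(k * N + l) div N = k" "(k * N + l) mod N = l" using l by simp_all
      ultimately show ?thesis using True by (simp add: col_def \<Phi>_def sum_cscale_apply)
    next
      case False
      have "\<eta> y k l' \<in> ambient N" for l'
        unfolding \<eta>_def using Y(2) w cv.span_superset[of "w ` {..<n}"]
        by (intro cv.subspace_sum[OF subspace_ambient] cv.subspace_scale[OF subspace_ambient]) auto
      then have "\<eta> y k l' i = 0" for l' using False by (simp add: ambient_def)
      moreover have "s k l i = 0" using sX[OF k, of l] X(2) False by (auto simp: ambient_def)
      ultimately show ?thesis using False by (simp add: col_def sum_cscale_apply)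
    qed
  qed
  have poly: "(\<lambda>y. \<Phi> y j) \<in> cpoly" for j
    unfolding cpoly_eq_polys \<Phi>_def \<eta>_def sum_cscale_apply
    by (intro polys_if polys.add polys_sum polys.mult polys.const polys.var) auto
  have "\<exists>c. \<epsilon> k l = (\<Sum>i<n. cscale (c i) (w i))" if "k < K" "l < n" for k l
  proof -
    have "\<epsilon> k l \<in> cv.span (w ` {..<n})"
      using \<epsilon>[OF that(1)] w that(2) cv.span_superset[of "\<epsilon> k ` {..<n}"] by auto
    then show ?thesis by (intro span_image_coeffs) auto
  qed
  then obtain Cf where Cf: "\<And>k l. k < K \<Longrightarrow> l < n \<Longrightarrow> \<epsilon> k l = (\<Sum>i<n. cscale (Cf k l i) (w i))" by metis
  \<comment> \<open>The coordinates of \<open>\<epsilon> k\<close> itself in the frame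
    \<open>w\<close>, for which nothing moves.\<close>
  define y0 where "y0 j = Cf (j div n div n) (j div n mod n) (j mod n)" for j
  have \<eta>0: "\<eta> y0 k l = \<epsilon> k l" if "k < K" "l < n" for k l
    unfolding \<eta>_def Cf[OF that] y0_def using that by (intro sum.cong) auto
  have "\<Phi> y0 = x0"
  proof
    fix j
    show "\<Phi> y0 j = x0 j"
    proof (cases "j < K * N * N")
      case True
      let ?k = "j div N div N" and ?l = "j div N mod N" and ?i = "j mod N"
      have N: "N > 0" using True by (cases N) auto
      have k: "?k < K" using True by (simp add: less_mult_imp_div_less)
      have l: "?l < N" "?i < N" using N by auto
      have "\<Phi> y0 j = col N (\<Phi> y0) ?k ?l ?i" using l by (simp add: col_def)
      also have "\<dots> = ((\<Sum>l'<n. cscale (\<alpha> ?k ?l l') (\<eta> y0 ?k l')) + s ?k ?l) ?i"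
        by (simp only: \<Phi>_col[OF k l(1)])
      also have "(\<Sum>l'<n. cscale (\<alpha> ?k ?l l') (\<eta> y0 ?k l')) = (\<Sum>l'<n. cscale (\<alpha> ?k ?l l') (\<epsilon> ?k l'))"
        using \<eta>0[OF k] by (intro sum.cong) auto
      also have "\<dots> + s ?k ?l = col N x0 ?k ?l" by (rule dec[OF k, symmetric])
      also have "\<dots> ?i = x0 j" using l by (simp add: col_def)
      finally show ?thesis .
    next
      case False
      then show ?thesis by (simp add: \<Phi>_def)
    qed
  qed
  moreover have "\<exists>g. Vector_Spaces.linear cscale cscale g \<and> (\<forall>v\<in>X. g v = v) \<and> (\<forall>l<n. g (\<epsilon> k l) = \<eta> y k l) \<and>
       (\<forall>l<N. col N (\<Phi> y) k l = g (col N x0 k l))" if k: "k < K" for y k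
  proof -
    have "lin_indep {..<n} (\<epsilon> k)" using \<epsilon>[OF k] Y(3) by (intro lin_indep_if_dim) simp
    then have ind: "inj_on (\<epsilon> k) {..<n}" "cv.independent (\<epsilon> k ` {..<n})"
      using lin_indep_independent[of "{..<n}" "\<epsilon> k"] by auto
    have un: "cv.independent (BX \<union> \<epsilon> k ` {..<n}) \<and> BX \<inter> \<epsilon> k ` {..<n} = {}"
      using BX ind XY(1) \<epsilon>[OF k] by (intro cv.independent_Un) auto
    define f where "f v = (if v \<in> BX then v else \<eta> y k (inv_into {..<n} (\<epsilon> k) v))" for v
    obtain g where g: "Vector_Spaces.linear cscale cscale g" "\<And>v. v \<in> BX \<union> \<epsilon> k ` {..<n} \<Longrightarrow> g v = f v"
      using cvp.linear_independent_extend[of "BX \<union> \<epsilon> k ` {..<n}" f] un by blast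
    have gX: "g v = v" if "v \<in> X" for v
      using that linear_fixing_on_span[OF g(1), of BX v] g(2) BX(3) by (auto simp: f_def)
    have g\<epsilon>: "g (\<epsilon> k l) = \<eta> y k l" if "l < n" for l
    proof -
      have "\<epsilon> k l \<notin> BX" using un that by blast
      then show ?thesis using g(2)[of "\<epsilon> k l"] that ind(1) by (simp add: f_def)
    qed
    have "col N (\<Phi> y) k l = g (col N x0 k l)" if "l < N" for l
    proof -
      have "g (col N x0 k l) = (\<Sum>l'<n. cscale (\<alpha> k l l') (g (\<epsilon> k l'))) + g (s k l)"
        unfolding dec[OF k, of l] by (simp add: cvp.linear_add[OF g(1)] linear_sum_scale[OF g(1)])
      also have "\<dots> = col N (\<Phi> y) k l"
        unfolding \<Phi>_col[OF k that] gX[OF sX[OF k]] using g\<epsilon> by simp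
      finally show ?thesis by simp
    qed
    then show ?thesis using g(1) gX g\<epsilon> by blast
  qed
  ultimately show ?thesis using poly unfolding \<eta>_def by blast
qed

lemma complement_exists:
  assumes "cv.subspace V" "cv.subspace W" "V \<subseteq> W" "W \<subseteq> ambient N"
  shows "\<exists>S. cv.subspace S \<and> S \<subseteq> W \<and> S \<inter> V = {0} \<and> csum S V = W"
proof -
  obtain B where B: "B \<subseteq> V" "cv.independent B" "finite B" "cv.span B = V"
    by (rule cv.finite_basis_extend[of "unit ` {..<N}" V "{}"])
      (use assms cv.independent_empty in \<open>auto simp: span_units\<close>)
  obtain C where C: "B \<subseteq> C" "C \<subseteq> W" "cv.independent C" "finite C" "cv.span C = W"
    by (rule cv.finite_basis_extend[of "unit ` {..<N}" W B])
      (use assms B in \<open>auto simp: span_units\<close>)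
  let ?S = "cv.span (C - B)"
  have "?S \<subseteq> W" using cv.span_mono[of "C - B" C] C(5) by blast
  moreover have "?S \<inter> V = {0}"
    using cv.span_Diff_Int[OF C(4,3,1)] cv.span_zero[of "C - B"] cv.span_zero[of B] B(4) by blast
  moreover have "csum ?S V = W"
  proof -
    have "csum ?S V = cv.span ((C - B) \<union> B)"
      unfolding csum_def B(4)[symmetric] cv.span_Un cv.span_span ..
    also have "(C - B) \<union> B = C" using C(1) by blast
    finally show ?thesis using C(5) by simp
  qed
  ultimately show ?thesis using cv.subspace_span by blast
qed

lemma flags_of_eq:
  assumes "qdim V0 V1 = n"
  shows "flags_of V0 V1 w y k j =
    cv.span (V0 \<union> (\<lambda>l. \<Sum>i<n. cscale (y ((k * n + l) * n + i)) (w i)) ` {..<j})"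
proof -
  have "{\<Sum>i<n. cscale (y ((k * n + l) * n + i)) (w i) |l. l < j} =
      (\<lambda>l. \<Sum>i<n. cscale (y ((k * n + l) * n + i)) (w i)) ` {..<j}" by auto
  then show ?thesis unfolding flags_of_def Let_def assms by simp
qed

lemma sol_cong:
  assumes "inst_eq V0 V1 (length lams) E E'" "k \<le> qdim V0 V1"
  shows "sol V0 V1 k lams E = sol V0 V1 k lams E'"
proof -
  have "E i (qdim V0 V1 - k + t - part (lams ! i) t) = E' i (qdim V0 V1 - k + t - part (lams ! i) t)"
    if "i < length lams" "t \<in> {1..k}" for i t
    using assms that by (auto simp: inst_eq_def)
  then show ?thesis unfolding sol_def schubert_def by auto
qed

lemma full_image:
  assumes g: "Vector_Spaces.linear cscale cscale g" and X: "cv.subspace X" "X \<subseteq> ambient N" "g ` X = X"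
    and Y: "cv.subspace Y" "Y \<subseteq> ambient N" "g ` Y \<subseteq> Y" and XY: "X \<inter> Y = {0}" "csum X Y = ambient N"
    and U: "g ` ambient N = ambient N"
  shows "g ` Y = Y"
proof (rule subspace_eqI[of _ _ N])
  show s: "cv.subspace (g ` Y)"
    using linear_span_image[OF g, of Y] Y(1) cv.subspace_span by (metis cv.span_eq_iff)
  have "csum X (g ` Y) = ambient N"
    using linear_csum[OF g, of X Y] X(3) XY(2) U by simp
  moreover have "g ` Y \<subseteq> ambient N" using Y by blast
  ultimately have "N + cv.dim (X \<inter> g ` Y) = cv.dim X + cv.dim (g ` Y)"
    using dim_csum[OF X(1) s X(2)] by (simp add: dim_ambient)
  moreover have "N = cv.dim X + cv.dim Y"
    using dim_csum[OF X(1) Y(1) X(2) Y(2)] XY by (simp add: dim_ambient dim_zero)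
  ultimately show "cv.dim Y \<le> cv.dim (g ` Y)" by simp
qed (use Y in auto)

context block_composition
begin

text \<open>Both flags are complete, so \<open>g\<close> carries a basis of the ambient space to a
  basis. This is where the maps of \<open>twist\<close> become invertible.\<close>

lemma moved_flag:
  assumes ok: "flags_ok (Fx x)" "flags_ok (Fx x')" and k: "k < r"
    and g: "Vector_Spaces.linear cscale cscale g" "\<And>l. l < N \<Longrightarrow> col N x' k l = g (col N x k l)"
  shows "\<And>j. j \<le> N \<Longrightarrow> Fx x' k j = g ` Fx x k j" "inj_on g (ambient N)" "g ` ambient N = ambient N"
proof -
  show img: "Fx x' k j = g ` Fx x k j" if "j \<le> N" for j
  proof -
    have "col N x' k ` {..<j} = g ` col N x k ` {..<j}" using g(2) that by force
    then show ?thesis unfolding flags_of_std linear_span_image[OF g(1)] by simp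
  qed
  show "g ` ambient N = ambient N"
    using img[of N] flags_ok_top[OF ok(1) k] flags_ok_top[OF ok(2) k] by simp
  have ind: "lin_indep {..<N} (col N x' k)"
    using flags_okD(3)[OF ok(2) k order_refl] by (intro lin_indep_if_dim) (simp add: flags_of_std)
  have ker: "v = 0" if v: "v \<in> ambient N" "g v = 0" for v
  proof -
    have "v \<in> cv.span (col N x k ` {..<N})" using v(1) flags_ok_top[OF ok(1) k] by (simp add: flags_of_std)
    then obtain c where c: "v = (\<Sum>l<N. cscale (c l) (col N x k l))"
      using span_image_coeffs[of "{..<N}" v] by blast
    have "(\<Sum>l<N. cscale (c l) (col N x' k l)) = g v"
      unfolding c linear_sum_scale[OF g(1)] using g(2) by (intro sum.cong) auto
    then have "(\<Sum>l<N. c l * col N x' k l i) = 0" for i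
      using v(2) sum_cscale_apply[of c "col N x' k" "{..<N}" i] by simp
    from lin_indepD[OF ind this] have "c l = 0" if "l < N" for l using that by blast
    then show "v = 0" unfolding c by (simp add: sum.neutral)
  qed
  show "inj_on g (ambient N)"
  proof (rule inj_onI)
    fix v v' assume "v \<in> ambient N" "v' \<in> ambient N" "g v = g v'"
    then have "v - v' = 0"
      using ker[of "v - v'"] cv.subspace_diff[OF subspace_ambient] by (simp add: cvp.linear_diff[OF g(1)])
    then show "v = v'" by simp
  qed
qed

lemma good_flagsI: "good F \<Longrightarrow> good_flags a1 a2 b1 b2 c d ms ns alphas betas gammas F"
  by (simp add: good_flags_def good_flags_axioms_def block_composition_axioms)

text \<open>The twist acts on \<open>V\<close> and fixes a complement \<open>S\<close>. As the bases
  \<open>\<epsilon> k\<close> are adapted to the induced flags, the moved flags induce on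
  \<open>V\<close> precisely the flags with coordinates \<open>y\<close>; the polynomial
  \<open>f\<close> is the pullback of \<open>fO\<close>.\<close>

lemma realize_base:
  assumes fO: "fO \<in> cpoly" "fO x0 \<noteq> 0" "\<And>x. fO x \<noteq> 0 \<Longrightarrow> good (Fx x)"
  shows "\<exists>w f. frame {0} (Vf (Fx x0)) w \<and> f \<in> cpoly \<and> (\<exists>y. f y \<noteq> 0) \<and>
    (\<forall>y. f y \<noteq> 0 \<longrightarrow> (\<exists>x. fO x \<noteq> 0 \<and> Vf (Fx x) = Vf (Fx x0) \<and>
       inst_eq {0} (Vf (Fx x0)) (2 + q) (Ef (Fx x)) (flags_of {0} (Vf (Fx x0)) w y)))"
proof -
  interpret A: good_flags a1 a2 b1 b2 c d ms ns alphas betas gammas "Fx x0"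
    by (rule good_flagsI[OF fO(3)[OF fO(2)]])
  let ?V = "Vf (Fx x0)" and ?n = "a + b"
  have "\<exists>v. \<forall>j\<le>?n. cv.span (v ` {..<j}) = Ef (Fx x0) k j" if "k < 2 + q" for k
    using A.Ef_facts[OF that] A.Ef_mono[OF that] A.V_sub by (intro adapted_basis[of _ _ N]) blast+
  then obtain \<epsilon> where \<epsilon>: "\<And>k j. k < 2 + q \<Longrightarrow> j \<le> ?n \<Longrightarrow> cv.span (\<epsilon> k ` {..<j}) = Ef (Fx x0) k j" by metis
  have EV: "Ef (Fx x0) k ?n = ?V" if "k < 2 + q" for k
    using A.Ef_facts[OF that order_refl] A.V_dim A.V_subspace A.V_sub by (intro subspace_eqI[of _ _ N]) auto
  have \<epsilon>V: "cv.span (\<epsilon> k ` {..<?n}) = ?V" if "k < 2 + q" for k using \<epsilon>[OF that order_refl] EV[OF that] by simp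
  let ?w = "\<epsilon> 0"
  have wV: "cv.span (?w ` {..<?n}) = ?V" by (rule \<epsilon>V) simp
  have frame: "frame {0} ?V ?w"
    using wV cv.subspace_0[OF A.V_subspace] A.V_subspace by (simp add: frame_def A.qdim_V dim_zero)
  obtain S where S: "cv.subspace S" "S \<subseteq> ambient N" "S \<inter> ?V = {0}" "csum S ?V = ambient N"
    using complement_exists[OF A.V_subspace subspace_ambient A.V_sub] by blast
  obtain \<Phi> y0 where \<Phi>: "\<And>i. (\<lambda>y. \<Phi> y i) \<in> cpoly" "\<Phi> y0 = x0"
    and g: "\<And>y k. k < 2 + q \<Longrightarrow> \<exists>g. Vector_Spaces.linear cscale cscale g \<and> (\<forall>v\<in>S. g v = v) \<and>
       (\<forall>l<?n. g (\<epsilon> k l) = (\<Sum>i<?n. cscale (y ((k * ?n + l) * ?n + i)) (?w i))) \<and>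
       (\<forall>l<N. col N (\<Phi> y) k l = g (col N x0 k l))"
    using twist[where K = "2 + q" and \<epsilon> = \<epsilon> and ?x0.0 = x0, OF S(1,2) A.V_subspace A.V_sub A.V_dim S(3,4) wV \<epsilon>V] by blast
  let ?f = "\<lambda>y. fO (\<Phi> y)"
  have "?f \<in> cpoly"
    unfolding cpoly_eq_polys
    by (rule polys_compose[where A = UNIV and f = fO and p = \<Phi>]) (use \<Phi>(1) fO(1) in \<open>simp_all add: cpoly_eq_polys\<close>)
  moreover have "\<exists>y. ?f y \<noteq> 0" using \<Phi>(2) fO(2) by (intro exI[of _ y0]) simp
  moreover have "\<exists>x. fO x \<noteq> 0 \<and> Vf (Fx x) = ?V \<and> inst_eq {0} ?V (2 + q) (Ef (Fx x)) (flags_of {0} ?V ?w y)"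
    if y: "?f y \<noteq> 0" for y
  proof -
    let ?x = "\<Phi> y"
    interpret B: good_flags a1 a2 b1 b2 c d ms ns alphas betas gammas "Fx ?x"
      by (rule good_flagsI[OF fO(3)[OF y]])
    let ?\<eta> = "\<lambda>k l. \<Sum>i<?n. cscale (y ((k * ?n + l) * ?n + i)) (?w i)"
    have \<eta>V: "?\<eta> k l \<in> ?V" for k l
      unfolding wV[symmetric] by (intro cv.span_sum cv.span_scale cv.span_base) auto
    define Q where "Q k g \<longleftrightarrow> (\<forall>j\<le>N. Fx ?x k j = g ` Fx x0 k j) \<and> inj_on g (ambient N) \<and> g ` ?V = ?V \<and>
        (\<forall>j\<le>?n. g ` Ef (Fx x0) k j = cv.span (?\<eta> k ` {..<j}))" for k g
    have "\<exists>g. Q k g" if k: "k < 2 + q" for k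
    proof -
      have kr: "k < r" using k by (simp add: r_def)
      obtain g where g: "Vector_Spaces.linear cscale cscale g" "\<forall>v\<in>S. g v = v" "\<forall>l<?n. g (\<epsilon> k l) = ?\<eta> k l"
        "\<forall>l<N. col N ?x k l = g (col N x0 k l)" using g[OF k, of y] by blast
      have m: "\<And>j. j \<le> N \<Longrightarrow> Fx ?x k j = g ` Fx x0 k j" "inj_on g (ambient N)" "g ` ambient N = ambient N"
        using moved_flag[OF A.ok B.ok kr g(1)] g(4) by blast+
      have img: "g ` Ef (Fx x0) k j = cv.span (?\<eta> k ` {..<j})" if j: "j \<le> ?n" for j
      proof -
        have "g ` \<epsilon> k ` {..<j} = ?\<eta> k ` {..<j}"
          unfolding image_image by (rule image_cong[OF refl]) (use g(3) j in simp)
        then show ?thesis unfolding \<epsilon>[OF k j, symmetric] linear_span_image[OF g(1)] by simp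
      qed
      have "g ` ?V \<subseteq> ?V"
        using img[OF order_refl] \<eta>V unfolding EV[OF k] by (simp only:) (intro cv.span_minimal A.V_subspace, blast)
      moreover have "g ` S = S" using g(2) by force
      ultimately have "g ` ?V = ?V"
        using full_image[OF g(1) S(1,2) _ A.V_subspace A.V_sub _ S(3,4) m(3)] by blast
      then have "Q k g" unfolding Q_def using m img by (intro conjI allI impI)
      then show ?thesis by blast
    qed
    then obtain g where Q: "\<And>k. k < 2 + q \<Longrightarrow> Q k (g k)" by metis
    note g = Q[unfolded Q_def, THEN conjunct1, rule_format]
      Q[unfolded Q_def, THEN conjunct2, THEN conjunct1]
      Q[unfolded Q_def, THEN conjunct2, THEN conjunct2, THEN conjunct1]
      Q[unfolded Q_def, THEN conjunct2, THEN conjunct2, THEN conjunct2, rule_format]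
    have q2: "0 < 2 + q" "1 < 2 + q" by auto
    have "Vf (Fx ?x) \<subseteq> ?V"
    proof -
      have "Fx ?x 0 (a1 + b2) \<subseteq> ?V"
        unfolding g(1)[OF q2(1) A.index_le(3)] using image_mono[OF A.A1_V, of "g 0"] g(3)[OF q2(1)] by simp
      moreover have "Fx ?x 1 (a2 + b1) \<subseteq> ?V"
        unfolding g(1)[OF q2(2) A.index_le(4)] using image_mono[OF A.A2_V, of "g 1"] g(3)[OF q2(2)] by simp
      ultimately show ?thesis unfolding Vf_def[of "Fx ?x"] by (rule csum_least[OF A.V_subspace])
    qed
    then have V': "Vf (Fx ?x) = ?V"
      using B.V_dim A.V_dim B.V_subspace A.V_subspace A.V_sub by (intro subspace_eqI[of _ _ N]) auto
    have "Ef (Fx ?x) k j = flags_of {0} ?V ?w y k j" if k: "k < 2 + q" and j: "j \<le> ?n" for k j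
    proof -
      have kr: "k < r" using k by (simp add: r_def)
      have jN: "j \<le> N" "j + c + d \<le> N" using j by (auto simp: N_def)
      \<comment> \<open>Each flag has its own map, but every map is injective and preserves
        \<open>?V\<close>, so the induced step is moved by the same map.\<close>
      have "?V \<inter> Fx ?x k (j + c + d) = g k ` (?V \<inter> Fx x0 k (j + c + d))"
        using inj_on_image_Int[OF g(2)[OF k] A.V_sub flags_okD(2)[OF A.ok kr jN(2)]]
          g(1)[OF k jN(2)] g(3)[OF k] by simp
      then have "Ef (Fx ?x) k j = g k ` Ef (Fx x0) k j"
        unfolding Ef_def V' using g(1)[OF k jN(1)] by auto
      also have "\<dots> = cv.span ({0} \<union> ?\<eta> k ` {..<j})" using g(4)[OF k j] by simp
      also have "\<dots> = flags_of {0} ?V ?w y k j" by (rule flags_of_eq[OF A.qdim_V, symmetric])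
      finally show ?thesis .
    qed
    then show ?thesis using y V' by (intro exI[of _ ?x]) (simp add: inst_eq_def A.qdim_V)
  qed
  ultimately show ?thesis using frame by blast
qed

text \<open>The twist fixes \<open>V\<close> pointwise, hence also the base flags and
  \<open>h\<close>, and acts on a complement \<open>S\<close> of \<open>h\<close> in
  \<open>T h\<close>. As \<open>S\<close> is a complement of \<open>V\<close> too, it stands for the
  quotient by \<open>V\<close>, and the fibre flags acquire the coordinates
  \<open>y\<close>.\<close>

lemma realize_fibre:
  assumes fO: "fO \<in> cpoly" "fO x1 \<noteq> 0" "\<And>x. fO x \<noteq> 0 \<Longrightarrow> good (Fx x)"
    and E: "inst_eq {0} (Vf (Fx x1)) (2 + q) (Ef (Fx x1)) E"
    and h: "h \<in> sol {0} (Vf (Fx x1)) a lam E"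
  shows "general (Vf (Fx x1)) (ambient N) (\<lambda>G. \<exists>x. fO x \<noteq> 0 \<and> Vf (Fx x) = Vf (Fx x1) \<and>
    inst_eq {0} (Vf (Fx x1)) (2 + q) (Ef (Fx x)) E \<and> inst_eq (Vf (Fx x1)) (ambient N) r (Fhf (Fx x) h) G)"
proof -
  interpret A: good_flags a1 a2 b1 b2 c d ms ns alphas betas gammas "Fx x1"
    by (rule good_flagsI[OF fO(3)[OF fO(2)]])
  let ?V = "Vf (Fx x1)" and ?n = "c + d" and ?T = "Tf (Fx x1) h"
  have "sol {0} ?V a lam (Ef (Fx x1)) = sol {0} ?V a lam E"
    by (rule sol_cong) (use E in \<open>auto simp: length_lam A.qdim_V\<close>)
  then have hs: "h \<in> hsol (Fx x1)" using h A.sol_lam by blast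
  note h' = A.hsolD[OF hs] and hV = A.hsol_sub_V[OF hs]
  obtain S where S: "cv.subspace S" "S \<subseteq> ?T" "S \<inter> h = {0}" "csum S h = ?T"
    using complement_exists[OF h'(1) A.T_subspace[OF hs] A.h_T[OF hs] A.T_sub[OF hs]] by blast
  have SU: "S \<subseteq> ambient N" using S(2) A.T_sub[OF hs] by blast
  have Sd: "cv.dim S = ?n"
    using dim_csum[OF S(1) h'(1) SU h'(2)] S(3,4) A.T_dim[OF hs] h'(3) by (simp add: dim_zero)
  have VS0: "?V \<inter> S = {0}"
    using S(2,3) A.T_V[OF hs] cv.subspace_0[OF S(1)] cv.subspace_0[OF A.V_subspace] by blast
  have VS: "csum ?V S = ambient N"
    using dim_csum[OF A.V_subspace S(1) A.V_sub SU] VS0 A.V_dim Sd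
    by (intro subspace_eqI[of _ _ N] subspace_csum subspace_ambient csum_ambient A.V_sub SU)
      (auto simp: dim_ambient dim_zero N_def)
  \<comment> \<open>The fibre flags, carried from the quotient by \<open>V\<close> to its complement
    \<open>S\<close>.\<close>
  define L where "L k l = S \<inter> Fhf (Fx x1) h k l" for k l
  have Lf: "cv.subspace (L k l) \<and> L k l \<subseteq> ambient N \<and> cv.dim (L k l) = l" if "k < r" "l \<le> ?n" for k l
  proof -
    note Fh = A.Fhf_facts[OF hs that]
    have "csum ?V S \<subseteq> csum S (Fhf (Fx x1) h k l)"
      unfolding csum_commute[of ?V S] using Fh(2) by (intro csum_mono) auto
    then have "csum S (Fhf (Fx x1) h k l) = ambient N"
      using VS csum_ambient[OF SU Fh(3)] by blast
    then show ?thesis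
      using dim_csum[OF S(1) Fh(1) SU Fh(3)] Sd Fh(4) SU S(1) Fh(1)
      by (auto simp: L_def dim_ambient N_def cv.subspace_inter)
  qed
  have Lm: "L k l \<subseteq> L k (Suc l)" if "k < r" "l < ?n" for k l
  proof -
    have "Fhf (Fx x1) h k l \<subseteq> Fhf (Fx x1) h k (Suc l)"
      using A.Fhf_instance[OF hs] that by (simp add: is_instance_def is_flag_def A.qdim_U)
    then show ?thesis unfolding L_def by blast
  qed
  have "\<exists>v. \<forall>j\<le>?n. cv.span (v ` {..<j}) = L k j" if "k < r" for k
    using Lf[OF that] Lm[OF that] by (intro adapted_basis[of _ _ N]) blast+
  then obtain \<sigma> where \<sigma>: "\<And>k j. k < r \<Longrightarrow> j \<le> ?n \<Longrightarrow> cv.span (\<sigma> k ` {..<j}) = L k j" by metis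
  have LS: "L k ?n = S" if "k < r" for k
    using Lf[OF that order_refl] Sd S(1) SU by (intro subspace_eqI[of _ _ N]) (auto simp: L_def)
  have \<sigma>S: "cv.span (\<sigma> k ` {..<?n}) = S" if "k < r" for k using \<sigma>[OF that order_refl] LS[OF that] by simp
  let ?w = "\<sigma> 0"
  have wS: "cv.span (?w ` {..<?n}) = S" by (rule \<sigma>S[OF r_gt(1)])
  have span_V: "cv.span (?V \<union> Z) = csum ?V (cv.span Z)" for Z
    unfolding csum_def cv.span_Un cv.span_span ..
  have "cv.dim ?V \<le> cv.dim (ambient N)"
    using dim_le_ambient[OF A.V_subspace A.V_sub] by (simp add: dim_ambient)
  then have frame: "frame ?V (ambient N) ?w"
    using A.V_subspace A.V_sub subspace_ambient VS by (simp add: frame_def A.qdim_U span_V wS)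
  obtain \<Phi> y0 where \<Phi>: "\<And>i. (\<lambda>y. \<Phi> y i) \<in> cpoly" "\<Phi> y0 = x1"
    and g: "\<And>y k. k < r \<Longrightarrow> \<exists>g. Vector_Spaces.linear cscale cscale g \<and> (\<forall>v\<in>?V. g v = v) \<and>
       (\<forall>l<?n. g (\<sigma> k l) = (\<Sum>i<?n. cscale (y ((k * ?n + l) * ?n + i)) (?w i))) \<and>
       (\<forall>l<N. col N (\<Phi> y) k l = g (col N x1 k l))"
    using twist[where K = r and \<epsilon> = \<sigma> and ?x0.0 = x1, OF A.V_subspace A.V_sub S(1) SU Sd VS0 VS wS \<sigma>S] by blast
  let ?f = "\<lambda>y. fO (\<Phi> y)"
  have "?f \<in> cpoly"
    unfolding cpoly_eq_polys
    by (rule polys_compose[where A = UNIV and f = fO and p = \<Phi>]) (use \<Phi>(1) fO(1) in \<open>simp_all add: cpoly_eq_polys\<close>)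
  moreover have "\<exists>y. ?f y \<noteq> 0" using \<Phi>(2) fO(2) by (intro exI[of _ y0]) simp
  moreover have "\<exists>x. fO x \<noteq> 0 \<and> Vf (Fx x) = ?V \<and> inst_eq {0} ?V (2 + q) (Ef (Fx x)) E \<and>
      inst_eq ?V (ambient N) r (Fhf (Fx x) h) (flags_of ?V (ambient N) ?w y)"
    if y: "?f y \<noteq> 0" for y
  proof -
    let ?x = "\<Phi> y"
    interpret B: good_flags a1 a2 b1 b2 c d ms ns alphas betas gammas "Fx ?x"
      by (rule good_flagsI[OF fO(3)[OF y]])
    let ?\<zeta> = "\<lambda>k l. \<Sum>i<?n. cscale (y ((k * ?n + l) * ?n + i)) (?w i)"
    have \<zeta>S: "?\<zeta> k l \<in> S" for k l
      unfolding wS[symmetric] by (intro cv.span_sum cv.span_scale cv.span_base) auto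
    define Q where "Q k g \<longleftrightarrow> Vector_Spaces.linear cscale cscale g \<and> (\<forall>v\<in>?V. g v = v) \<and>
        (\<forall>j\<le>N. Fx ?x k j = g ` Fx x1 k j) \<and> inj_on g (ambient N) \<and> g ` ?T = ?T \<and>
        (\<forall>j\<le>?n. g ` L k j = cv.span (?\<zeta> k ` {..<j}))" for k g
    have "\<exists>g. Q k g" if k: "k < r" for k
    proof -
      obtain g where g: "Vector_Spaces.linear cscale cscale g" "\<forall>v\<in>?V. g v = v" "\<forall>l<?n. g (\<sigma> k l) = ?\<zeta> k l"
        "\<forall>l<N. col N ?x k l = g (col N x1 k l)" using g[OF k, of y] by blast
      have m: "\<And>j. j \<le> N \<Longrightarrow> Fx ?x k j = g ` Fx x1 k j" "inj_on g (ambient N)" "g ` ambient N = ambient N"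
        using moved_flag[OF A.ok B.ok k g(1)] g(4) by blast+
      have img: "g ` L k j = cv.span (?\<zeta> k ` {..<j})" if j: "j \<le> ?n" for j
      proof -
        have "g ` \<sigma> k ` {..<j} = ?\<zeta> k ` {..<j}"
          unfolding image_image by (rule image_cong[OF refl]) (use g(3) j in simp)
        then show ?thesis unfolding \<sigma>[OF k j, symmetric] linear_span_image[OF g(1)] by simp
      qed
      have "g ` S \<subseteq> S"
        using img[OF order_refl] \<zeta>S unfolding LS[OF k] by (simp only:) (intro cv.span_minimal S(1), blast)
      moreover have "g ` ?V = ?V" using g(2) by force
      ultimately have "g ` S = S"
        using full_image[OF g(1) A.V_subspace A.V_sub _ S(1) SU _ VS0 VS m(3)] by blast
      moreover have "g ` h = h" using g(2) hV by force
      ultimately have "g ` ?T = ?T" unfolding S(4)[symmetric] linear_csum[OF g(1)] by simp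
      then have "Q k g" unfolding Q_def using g(1,2) m img by (intro conjI allI impI)
      then show ?thesis by blast
    qed
    then obtain g where Q: "\<And>k. k < r \<Longrightarrow> Q k (g k)" by metis
    note g = Q[unfolded Q_def, THEN conjunct1]
      Q[unfolded Q_def, THEN conjunct2, THEN conjunct1, rule_format]
      Q[unfolded Q_def, THEN conjunct2, THEN conjunct2, THEN conjunct1, rule_format]
      Q[unfolded Q_def, THEN conjunct2, THEN conjunct2, THEN conjunct2, THEN conjunct1]
      Q[unfolded Q_def, THEN conjunct2, THEN conjunct2, THEN conjunct2, THEN conjunct2, THEN conjunct1]
      Q[unfolded Q_def, THEN conjunct2, THEN conjunct2, THEN conjunct2, THEN conjunct2, THEN conjunct2, rule_format]
    have gid: "g k ` Z = Z" if "k < r" "Z \<subseteq> ?V" for k Z using g(2)[OF that(1)] that(2) by force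
    have V': "Vf (Fx ?x) = ?V"
      unfolding Vf_def[of "Fx ?x"] g(3)[OF r_gt(1) A.index_le(3)] g(3)[OF r_gt(2) A.index_le(4)]
        gid[OF r_gt(1) A.A1_V] gid[OF r_gt(2) A.A2_V] by (simp add: Vf_def)
    have E': "Ef (Fx ?x) k j = Ef (Fx x1) k j" if k: "k < 2 + q" and j: "j \<le> a + b" for k j
    proof -
      have kr: "k < r" using k by (simp add: r_def)
      have jN: "j \<le> N" "j + c + d \<le> N" using j by (auto simp: N_def)
      have "?V \<inter> Fx ?x k (j + c + d) = g k ` (?V \<inter> Fx x1 k (j + c + d))"
        using inj_on_image_Int[OF g(4)[OF kr] A.V_sub flags_okD(2)[OF A.ok kr jN(2)]] g(3)[OF kr jN(2)]
          gid[OF kr order_refl] by simp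
      then have 1: "?V \<inter> Fx ?x k (j + c + d) = ?V \<inter> Fx x1 k (j + c + d)" using gid[OF kr] by simp
      have 2: "Fx ?x k j = Fx x1 k j" if "Ef (Fx x1) k j = Fx x1 k j"
        using g(3)[OF kr jN(1)] gid[OF kr] A.Ef_facts(2)[OF k j] that by simp
      show ?thesis using 1 2 unfolding Ef_def V' by auto
    qed
    have EE: "inst_eq {0} ?V (2 + q) (Ef (Fx ?x)) E"
      using E E' by (simp add: inst_eq_def A.qdim_V)
    have "sol {0} ?V a lam (Ef (Fx ?x)) = sol {0} ?V a lam E"
      by (rule sol_cong) (use EE in \<open>auto simp: length_lam A.qdim_V\<close>)
    then have hs': "h \<in> hsol (Fx ?x)" using h B.sol_lam V' by simp
    \<comment> \<open>The sums \<open>h + G_j\<close> are moved by different maps, but each map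
      preserves \<open>?T\<close> and \<open>h\<close>, so \<open>?T\<close> stays inside every sum.
      Equal dimensions then give equality.\<close>
    have "?T \<subseteq> Tf (Fx ?x) h"
    proof
      fix v assume v: "v \<in> ?T"
      have "v \<in> csum h (Gf (Fx ?x) j)" if j: "j < q" for j
      proof -
        have jr: "2 + j < r" by (rule r_gt(3)[OF j])
        have "?T \<subseteq> csum h (Gf (Fx x1) j)" using j by (auto simp: Tf_def)
        then have "g (2 + j) ` ?T \<subseteq> csum (g (2 + j) ` h) (g (2 + j) ` Gf (Fx x1) j)"
          unfolding linear_csum[OF g(1)[OF jr], symmetric] by blast
        moreover have "g (2 + j) ` Gf (Fx x1) j = Gf (Fx ?x) j"
          unfolding Gf_def by (rule g(3)[OF jr, symmetric]) simp
        ultimately show ?thesis using g(5)[OF jr] gid[OF jr hV] v by auto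
      qed
      then show "v \<in> Tf (Fx ?x) h" using v by (auto simp: Tf_def)
    qed
    then have T': "Tf (Fx ?x) h = ?T"
      using A.T_dim[OF hs] B.T_dim[OF hs'] A.T_subspace[OF hs] B.T_subspace[OF hs'] B.T_sub[OF hs']
      by (intro subspace_eqI[symmetric, of _ _ N]) auto
    have "Fhf (Fx ?x) h k l = flags_of ?V (ambient N) ?w y k l" if k: "k < r" and l: "l \<le> ?n" for k l
    proof -
      let ?i = "sh k + l"
      have le: "?i \<le> N" using l sh_le[of k] by simp
      note Fh = A.Fhf_facts[OF hs k l]
      have "?T \<inter> Fx ?x k ?i = g k ` (?T \<inter> Fx x1 k ?i)"
        using inj_on_image_Int[OF g(4)[OF k] A.T_sub[OF hs] flags_okD(2)[OF A.ok k le]] g(3)[OF k le] g(5)[OF k]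
        by simp
      then have "Fhf (Fx ?x) h k l = g k ` Fhf (Fx x1) h k l"
        unfolding Fhf_def V' T' linear_csum[OF g(1)[OF k]] gid[OF k order_refl] by simp
      also have "Fhf (Fx x1) h k l = csum ?V (L k l)"
        using csum_modular[OF A.V_subspace S(1) Fh(1,2)] VS Fh(3) by (auto simp: L_def Int_absorb2 Int_commute)
      also have "g k ` csum ?V (L k l) = csum ?V (cv.span (?\<zeta> k ` {..<l}))"
        unfolding linear_csum[OF g(1)[OF k]] gid[OF k order_refl] g(6)[OF k l] ..
      also have "\<dots> = flags_of ?V (ambient N) ?w y k l"
        unfolding flags_of_eq[OF A.qdim_U] span_V ..
      finally show ?thesis .
    qed
    then have "inst_eq ?V (ambient N) r (Fhf (Fx ?x) h) (flags_of ?V (ambient N) ?w y)"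
      by (simp add: inst_eq_def A.qdim_U)
    then show ?thesis using y V' EE by blast
  qed
  ultimately show ?thesis unfolding general_def using frame by blast
qed

lemma fibered_composition: "fibered a b c d kap lam rho"
proof -
  obtain fO x' where fO: "fO \<in> cpoly" "fO x' \<noteq> 0" "\<And>x. fO x \<noteq> 0 \<Longrightarrow> good (Fx x)"
    using generic_good unfolding generic_def by blast
  have inst: "is_instance {0} (ambient N) r (Fx x) \<and>
      cv.subspace (Vf (Fx x)) \<and> Vf (Fx x) \<subseteq> ambient N \<and> cv.dim (Vf (Fx x)) = a + b \<and>
      is_instance {0} (Vf (Fx x)) (2 + q) (Ef (Fx x)) \<and>
      (\<forall>H\<in>sol {0} (ambient N) (a + c) kap (Fx x). H \<inter> Vf (Fx x) \<in> sol {0} (Vf (Fx x)) a lam (Ef (Fx x))) \<and>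
      (\<forall>h\<in>sol {0} (Vf (Fx x)) a lam (Ef (Fx x)).
         is_instance (Vf (Fx x)) (ambient N) r (Fhf (Fx x) h) \<and>
         (\<forall>H\<in>sol {0} (ambient N) (a + c) kap (Fx x). H \<inter> Vf (Fx x) = h \<longrightarrow>
            csum H (Vf (Fx x)) \<in> sol (Vf (Fx x)) (ambient N) c rho (Fhf (Fx x) h))) \<and>
      bij_betw (\<lambda>H. (H \<inter> Vf (Fx x), csum H (Vf (Fx x)))) (sol {0} (ambient N) (a + c) kap (Fx x))
        (SIGMA h:sol {0} (Vf (Fx x)) a lam (Ef (Fx x)). sol (Vf (Fx x)) (ambient N) c rho (Fhf (Fx x) h))"
    if x: "fO x \<noteq> 0" for x
  proof -
    interpret A: good_flags a1 a2 b1 b2 c d ms ns alphas betas gammas "Fx x"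
      by (rule good_flagsI[OF fO(3)[OF x]])
    have "is_instance {0} (ambient N) r (Fx x)"
      unfolding is_instance_def is_flag_def qdim_ambient
      using A.D cv.subspace_0[OF A.D(1)] by (auto simp: dim_zero)
    then show ?thesis
      using A.V_subspace A.V_sub A.V_dim A.E_instance A.fibration A.Fhf_instance
        A.project_solution A.image_solution(1)
      by (auto simp: A.sol_lam sol_kap[OF A.ok])
  qed
  have gen: "general {0} (Vf (Fx x0)) (\<lambda>E. \<exists>x. fO x \<noteq> 0 \<and> Vf (Fx x) = Vf (Fx x0) \<and>
        inst_eq {0} (Vf (Fx x0)) (2 + q) (Ef (Fx x)) E) \<and>
      general {0} (Vf (Fx x0)) (\<lambda>E. \<forall>h\<in>sol {0} (Vf (Fx x0)) a lam E.
        general (Vf (Fx x0)) (ambient N) (\<lambda>G. \<exists>x. fO x \<noteq> 0 \<and> Vf (Fx x) = Vf (Fx x0) \<and>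
          inst_eq {0} (Vf (Fx x0)) (2 + q) (Ef (Fx x)) E \<and>
          inst_eq (Vf (Fx x0)) (ambient N) r (Fhf (Fx x) h) G))"
    if x0: "fO x0 \<noteq> 0" for x0
  proof -
    obtain w f where wf: "frame {0} (Vf (Fx x0)) w" "f \<in> cpoly" "\<exists>y. f y \<noteq> 0"
      and y: "\<And>y. f y \<noteq> 0 \<Longrightarrow> \<exists>x. fO x \<noteq> 0 \<and> Vf (Fx x) = Vf (Fx x0) \<and>
        inst_eq {0} (Vf (Fx x0)) (2 + q) (Ef (Fx x)) (flags_of {0} (Vf (Fx x0)) w y)"
      using realize_base[OF fO(1) x0 fO(3)] by blast
    have "general (Vf (Fx x0)) (ambient N) (\<lambda>G. \<exists>x. fO x \<noteq> 0 \<and> Vf (Fx x) = Vf (Fx x0) \<and>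
          inst_eq {0} (Vf (Fx x0)) (2 + q) (Ef (Fx x)) (flags_of {0} (Vf (Fx x0)) w y) \<and>
          inst_eq (Vf (Fx x0)) (ambient N) r (Fhf (Fx x) h) G)"
      if fy: "f y \<noteq> 0" and h: "h \<in> sol {0} (Vf (Fx x0)) a lam (flags_of {0} (Vf (Fx x0)) w y)" for y h
    proof -
      \<comment> \<open>The second twist starts from this \<open>x\<close>, which realises the
        chosen base flags, and not from \<open>x0\<close>: the base flags then stay fixed while the
        fibre flags vary.\<close>
      obtain x where x: "fO x \<noteq> 0" "Vf (Fx x) = Vf (Fx x0)"
        "inst_eq {0} (Vf (Fx x0)) (2 + q) (Ef (Fx x)) (flags_of {0} (Vf (Fx x0)) w y)"
        using y[OF fy] by blast
      show ?thesis
        using realize_fibre[OF fO(1) x(1) fO(3), of "flags_of {0} (Vf (Fx x0)) w y" h] x(2,3) h by simp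
    qed
    then show ?thesis unfolding general_def[of "{0}"] using wf y by blast
  qed
  show ?thesis
    unfolding fibered_def Let_def N_def[symmetric] length_kap length_lam length_rho
    using frame_std fO(1,2) inst gen
    by (intro exI[of _ unit] exI[of _ fO] exI[of _ Vf] exI[of _ Ef] exI[of _ Fhf]) blast
qed

end

theorem theorem3p8:
  fixes a1 a2 b1 b2 c d :: nat
    and ms ns :: "nat list"
    and alphas betas gammas :: "nat list list"
  assumes "sum_list ms = b1" and "sum_list ns = b2"
    and "length alphas = 2"
    and "length betas = length ms + length ns"
    and "schubert_problem c d (alphas @ betas @ gammas)"
  shows "fibered (a1 + a2) (b1 + b2) c d
           (compose [box a1 b1, box a2 b2] (map (box a2) ms @ map (box a1) ns)
              [a1, a2] (ms @ ns) c d alphas betas gammas)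
           (block_column a1 a2 b1 b2 ms ns)
           (alphas @ betas @ gammas)"
proof -
  interpret block_composition a1 a2 b1 b2 c d ms ns alphas betas gammas
    using assms by unfold_locales
  show ?thesis
    using fibered_composition unfolding a_def b_def kap_def lam_def rho_def .
qed

end
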